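(* For any norm $\nu$ on $\mathbb{R}^d$, $d=m+n$, the set $\widehat D_\nu\subset M_{m,n}(\mathbb{R})$ has Lebesgue measure zero.
   Context: $B_\nu(r)=\{\mathbf{x}\in\mathbb{R}^d:\nu(\mathbf{x})<r\}$; $\Delta_\nu$ is the smallest covolume of a lattice in $\mathbb{R}^d$ meeting $B_\nu(1)$ only in $0$. For positive $\psi$, $A\in D_\nu(\psi)$ means: for every sufficiently large $t>0$ there exist $\mathbf{q}\in\mathbb{Z}^n\smallsetminus\{0\}$, $\mathbf{p}\in\mathbb{Z}^m$ with $(A\mathbf{q}-\mathbf{p},\mathbf{q})\in\operatorname{diag}(\psi(t)I_m,tI_n)B_\nu(\Delta_\nu^{-1/d})$. $\widehat D_\nu=\bigcup_{c<1}D_\nu(c\psi_{n/m})$ with $\psi_{n/m}(t)=t^{-n/m}$. *)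

theory Defs
  imports "HOL-Analysis.Analysis"
begin

definition is_norm :: "('a::real_vector \<Rightarrow> real) \<Rightarrow> bool" where
  "is_norm \<nu> \<longleftrightarrow>
     (\<forall>x. 0 \<le> \<nu> x) \<and> (\<forall>x. \<nu> x = 0 \<longleftrightarrow> x = 0) \<and>
     (\<forall>a x. \<nu> (a *\<^sub>R x) = \<bar>a\<bar> * \<nu> x) \<and>
     (\<forall>x y. \<nu> (x + y) \<le> \<nu> x + \<nu> y)"

definition nu_ball :: "('a::real_vector \<Rightarrow> real) \<Rightarrow> real \<Rightarrow> 'a set" where
  "nu_ball \<nu> r = {x. \<nu> x < r}"

definition int_vecs :: "(real^'k::finite) set" where
  "int_vecs = {z. \<forall>i. z $ i \<in> \<int>}"

definition lattice_basis :: "real^'k^'k \<Rightarrow> (real^'k::finite) set \<Rightarrow> bool" where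
  "lattice_basis g L \<longleftrightarrow> invertible g \<and> L = (\<lambda>z. g *v z) ` int_vecs"

definition is_lattice :: "(real^'k::finite) set \<Rightarrow> bool" where
  "is_lattice L \<longleftrightarrow> (\<exists>g. lattice_basis g L)"

text \<open>The covolume does not depend on the basis, see \<open>covolume_eq\<close> below.\<close>

definition covolume :: "(real^'k::finite) set \<Rightarrow> real" where
  "covolume L = (THE v. \<exists>g. lattice_basis g L \<and> v = \<bar>det g\<bar>)"

text \<open>The smallest covolume is written as an infimum; the two agree because the minimum is
  attained (Mahler compactness).\<close>

definition critical_covolume :: "(real^'k::finite \<Rightarrow> real) \<Rightarrow> real" where
  "critical_covolume \<nu> = Inf {covolume L | L. is_lattice L \<and> L \<inter> nu_ball \<nu> 1 = {0}}"

text \<open>With \<open>d = m + n\<close>, the space \<open>\<real>\<^sup>d\<close> is \<^typ>\<open>real^('m + 'n)\<close>: the \<open>Inl\<close> coordinates are the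
  first \<open>m\<close> ones and the \<open>Inr\<close> coordinates the last \<open>n\<close>.\<close>

definition join_vec :: "real^'m \<Rightarrow> real^'n \<Rightarrow> real^('m::finite + 'n::finite)" where
  "join_vec x y = (\<chi> i. case i of Inl j \<Rightarrow> x $ j | Inr k \<Rightarrow> y $ k)"

definition block_diag :: "real \<Rightarrow> real \<Rightarrow> real^('m::finite + 'n::finite)^('m + 'n)" where
  "block_diag a b =
     (\<chi> i j. if i = j then (case i of Inl _ \<Rightarrow> a | Inr _ \<Rightarrow> b) else 0)"

definition D_set ::
  "(real^('m::finite + 'n::finite) \<Rightarrow> real) \<Rightarrow> (real \<Rightarrow> real) \<Rightarrow> (real^'n^'m) set" where
  "D_set \<nu> \<psi> = {A. \<forall>\<^sub>F t in at_top. \<exists>q \<in> int_vecs - {0}. \<exists>p \<in> int_vecs.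
     join_vec (A *v q - p) q \<in>
       (\<lambda>x. block_diag (\<psi> t) t *v x) `
         nu_ball \<nu> (critical_covolume \<nu> powr (- 1 / real CARD('m + 'n)))}"

definition psi_exp :: "real \<Rightarrow> real \<Rightarrow> real" where
  "psi_exp a t = t powr (- a)"

text \<open>The sets \<^const>\<open>D_set\<close> are only meant for positive \<open>\<psi>\<close>, so \<open>c\<close> ranges over \<open>0 < c < 1\<close>.\<close>

definition D_hat :: "(real^('m::finite + 'n::finite) \<Rightarrow> real) \<Rightarrow> (real^'n^'m) set" where
  "D_hat \<nu> = (\<Union>c\<in>{0<..<1}. D_set \<nu> (\<lambda>t. c * psi_exp (real CARD('n) / real CARD('m)) t))"

lemma lattice_basis_abs_det_le:
  fixes g h :: "real^'k::finite^'k"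
  assumes "lattice_basis g L" "lattice_basis h L"
  shows "\<bar>det g\<bar> \<le> \<bar>det h\<bar>"
proof -
  have "\<exists>z \<in> int_vecs. column j h = g *v z" for j
  proof -
    have "axis j 1 \<in> (int_vecs :: (real^'k) set)"
      by (auto simp: int_vecs_def axis_def)
    then have "h *v axis j 1 \<in> L"
      using assms(2) by (auto simp: lattice_basis_def)
    then show ?thesis
      using assms(1) by (auto simp: lattice_basis_def matrix_vector_mult_basis)
  qed
  then obtain z where z: "\<And>j. z j \<in> int_vecs" "\<And>j. column j h = g *v z j"
    by metis
  define M :: "real^'k^'k" where "M = (\<chi> i j. z j $ i)"
  have "h = g ** M"
    using z(2) by (simp add: vec_eq_iff matrix_matrix_mult_def M_def column_def matrix_vector_mult_def)
  then have det: "det h = det g * det M"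
    by (simp add: det_mul)
  have "det M \<in> \<int>"
    using z(1) unfolding det_def M_def
    by (intro Ints_sum Ints_mult Ints_prod) (auto simp: int_vecs_def)
  moreover have "det h \<noteq> 0"
    using assms(2) by (simp add: lattice_basis_def invertible_det_nz)
  ultimately have "1 \<le> \<bar>det M\<bar>"
    using det Ints_nonzero_abs_ge1 by auto
  then show ?thesis
    using mult_left_mono[of 1 "\<bar>det M\<bar>" "\<bar>det g\<bar>"] by (simp add: det abs_mult)
qed

lemma covolume_eq: "lattice_basis g L \<Longrightarrow> covolume L = \<bar>det g\<bar>"
  unfolding covolume_def by (rule the_equality) (auto intro: antisym lattice_basis_abs_det_le)

end

theory Submission
  imports Defs
begin

text \<open>
  Write \<open>g\<^sub>t = diag(t\<^bsup>n/m\<^esup>, 1/t)\<close> and \<open>u\<^sub>A\<close> for the unipotent matrix with upper right block \<open>A\<close>. A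
  matrix \<open>A\<close> lies in \<^const>\<open>D_hat\<close> only if the lattices \<open>g\<^sub>t u\<^sub>A \<int>\<^sup>d\<close> eventually avoid a neighbourhood of
  some fixed unimodular lattice, so it suffices that for almost every \<open>A\<close> these lattices are dense among
  the unimodular ones.

  Counting integral vectors shows that, uniformly in \<open>t\<close>, few matrices \<open>X\<close> in a bounded set are such
  that \<open>g\<^sub>t X \<int>\<^sup>d\<close> has a very short vector. As Lebesgue measure on matrices is invariant under \<open>g\<^sub>t\<close>
  and \<open>GL\<^sub>d(\<int>)\<close>, a Poincare recurrence argument inside a compact set of lattices makes the flow
  nonwandering. Contracted unipotents can be absorbed into returns, so the closure of a flow invariant
  open set of lattices is invariant under all transvections: the flow is topologically transitive.
  Transitivity and the expansion of \<open>u\<^sub>A\<close> under \<open>g\<^sub>t\<close> imply that from every lattice some \<open>g\<^sub>t u\<^sub>B\<close> leads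
  into a given open set. Almost every orbit \<open>g\<^sub>t u\<^sub>A \<int>\<^sup>d\<close> returns to a compact set, and at such times a
  fixed proportion of a small ball around \<open>A\<close> enters the open set; hence the set of \<open>A\<close> that never do so
  from some time on has no density points.
\<close>

section \<open>Matrices\<close>

lemma norm_matrix_vector_mult_le:
  fixes A :: "real^'n^'m"
  shows "norm (A *v x) \<le> norm A * norm x"
proof -
  have "norm (A *v x) = L2_set (\<lambda>i. \<bar>A $ i \<bullet> x\<bar>) UNIV"
    by (simp add: norm_vec_def matrix_vector_mul_component)
  also have "\<dots> \<le> L2_set (\<lambda>i. norm (A $ i) * norm x) UNIV"
    by (intro L2_set_mono Cauchy_Schwarz_ineq2) auto
  also have "\<dots> = norm A * norm x"
    by (simp add: L2_set_left_distrib norm_vec_def)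
  finally show ?thesis .
qed

lemma norm_transpose: "norm (transpose A) = norm (A :: real^'n^'m)"
proof -
  have "(\<Sum>i\<in>UNIV. \<Sum>j\<in>UNIV. (A $ j $ i)\<^sup>2) = (\<Sum>j\<in>UNIV. \<Sum>i\<in>UNIV. (A $ j $ i)\<^sup>2)"
    by (rule sum.swap)
  then show ?thesis
    by (simp add: norm_vec_def L2_set_def transpose_def real_sqrt_pow2 sum_nonneg)
qed

lemma norm_vector_matrix_mult_le:
  fixes A :: "real^'n^'m"
  shows "norm (x v* A) \<le> norm x * norm A"
  using norm_matrix_vector_mult_le[of "transpose A" x] by (simp add: norm_transpose mult.commute)

lemma matrix_matrix_mult_nth: "(A ** B) $ i = A $ i v* B"
  by (simp add: vec_eq_iff matrix_matrix_mult_def vector_matrix_mult_def mult.commute)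

lemma norm_matrix_matrix_mult_le:
  fixes A :: "real^'n^'m" and B :: "real^'p^'n"
  shows "norm (A ** B) \<le> norm A * norm B"
proof -
  have "norm (A ** B) = L2_set (\<lambda>i. norm ((A ** B) $ i)) UNIV"
    by (simp add: norm_vec_def)
  also have "\<dots> \<le> L2_set (\<lambda>i. norm (A $ i) * norm B) UNIV"
    by (intro L2_set_mono) (simp_all add: matrix_matrix_mult_nth norm_vector_matrix_mult_le)
  also have "\<dots> = norm A * norm B"
    by (simp add: L2_set_left_distrib norm_vec_def)
  finally show ?thesis .
qed

lemma bounded_bilinear_matrix_matrix_mult:
  "bounded_bilinear ((**) :: real^'n^'m \<Rightarrow> real^'p^'n \<Rightarrow> real^'p^'m)"
proof
  show "\<exists>K. \<forall>(A :: real^'n^'m) (B :: real^'p^'n). norm (A ** B) \<le> norm A * norm B * K"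
    by (intro exI[of _ 1]) (simp add: norm_matrix_matrix_mult_le)
qed (simp_all add: vec_eq_iff matrix_matrix_mult_def sum.distrib sum_distrib_left algebra_simps)

lemmas tendsto_matrix_matrix_mult [tendsto_intros] =
  bounded_bilinear.tendsto[OF bounded_bilinear_matrix_matrix_mult]

lemmas continuous_on_matrix_matrix_mult [continuous_intros] =
  bounded_bilinear.continuous_on[OF bounded_bilinear_matrix_matrix_mult]

lemmas matrix_add_rdistrib = bounded_bilinear.add_left[OF bounded_bilinear_matrix_matrix_mult]
lemmas matrix_scaleR_right = bounded_bilinear.scaleR_right[OF bounded_bilinear_matrix_matrix_mult]
lemmas matrix_scaleR_left = bounded_bilinear.scaleR_left[OF bounded_bilinear_matrix_matrix_mult]

lemma abs_matrix_nth_le_norm: "\<bar>A $ i $ j\<bar> \<le> norm (A :: real^'n^'m)"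
  using component_le_norm_cart[of "A $ i" j] Finite_Cartesian_Product.norm_nth_le[of A i]
  by linarith

lemma norm_matrix_mono:
  fixes A B :: "real^'n^'m"
  assumes "\<And>i j. \<bar>A $ i $ j\<bar> \<le> \<bar>B $ i $ j\<bar>"
  shows "norm A \<le> norm B"
  by (intro norm_le_componentwise_cart) (simp add: assms)

lemma tendsto_det [tendsto_intros]:
  fixes f :: "'a \<Rightarrow> real^'k^'k"
  assumes "(f \<longlongrightarrow> A) F"
  shows "((\<lambda>x. det (f x)) \<longlongrightarrow> det A) F"
  unfolding det_def by (intro tendsto_intros assms)

lemma continuous_on_det [continuous_intros]:
  fixes f :: "'a::topological_space \<Rightarrow> real^'k^'k"
  shows "continuous_on S f \<Longrightarrow> continuous_on S (\<lambda>x. det (f x))"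
  by (simp add: continuous_on_def tendsto_det)

lemma open_det_nonzero: "open {X :: real^'k^'k. det X \<noteq> 0}"
  by (intro open_Collect_neq continuous_intros)

lemma matrix_inv_mult:
  fixes A :: "real^'k^'k"
  assumes "det A \<noteq> 0"
  shows "A ** matrix_inv A = mat 1" "matrix_inv A ** A = mat 1"
proof -
  have "\<exists>B. A ** B = mat 1 \<and> B ** A = mat 1"
    using assms by (simp add: invertible_det_nz[symmetric] invertible_def)
  from someI_ex[OF this] show "A ** matrix_inv A = mat 1" "matrix_inv A ** A = mat 1"
    by (simp_all add: matrix_inv_def)
qed

lemma matrix_mult_matrix_inv_cancel:
  fixes A :: "real^'k^'k" and X :: "real^'k^'l" and Y :: "real^'n^'k"
  assumes "det A \<noteq> 0"
  shows "X ** A ** matrix_inv A = X" "X ** matrix_inv A ** A = X"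
    "A ** (matrix_inv A ** Y) = Y" "matrix_inv A ** (A ** Y) = Y"
  using matrix_inv_mult[OF assms] by (simp_all add: matrix_mul_assoc flip: matrix_mul_assoc[of X])

lemma matrix_inv_1: "matrix_inv (mat 1) = (mat 1 :: real^'k^'k)"
  using matrix_inv_mult(1)[of "mat 1"] by simp

lemma det_matrix_inv:
  fixes A :: "real^'k^'k"
  shows "det A \<noteq> 0 \<Longrightarrow> det (matrix_inv A) = 1 / det A"
  by (metis det_I det_mul matrix_inv_mult(1) nonzero_mult_div_cancel_left)

lemma matrix_inv_nth:
  fixes A :: "real^'k^'k"
  assumes "det A \<noteq> 0"
  shows "matrix_inv A $ k $ j = det (\<chi> i l. if l = k then axis j 1 $ i else A $ i $ l) / det A"
proof -
  have "A *v (matrix_inv A *v axis j 1) = axis j 1"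
    by (simp add: matrix_vector_mul_assoc matrix_inv_mult assms)
  then have "matrix_inv A *v axis j 1 =
      (\<chi> k. det (\<chi> i l. if l = k then axis j 1 $ i else A $ i $ l) / det A)"
    using cramer[OF assms] by blast
  then show ?thesis
    by (simp add: matrix_vector_mult_basis column_def vec_eq_iff)
qed

lemma tendsto_matrix_inv [tendsto_intros]:
  fixes f :: "'a \<Rightarrow> real^'k^'k"
  assumes f: "(f \<longlongrightarrow> A) F" and A: "det A \<noteq> 0"
  shows "((\<lambda>x. matrix_inv (f x)) \<longlongrightarrow> matrix_inv A) F"
proof (intro vec_tendstoI)
  fix k j
  define C :: "real^'k^'k \<Rightarrow> real^'k^'k" where
    "C = (\<lambda>X. \<chi> i l. if l = k then axis j 1 $ i else X $ i $ l)"
  have "((\<lambda>x. if l = k then axis j 1 $ i else f x $ i $ l) \<longlongrightarrow>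
      (if l = k then axis j 1 $ i else A $ i $ l)) F" for i l
    by (cases "l = k") (auto intro!: tendsto_intros f)
  then have "((\<lambda>x. C (f x)) \<longlongrightarrow> C A) F"
    unfolding C_def by (intro vec_tendstoI) simp
  then have "((\<lambda>x. det (C (f x)) / det (f x)) \<longlongrightarrow> det (C A) / det A) F"
    by (intro tendsto_intros f A)
  moreover have "\<forall>\<^sub>F x in F. det (f x) \<noteq> 0"
    using tendsto_imp_eventually_ne[OF tendsto_det[OF f] A] .
  then have "\<forall>\<^sub>F x in F. det (C (f x)) / det (f x) = matrix_inv (f x) $ k $ j"
    by eventually_elim (simp add: matrix_inv_nth C_def)
  ultimately show "((\<lambda>x. matrix_inv (f x) $ k $ j) \<longlongrightarrow> matrix_inv A $ k $ j) F"
    using tendsto_cong matrix_inv_nth[OF A, of k j] unfolding C_def by force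
qed

lemma matrix_bounded_below:
  fixes h :: "real^'k^'k"
  assumes "det h \<noteq> 0"
  obtains c where "c > 0" "\<And>x. c * norm x \<le> norm (h *v x)"
proof -
  have "bounded_linear ((*v) h)" "inj ((*v) h)"
    using assms by (simp_all add: inj_matrix_vector_mult invertible_det_nz)
  then show thesis
    using linear_inj_bounded_below_pos[of "(*v) h"] that
    by (metis matrix_vector_mul_linear mult.commute)
qed

lemma norm_matrix_lower_bound_ball:
  fixes h :: "real^'k^'k"
  assumes "\<And>x. c * norm x \<le> norm (h *v x)" "norm (X - h) \<le> c / 2"
  shows "c / 2 * norm x \<le> norm (X *v x)"
proof -
  have "norm (h *v x - X *v x) \<le> norm (X - h) * norm x"
    using norm_matrix_vector_mult_le[of "h - X" x]
    by (simp add: matrix_vector_mult_diff_rdistrib norm_minus_commute)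
  also have "\<dots> \<le> c / 2 * norm x"
    using assms(2) by (rule mult_right_mono) simp
  finally show ?thesis
    using assms(1)[of x] norm_triangle_sub[of "h *v x" "X *v x"] by (simp add: field_simps)
qed

lemma det_nonzero_if_bounded_below:
  fixes X :: "real^'k^'k"
  assumes "c > 0" "\<And>x. c * norm x \<le> norm (X *v x)"
  shows "det X \<noteq> 0"
proof
  assume "det X = 0"
  then obtain x where "x \<noteq> 0" "X *v x = 0"
    by (metis invertible_det_nz invertible_left_inverse matrix_left_invertible_ker)
  then show False
    using assms(1) assms(2)[of x] by (simp add: mult_le_0_iff)
qed

lemma linear_matrix_conj: "linear (\<lambda>X :: real^'k^'k. A ** X ** B)"
  by (rule linearI)
    (simp_all add: matrix_add_ldistrib matrix_add_rdistrib matrix_scaleR_left matrix_scaleR_right)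

section \<open>Row operations\<close>

definition row_op :: "'k \<Rightarrow> 'k \<Rightarrow> real \<Rightarrow> real^'l^'k \<Rightarrow> real^'l^'k::finite" where
  "row_op i j s X = (\<chi> a. if a = i then X $ i + s *\<^sub>R X $ j else X $ a)"

definition diag_mat :: "('k \<Rightarrow> real) \<Rightarrow> real^'k^'k::finite" where
  "diag_mat f = (\<chi> i j. if i = j then f i else 0)"

abbreviation single_diag :: "'k \<Rightarrow> real \<Rightarrow> real^'k^'k::finite" where
  "single_diag i a \<equiv> diag_mat (\<lambda>x. if x = i then a else 1)"

inductive_set row_op_products :: "(real^'k^'k::finite) set" where
  one: "mat 1 \<in> row_op_products"
| step: "X \<in> row_op_products \<Longrightarrow> i \<noteq> j \<Longrightarrow> row_op i j s X \<in> row_op_products"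

lemma row_op_matrix_mult: "row_op i j s (X ** Y) = row_op i j s X ** Y"
  by (auto simp: row_op_def vec_eq_iff matrix_matrix_mult_def sum_distrib_left sum.distrib
    algebra_simps)

lemma det_row_op:
  assumes "i \<noteq> j"
  shows "det (row_op i j s X) = det (X :: real^'k^'k::finite)"
proof -
  have "row_op i j s X = (\<chi> k. if k = i then row i X + s *s row j X else row k X)"
    by (simp add: row_op_def row_def vec_eq_iff)
  then show ?thesis
    using det_row_operation[OF assms, of X s] by simp
qed

lemma row_op_commutator:
  assumes "i \<noteq> j" "i \<noteq> k" "j \<noteq> k"
  shows "row_op i j s X = row_op i k s (row_op k j 1 (row_op i k (- s) (row_op k j (- 1) X)))"
  using assms by (auto simp: row_op_def vec_eq_iff algebra_simps)

lemma diag_mat_vec: "(diag_mat f *v x) $ i = f i * x $ i"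
  by (simp add: diag_mat_def matrix_vector_mult_def if_distrib[of "\<lambda>y. y * _"] cong: if_cong)

lemma diag_mat_mult_nth: "(diag_mat f ** X) $ a = f a *\<^sub>R X $ a"
  by (simp add: diag_mat_def matrix_matrix_mult_def vec_eq_iff if_distrib[of "\<lambda>x. x * _"]
    cong: if_cong)

lemma diag_mat_mult_diag_mat: "diag_mat f ** diag_mat g = diag_mat (\<lambda>i. f i * g i)"
  by (simp add: vec_eq_iff diag_mat_mult_nth) (simp add: diag_mat_def)

lemma det_diag_mat: "det (diag_mat f) = prod f UNIV"
  by (subst det_diagonal) (auto simp: diag_mat_def)

lemma diag_mat_1: "diag_mat (\<lambda>_. 1) = mat 1"
  by (simp add: diag_mat_def mat_def)

lemma diag_mat_row_op:
  assumes "f j \<noteq> 0"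
  shows "diag_mat f ** row_op i j s X = row_op i j (s * f i / f j) (diag_mat f ** X)"
  using assms by (simp add: vec_eq_iff diag_mat_mult_nth row_op_def algebra_simps)

lemma row_op_products_mult:
  "X \<in> row_op_products \<Longrightarrow> Y \<in> row_op_products \<Longrightarrow> X ** Y \<in> row_op_products"
  by (induction rule: row_op_products.induct)
    (auto simp: row_op_matrix_mult[symmetric] intro: row_op_products.step)

lemma det_row_op_products: "X \<in> row_op_products \<Longrightarrow> det X = 1"
  by (induction rule: row_op_products.induct) (auto simp: det_row_op)

lemma diag_mat_normalizes_row_op_products:
  assumes "X \<in> row_op_products" "\<And>i. f i \<noteq> 0"
  shows "\<exists>X' \<in> row_op_products. diag_mat f ** X = X' ** diag_mat f"
  using assms(1)
proof induction
  case one
  show ?case by (intro bexI[of _ "mat 1"]) (auto intro: row_op_products.one)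
next
  case (step X i j s)
  then show ?case
    using assms(2) by (metis diag_mat_row_op row_op_matrix_mult row_op_products.step)
qed

lemma pair_diag_in_row_op_products:
  assumes "i \<noteq> j" "a \<noteq> 0"
  shows "diag_mat (\<lambda>x. if x = i then a else if x = j then 1 / a else 1) \<in> row_op_products"
proof -
  have "diag_mat (\<lambda>x. if x = i then a else if x = j then 1 / a else 1) =
    row_op i j a (row_op j i (- 1 / a) (row_op i j a
      (row_op i j (- 1) (row_op j i 1 (row_op i j (- 1) (mat 1))))))"
    using assms by (auto simp: vec_eq_iff row_op_def diag_mat_def mat_def)
  then show ?thesis
    using assms by (auto intro!: row_op_products.intros)
qed

definition row_reducible :: "'k \<Rightarrow> real^'k^'k::finite \<Rightarrow> bool" where
  "row_reducible k A \<longleftrightarrow> (\<exists>E \<in> row_op_products. \<exists>b. b \<noteq> 0 \<and> A = E ** single_diag k b)"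

lemma row_reducible_mult:
  assumes "row_reducible k A" "row_reducible k B"
  shows "row_reducible k (A ** B)"
proof -
  obtain E b F c where A: "E \<in> row_op_products" "b \<noteq> 0" "A = E ** single_diag k b"
    and B: "F \<in> row_op_products" "c \<noteq> 0" "B = F ** single_diag k c"
    using assms unfolding row_reducible_def by blast
  have "\<exists>F' \<in> row_op_products. single_diag k b ** F = F' ** single_diag k b"
    by (rule diag_mat_normalizes_row_op_products) (simp_all add: A(2) B(1))
  then obtain F' where F': "F' \<in> row_op_products" "single_diag k b ** F = F' ** single_diag k b"
    by blast
  have "A ** B = E ** (single_diag k b ** F) ** single_diag k c"
    by (simp add: A B matrix_mul_assoc)
  also have "\<dots> = (E ** F') ** (single_diag k b ** single_diag k c)"
    by (simp add: F' matrix_mul_assoc)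
  also have "single_diag k b ** single_diag k c = single_diag k (b * c)"
    by (simp add: diag_mat_mult_diag_mat if_distrib cong: if_cong)
  finally show ?thesis
    unfolding row_reducible_def using A(2) B(2) row_op_products_mult[OF A(1) F'(1)]
    by (intro bexI[of _ "E ** F'"] exI[of _ "b * c"]) simp_all
qed

lemma row_reducible_row_op:
  "row_reducible k A \<Longrightarrow> i \<noteq> j \<Longrightarrow> row_reducible k (row_op i j s A)"
  unfolding row_reducible_def by (metis row_op_matrix_mult row_op_products.step)

lemma row_reducible_single_diag:
  assumes "a \<noteq> 0"
  shows "row_reducible k (single_diag i a)"
proof (cases "i = k")
  case True
  then show ?thesis
    unfolding row_reducible_def using assms row_op_products.one by (metis matrix_mul_lid)
next
  case False
  have "single_diag i a =
      diag_mat (\<lambda>x. if x = i then a else if x = k then 1 / a else 1) ** single_diag k a"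
    using False assms by (auto simp: diag_mat_mult_diag_mat intro!: arg_cong[of _ _ diag_mat])
  then show ?thesis
    unfolding row_reducible_def using pair_diag_in_row_op_products[OF False assms] assms by blast
qed

lemma row_reducible_diag_mat:
  assumes "\<And>i. f i \<noteq> 0"
  shows "row_reducible k (diag_mat f)"
proof -
  have "row_reducible k (diag_mat (\<lambda>i. if i \<in> K then f i else 1))" if "finite K" for K
    using that
  proof induction
    case empty
    show ?case using row_reducible_single_diag[of 1 k k] by (simp cong: if_cong)
  next
    case (insert x K)
    have "diag_mat (\<lambda>i. if i \<in> insert x K then f i else 1) =
        single_diag x (f x) ** diag_mat (\<lambda>i. if i \<in> K then f i else 1)"
      using insert by (auto simp: diag_mat_mult_diag_mat intro!: arg_cong[of _ _ diag_mat])
    then show ?case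
      using row_reducible_mult[OF row_reducible_single_diag insert.IH] assms by simp
  qed
  from this[of UNIV] show ?thesis by simp
qed

lemma det_nonzero_imp_row_reducible: "det A \<noteq> 0 \<Longrightarrow> row_reducible k A"
proof (rule induct_matrix_elementary[where P = "\<lambda>A. det A \<noteq> 0 \<longrightarrow> row_reducible k A", THEN mp])
  show "det (A ** B) \<noteq> 0 \<longrightarrow> row_reducible k (A ** B)"
    if "det A \<noteq> 0 \<longrightarrow> row_reducible k A" "det B \<noteq> 0 \<longrightarrow> row_reducible k B" for A B
    using that by (simp add: det_mul row_reducible_mult)
  show "det A \<noteq> 0 \<longrightarrow> row_reducible k A" if "row i A = 0" for A i
    using that by (simp add: det_zero_row)
  show "det A \<noteq> 0 \<longrightarrow> row_reducible k A" if "\<And>i j. i \<noteq> j \<Longrightarrow> A $ i $ j = 0" for A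
  proof
    assume "det A \<noteq> 0"
    moreover have A: "A = diag_mat (\<lambda>i. A $ i $ i)"
      using that by (auto simp: diag_mat_def vec_eq_iff)
    ultimately have "prod (\<lambda>i. A $ i $ i) UNIV \<noteq> 0"
      by (metis det_diag_mat)
    then show "row_reducible k A" by (subst A) (rule row_reducible_diag_mat, simp)
  qed
next
  fix m n :: 'a and c :: real
  assume distinct: "m \<noteq> n"
  have "row_reducible k (row_op m n 1 (row_op n m (- 1) (row_op m n 1 (single_diag m (- 1)))))"
    using distinct by (intro row_reducible_row_op row_reducible_single_diag) auto
  moreover have "row_op m n 1 (row_op n m (- 1) (row_op m n 1 (single_diag m (- 1)))) =
      (\<chi> i j. mat 1 $ i $ Transposition.transpose m n j)"
    using distinct
    by (auto simp: vec_eq_iff row_op_def diag_mat_def mat_def Transposition.transpose_def)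
  ultimately show "det (\<chi> i j. mat 1 $ i $ Transposition.transpose m n j) \<noteq> 0 \<longrightarrow>
      row_reducible k (\<chi> i j. mat 1 $ i $ Transposition.transpose m n j)"
    by simp
  have "row_reducible k (row_op m n c (single_diag m 1))"
    using distinct by (intro row_reducible_row_op row_reducible_single_diag) auto
  moreover have "row_op m n c (single_diag m 1)
      = (\<chi> i j. if i = m \<and> j = n then c else of_bool (i = j))"
    using distinct by (auto simp: vec_eq_iff row_op_def diag_mat_def)
  ultimately show "det (\<chi> i j. if i = m \<and> j = n then c else of_bool (i = j)) \<noteq> 0 \<longrightarrow>
      row_reducible k (\<chi> i j. if i = m \<and> j = n then c else of_bool (i = j))"
    by simp
qed

lemma matrix_eq_row_op_products:
  fixes A :: "real^'k^'k::finite"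
  assumes "det A \<noteq> 0"
  shows "\<exists>E \<in> row_op_products. A = E ** single_diag k (det A)"
proof -
  obtain E b where E: "E \<in> row_op_products" "A = E ** single_diag k b"
    using det_nonzero_imp_row_reducible[OF assms] unfolding row_reducible_def by blast
  have "det A = b"
    by (simp add: E(2) det_mul det_row_op_products[OF E(1)] det_diag_mat)
  with E show ?thesis by metis
qed

section \<open>Lebesgue measure under matrix actions\<close>

definition shear :: "'k \<Rightarrow> 'k \<Rightarrow> real \<Rightarrow> real^'k \<Rightarrow> real^'k" where
  "shear i j s x = (\<chi> a. if a = i then x $ i + s * x $ j else x $ a)"

lemma linear_shear: "linear (shear i j s)"
  by (rule linearI) (auto simp: shear_def vec_eq_iff algebra_simps)

lemma row_op_matrix_vector_mult: "row_op i j s A *v x = shear i j s (A *v x)"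
  by (auto simp: row_op_def shear_def vec_eq_iff matrix_vector_mult_def sum_distrib_left sum.distrib
    algebra_simps)

lemma measure_unit_shear_cbox:
  assumes "i \<noteq> j"
  shows "measure lebesgue (shear i j 1 ` cbox a b) = measure lebesgue (cbox a b)"
proof (cases "cbox a b = {}")
  case False
  define w where "w = axis j (a $ j)"
  have shear: "shear i j 1 = (\<lambda>x. \<chi> k. if k = i then x $ i + x $ j else x $ k)"
    by (auto simp: fun_eq_iff vec_eq_iff shear_def)
  have box: "cbox a b = (+) w ` cbox (a - w) (b - w)"
    using cbox_translation[of w "a - w" "b - w"] by simp
  have "shear i j 1 ` cbox a b = (+) (shear i j 1 w) ` shear i j 1 ` cbox (a - w) (b - w)"
    by (simp add: box image_image linear_add[OF linear_shear])
  then have "measure lebesgue (shear i j 1 ` cbox a b)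
      = measure lebesgue (shear i j 1 ` cbox (a - w) (b - w))"
    by (simp add: measure_translation)
  also have "\<dots> = measure lebesgue (cbox (a - w) (b - w))"
    unfolding shear using False box
    by (intro measure_shear_interval assms) (auto simp: w_def axis_def)
  also have "\<dots> = measure lebesgue (cbox a b)"
    unfolding box by (rule measure_translation[symmetric])
  finally show ?thesis .
qed simp

lemma
  assumes "i \<noteq> j" "S \<in> lmeasurable"
  shows measurable_shear: "shear i j s ` S \<in> lmeasurable"
    and measure_shear: "measure lebesgue (shear i j s ` S) = measure lebesgue S"
proof -
  have unit: "shear i j 1 ` T \<in> lmeasurable \<and>
      measure lebesgue (shear i j 1 ` T) = measure lebesgue T"
    if "T \<in> lmeasurable" for T
    using measure_linear_sufficient[OF linear_shear that, of i j 1 1]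
      measure_unit_shear_cbox[OF assms(1)]
    by simp
  have "shear i j s ` S \<in> lmeasurable \<and> measure lebesgue (shear i j s ` S) = measure lebesgue S"
  proof (cases "s = 0")
    case True
    have "shear i j 0 x = x" for x
      by (simp add: shear_def vec_eq_iff)
    then show ?thesis using True assms(2) by simp
  next
    case False
    define stretch :: "real \<Rightarrow> real^'a \<Rightarrow> real^'a" where
      "stretch = (\<lambda>c x. \<chi> k. (if k = j then c else 1) * x $ k)"
    have prod: "(\<Prod>k\<in>UNIV. if k = j then c else 1) = c" for c :: real
      by simp
    have stretch: "stretch c ` T \<in> lmeasurable"
      "measure lebesgue (stretch c ` T) = \<bar>c\<bar> * measure lebesgue T" if "T \<in> lmeasurable" for T c
      unfolding stretch_def
      using measurable_stretch[OF that] measure_stretch[OF that, of "\<lambda>k. if k = j then c else 1"]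
      by (simp_all add: prod)
    have "shear i j s x = stretch (1 / s) (shear i j 1 (stretch s x))" for x
      using False assms(1) by (auto simp: shear_def stretch_def vec_eq_iff)
    then have "shear i j s ` S = stretch (1 / s) ` shear i j 1 ` stretch s ` S"
      by (simp add: image_image)
    then show ?thesis
      using stretch unit assms(2) False by (simp add: abs_divide)
  qed
  then show "shear i j s ` S \<in> lmeasurable"
    "measure lebesgue (shear i j s ` S) = measure lebesgue S"
    by auto
qed

lemma measure_row_op_products_image:
  assumes "E \<in> row_op_products" "S \<in> lmeasurable"
  shows "(*v) E ` S \<in> lmeasurable \<and> measure lebesgue ((*v) E ` S) = measure lebesgue S"
  using assms(1)
proof induction
  case (step X i j s)
  have "(*v) (row_op i j s X) ` S = shear i j s ` (*v) X ` S"
    by (simp add: image_image row_op_matrix_vector_mult)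
  then show ?case
    using step measurable_shear measure_shear by metis
qed (use assms(2) in simp)

lemma
  fixes A :: "real^'k^'k"
  assumes A: "det A \<noteq> 0" and S: "S \<in> lmeasurable"
  shows measurable_matrix_vector_image: "(*v) A ` S \<in> lmeasurable"
    and measure_matrix_vector_image: "measure lebesgue ((*v) A ` S) = \<bar>det A\<bar> * measure lebesgue S"
proof -
  fix k :: 'k
  obtain E where E: "E \<in> row_op_products" "A = E ** single_diag k (det A)"
    using matrix_eq_row_op_products[OF A] by blast
  define m where "m = (\<lambda>i. if i = k then det A else 1)"
  define S' where "S' = (\<lambda>x. \<chi> i. m i * x $ i) ` S"
  have S': "S' \<in> lmeasurable" "measure lebesgue S' = \<bar>det A\<bar> * measure lebesgue S"
    using measurable_stretch[OF S, of m] measure_stretch[OF S, of m] by (simp_all add: S'_def m_def)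
  have "diag_mat m *v x = (\<chi> i. m i * x $ i)" for x
    by (simp add: vec_eq_iff diag_mat_vec)
  then have "A *v x = E *v (\<chi> i. m i * x $ i)" for x
    by (subst E(2)) (simp add: m_def flip: matrix_vector_mul_assoc)
  then have "(*v) A ` S = (*v) E ` S'"
    by (simp add: S'_def image_image)
  then show "(*v) A ` S \<in> lmeasurable"
    "measure lebesgue ((*v) A ` S) = \<bar>det A\<bar> * measure lebesgue S"
    using measure_row_op_products_image[OF E(1) S'(1)] S'(2) by simp_all
qed

lemma borel_measurable_linear:
  fixes f :: "'a::euclidean_space \<Rightarrow> 'b::euclidean_space"
  shows "linear f \<Longrightarrow> f \<in> borel_measurable borel"
  by (simp add: linear_continuous_on linear_conv_bounded_linear borel_measurable_continuous_onI)

lemma lborel_distr_matrix_vector_mult: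
  fixes A :: "real^'k^'k"
  assumes "\<bar>det A\<bar> = 1"
  shows "distr lborel borel ((*v) A) = lborel"
proof (rule lborel_eqI[symmetric])
  fix l u :: "real^'k"
  assume ordered: "\<And>b. b \<in> Basis \<Longrightarrow> l \<bullet> b \<le> u \<bullet> b"
  have A: "det A \<noteq> 0"
    using assms by auto
  have meas: "(*v) A \<in> borel_measurable borel"
    by (rule borel_measurable_linear[OF matrix_vector_mul_linear])
  have vimage: "(*v) A -` box l u = (*v) (matrix_inv A) ` box l u"
    using matrix_inv_mult[OF A] by (force simp: matrix_vector_mul_assoc image_iff)
  have "bounded ((*v) A -` box l u)"
    unfolding vimage by (intro bounded_linear_image bounded_box matrix_vector_mul_bounded_linear)
  then have "emeasure lborel ((*v) A -` box l u) = measure lborel ((*v) A -` box l u)"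
    using emeasure_bounded_finite by (intro emeasure_eq_ennreal_measure) force
  also have "measure lborel ((*v) A -` box l u) = measure lebesgue ((*v) (matrix_inv A) ` box l u)"
    using measurable_sets[OF meas, of "box l u"] by (simp add: measure_completion flip: vimage)
  also have "\<dots> = (\<Prod>b\<in>Basis. (u - l) \<bullet> b)"
    using A assms ordered
    by (subst measure_matrix_vector_image) (simp_all add: det_matrix_inv measure_completion)
  finally show "emeasure (distr lborel borel ((*v) A)) (box l u) = (\<Prod>b\<in>Basis. (u - l) \<bullet> b)"
    using meas by (simp add: emeasure_distr)
qed simp

lemma prod_Basis_vec:
  "(\<Prod>b\<in>(Basis :: ('a::euclidean_space^'n) set). f b) = (\<Prod>i\<in>UNIV. \<Prod>b\<in>Basis. f (axis i b))"
proof -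
  have "bij_betw (\<lambda>(i, b). axis i b) (UNIV \<times> Basis) (Basis :: ('a^'n) set)"
    by (auto simp: bij_betw_def inj_on_def axis_eq_axis Basis_vec_def)
  from prod.reindex_bij_betw[OF this, of f] show ?thesis
    by (simp add: prod.cartesian_product case_prod_beta)
qed

lemma borel_measurable_vec_lambda:
  fixes f :: "'b \<Rightarrow> 'a::euclidean_space^'n"
  assumes "\<And>i. (\<lambda>x. f x $ i) \<in> borel_measurable M"
  shows "f \<in> borel_measurable M"
  unfolding borel_measurable_euclidean_space[of f]
  using borel_measurable_inner[OF assms borel_measurable_const]
  by (auto simp: Basis_vec_def inner_axis)

lemma borel_measurable_vec_nth [measurable]: "(\<lambda>x. x $ i) \<in> borel_measurable borel"
  by (intro borel_measurable_continuous_onI continuous_intros)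

lemma mem_box_vec: "X \<in> box l u \<longleftrightarrow> (\<forall>i. X $ i \<in> box (l $ i) (u $ i))"
  by (auto simp: mem_box Basis_vec_def inner_axis)

lemma lborel_vec_eq_distr_PiM:
  "(lborel :: ('a::euclidean_space^'n) measure) = distr (\<Pi>\<^sub>M i\<in>UNIV. lborel) borel vec_lambda"
proof (rule lborel_eqI)
  interpret product_sigma_finite "\<lambda>_ :: 'n. lborel :: 'a measure" ..
  fix l u :: "'a^'n"
  assume ordered: "\<And>b. b \<in> Basis \<Longrightarrow> l \<bullet> b \<le> u \<bullet> b"
  have ordered_row: "l $ i \<bullet> b \<le> u $ i \<bullet> b" if "b \<in> Basis" for i b
    using ordered[of "axis i b"] that by (simp add: inner_axis)
  have "vec_lambda \<in> borel_measurable (\<Pi>\<^sub>M i\<in>UNIV. lborel :: 'a measure)"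
    by (rule borel_measurable_vec_lambda) simp
  then have "emeasure (distr (\<Pi>\<^sub>M i\<in>UNIV. lborel) borel vec_lambda) (box l u) =
      emeasure (\<Pi>\<^sub>M i\<in>UNIV. lborel) (vec_lambda -` box l u \<inter> space (\<Pi>\<^sub>M i\<in>UNIV. lborel))"
    by (rule emeasure_distr) simp
  also have "vec_lambda -` box l u \<inter> space (\<Pi>\<^sub>M i\<in>UNIV. lborel) = (\<Pi>\<^sub>E i\<in>UNIV. box (l $ i) (u $ i))"
    by (auto simp: mem_box_vec space_PiM PiE_iff)
  also have "emeasure (\<Pi>\<^sub>M i\<in>UNIV. lborel) \<dots> = (\<Prod>i\<in>UNIV. emeasure lborel (box (l $ i) (u $ i)))"
    by (rule emeasure_PiM) auto
  also have "\<dots> = (\<Prod>b\<in>Basis. (u - l) \<bullet> b)"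
    using ordered_row by (simp add: prod_Basis_vec inner_axis prod_ennreal prod_nonneg inner_diff_left)
  finally show "emeasure (distr (\<Pi>\<^sub>M i\<in>UNIV. lborel) borel vec_lambda) (box l u)
      = (\<Prod>b\<in>Basis. (u - l) \<bullet> b)" .
qed simp

lemma
  fixes T :: "'n::finite \<Rightarrow> 'a::euclidean_space set"
  assumes T: "\<And>i. T i \<in> sets borel"
  shows borel_vec_Pi: "{X :: 'a^'n. \<forall>i. X $ i \<in> T i} \<in> sets borel"
    and emeasure_lborel_vec_Pi: "emeasure lborel {X :: 'a^'n. \<forall>i. X $ i \<in> T i}
        = (\<Prod>i\<in>UNIV. emeasure lborel (T i))"
proof -
  interpret product_sigma_finite "\<lambda>_ :: 'n. lborel :: 'a measure" ..
  note [measurable] = T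
  show borel: "{X :: 'a^'n. \<forall>i. X $ i \<in> T i} \<in> sets borel"
    by measurable
  have meas: "vec_lambda \<in> borel_measurable (\<Pi>\<^sub>M i\<in>UNIV. lborel :: 'a measure)"
    by (rule borel_measurable_vec_lambda) simp
  have "emeasure lborel {X :: 'a^'n. \<forall>i. X $ i \<in> T i} =
      emeasure (\<Pi>\<^sub>M i\<in>UNIV. lborel)
        (vec_lambda -` {X. \<forall>i. X $ i \<in> T i} \<inter> space (\<Pi>\<^sub>M i\<in>UNIV. lborel))"
    unfolding lborel_vec_eq_distr_PiM using meas borel by (rule emeasure_distr)
  also have "vec_lambda -` {X. \<forall>i. X $ i \<in> T i} \<inter> space (\<Pi>\<^sub>M i\<in>UNIV. lborel) = (\<Pi>\<^sub>E i\<in>UNIV. T i)"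
    by (auto simp: space_PiM PiE_iff)
  also have "emeasure (\<Pi>\<^sub>M i\<in>UNIV. lborel) \<dots> = (\<Prod>i\<in>UNIV. emeasure lborel (T i))"
    using T by (intro emeasure_PiM) auto
  finally show "emeasure lborel {X :: 'a^'n. \<forall>i. X $ i \<in> T i} = (\<Prod>i\<in>UNIV. emeasure lborel (T i))" .
qed

lemma lborel_distr_vec_map:
  fixes g :: "'a::euclidean_space \<Rightarrow> 'a"
  assumes g [measurable]: "g \<in> borel_measurable borel" and "distr lborel borel g = lborel"
  shows "distr lborel borel (\<lambda>X :: 'a^'n. \<chi> i. g (X $ i)) = lborel"
proof (rule lborel_eqI[symmetric])
  fix l u :: "'a^'n"
  assume ordered: "\<And>b. b \<in> Basis \<Longrightarrow> l \<bullet> b \<le> u \<bullet> b"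
  have meas: "(\<lambda>X :: 'a^'n. \<chi> i. g (X $ i)) \<in> borel_measurable borel"
    by (rule borel_measurable_vec_lambda) simp
  have vimage: "g -` B \<in> sets borel" if "B \<in> sets borel" for B
    using measurable_sets[OF g that] by simp
  have g_emeasure: "emeasure lborel (g -` B) = emeasure lborel B" if "B \<in> sets borel" for B
    using emeasure_distr[of g lborel borel B] that by (simp add: assms(2))
  have "emeasure (distr lborel borel (\<lambda>X :: 'a^'n. \<chi> i. g (X $ i))) (box l u) =
      emeasure lborel ((\<lambda>X :: 'a^'n. \<chi> i. g (X $ i)) -` box l u)"
    using meas by (simp add: emeasure_distr)
  also have "(\<lambda>X :: 'a^'n. \<chi> i. g (X $ i)) -` box l u = {X. \<forall>i. X $ i \<in> g -` box (l $ i) (u $ i)}"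
    by (auto simp: mem_box_vec)
  also have "emeasure lborel \<dots> = (\<Prod>i\<in>UNIV. emeasure lborel (g -` box (l $ i) (u $ i)))"
    by (rule emeasure_lborel_vec_Pi) (simp add: vimage)
  also have "\<dots> = (\<Prod>i\<in>UNIV. emeasure lborel (box (l $ i) (u $ i)))"
    by (simp add: g_emeasure)
  also have "\<dots> = emeasure lborel {X. \<forall>i. X $ i \<in> box (l $ i) (u $ i)}"
    by (rule emeasure_lborel_vec_Pi[symmetric]) simp
  also have "\<dots> = (\<Prod>b\<in>Basis. (u - l) \<bullet> b)"
    using emeasure_lborel_box[OF ordered] by (simp flip: mem_box_vec)
  finally show "emeasure (distr lborel borel (\<lambda>X :: 'a^'n. \<chi> i. g (X $ i))) (box l u)
      = (\<Prod>b\<in>Basis. (u - l) \<bullet> b)" .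
qed simp

lemma linear_transpose: "linear (transpose :: real^'n^'m \<Rightarrow> real^'m^'n)"
  by (rule linearI) (simp_all add: transpose_def vec_eq_iff)

lemma lborel_distr_transpose: "distr lborel borel (transpose :: real^'n^'m \<Rightarrow> real^'m^'n) = lborel"
proof (rule lborel_eqI[symmetric])
  fix l u :: "real^'m^'n"
  assume "\<And>b. b \<in> Basis \<Longrightarrow> l \<bullet> b \<le> u \<bullet> b"
  then have ordered: "l $ j $ i \<le> u $ j $ i" for i j
    by (force simp: Basis_vec_def inner_axis)
  have "transpose -` box l u = box (transpose l) (transpose u)"
    by (auto simp: mem_box_vec mem_box_cart transpose_def)
  moreover have "emeasure lborel (box (transpose l) (transpose u))
      = (\<Prod>b\<in>Basis. (transpose u - transpose l) \<bullet> b)"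
    using ordered by (intro emeasure_lborel_box) (auto simp: Basis_vec_def inner_axis transpose_def)
  moreover have "(\<Prod>b\<in>Basis. (transpose u - transpose l) \<bullet> b) = (\<Prod>b\<in>Basis. (u - l) \<bullet> b)"
    by (simp add: prod_Basis_vec inner_axis transpose_def) (rule prod.swap)
  ultimately show "emeasure (distr lborel borel transpose) (box l u) = (\<Prod>b\<in>Basis. (u - l) \<bullet> b)"
    by (simp add: emeasure_distr borel_measurable_linear linear_transpose)
qed simp

lemma lborel_distr_matrix_conj:
  fixes A B :: "real^'k^'k"
  assumes "\<bar>det A\<bar> = 1" "\<bar>det B\<bar> = 1"
  shows "distr lborel borel (\<lambda>X. A ** X ** B) = lborel"
proof -
  have right: "distr lborel borel (\<lambda>X :: real^'k^'k. X ** C) = lborel"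
      if "\<bar>det C\<bar> = 1" for C :: "real^'k^'k"
  proof -
    have "(\<lambda>X. X ** C) = (\<lambda>X :: real^'k^'k. \<chi> i. transpose C *v X $ i)"
      by (simp add: fun_eq_iff vec_eq_iff matrix_matrix_mult_nth)
    moreover have "distr lborel borel (\<lambda>X :: real^'k^'k. \<chi> i. transpose C *v X $ i) = lborel"
      by (intro lborel_distr_vec_map borel_measurable_linear matrix_vector_mul_linear
          lborel_distr_matrix_vector_mult) (simp add: that)
    ultimately show ?thesis by simp
  qed
  have comp: "distr lborel borel (g \<circ> f) = lborel"
    if "linear f" "linear g" "distr lborel borel f = lborel" "distr lborel borel g = lborel"
    for f g :: "real^'k^'k \<Rightarrow> real^'k^'k"
    using distr_distr[of g borel borel f lborel] that by (simp add: borel_measurable_linear)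
  have lin: "linear (\<lambda>X :: real^'k^'k. X ** C)" for C
    using linear_matrix_conj[of "mat 1" C] by simp
  have "(\<lambda>X. A ** X ** B) = (\<lambda>X. X ** B) \<circ> (transpose \<circ> ((\<lambda>X. X ** transpose A) \<circ> transpose))"
    by (auto simp: matrix_transpose_mul)
  then show ?thesis
    using assms by (simp add: comp lin linear_compose linear_transpose lborel_distr_transpose right)
qed

lemma
  fixes A B :: "real^'k^'k"
  assumes AB: "\<bar>det A\<bar> = 1" "\<bar>det B\<bar> = 1" and S: "S \<in> sets borel"
  shows borel_matrix_conj_image: "(\<lambda>X. A ** X ** B) ` S \<in> sets borel"
    and emeasure_matrix_conj_image: "emeasure lborel ((\<lambda>X. A ** X ** B) ` S) = emeasure lborel S"
proof -
  have det_nonzero: "det A \<noteq> 0" "det B \<noteq> 0"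
    using AB by auto
  have left_inverse: "matrix_inv A ** (A ** X ** B) ** matrix_inv B = X" for X
    by (simp add: matrix_mul_assoc[symmetric, of A] matrix_mult_matrix_inv_cancel det_nonzero)
  have right_inverse: "A ** (matrix_inv A ** X ** matrix_inv B) ** B = X" for X
    by (simp add: matrix_mul_assoc[symmetric, of "matrix_inv A"] matrix_mult_matrix_inv_cancel det_nonzero)
  have "(\<lambda>X. A ** X ** B) ` S = (\<lambda>X. matrix_inv A ** X ** matrix_inv B) -` S"
    using left_inverse right_inverse by (auto simp: image_iff) metis
  then show borel: "(\<lambda>X. A ** X ** B) ` S \<in> sets borel"
    using measurable_sets[OF borel_measurable_linear[OF linear_matrix_conj] S] by simp
  have "(\<lambda>X. A ** X ** B) -` (\<lambda>X. A ** X ** B) ` S = S"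
    by (intro inj_vimage_image_eq inj_on_inverseI[of _ "\<lambda>X. matrix_inv A ** X ** matrix_inv B"]
      left_inverse)
  moreover have "emeasure (distr lborel borel (\<lambda>X. A ** X ** B)) ((\<lambda>X. A ** X ** B) ` S) =
      emeasure lborel ((\<lambda>X. A ** X ** B) -` (\<lambda>X. A ** X ** B) ` S)"
    using borel by (simp add: emeasure_distr borel_measurable_linear linear_matrix_conj)
  ultimately show "emeasure lborel ((\<lambda>X. A ** X ** B) ` S) = emeasure lborel S"
    by (simp add: lborel_distr_matrix_conj[OF AB])
qed

section \<open>Integral vectors and matrices\<close>

lemma infnorm_attained:
  fixes x :: "real^'k"
  obtains j where "infnorm x = \<bar>x $ j\<bar>"
proof -
  have "Max ((\<lambda>b. \<bar>x \<bullet> b\<bar>) ` Basis) \<in> (\<lambda>b. \<bar>x \<bullet> b\<bar>) ` Basis"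
    by (intro Max_in) auto
  then obtain b where "b \<in> Basis" "infnorm x = \<bar>x \<bullet> b\<bar>"
    unfolding infnorm_Max by (rule imageE)
  then show thesis
    using that by (auto simp: Basis_vec_def inner_axis)
qed

lemma int_vecs_infnorm_ge_1:
  assumes "z \<in> int_vecs - {0}"
  shows "1 \<le> infnorm z"
proof -
  obtain i where i: "z $ i \<noteq> 0"
    using assms by (auto simp: vec_eq_iff)
  have "z $ i \<in> \<int>"
    using assms by (simp add: int_vecs_def)
  then have "1 \<le> \<bar>z $ i\<bar>"
    using i by (intro Ints_nonzero_abs_ge1)
  then show ?thesis
    using component_le_infnorm_cart[of z i] by linarith
qed

lemma int_vecs_norm_ge_1: "z \<in> int_vecs - {0} \<Longrightarrow> 1 \<le> norm z"
  using int_vecs_infnorm_ge_1[of z] infnorm_le_norm[of z] by linarith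

lemma axis_in_int_vecs: "axis i 1 \<in> int_vecs"
  by (simp add: int_vecs_def axis_def)

definition int_mats :: "(real^'k^'k::finite) set" where
  "int_mats = {N. \<forall>i j. N $ i $ j \<in> \<int>}"

definition GLZ :: "(real^'k^'k::finite) set" where
  "GLZ = {\<gamma> \<in> int_mats. \<bar>det \<gamma>\<bar> = 1}"

lemma int_mats_1: "mat 1 \<in> int_mats"
  by (simp add: int_mats_def mat_def)

lemma int_mats_add: "A \<in> int_mats \<Longrightarrow> B \<in> int_mats \<Longrightarrow> A + B \<in> int_mats"
  by (simp add: int_mats_def)

lemma int_mats_mult: "A \<in> int_mats \<Longrightarrow> B \<in> int_mats \<Longrightarrow> A ** B \<in> int_mats"
  by (auto simp: int_mats_def matrix_matrix_mult_def intro!: Ints_sum)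

lemma int_mats_vec: "A \<in> int_mats \<Longrightarrow> z \<in> int_vecs \<Longrightarrow> A *v z \<in> int_vecs"
  by (auto simp: int_mats_def int_vecs_def matrix_vector_mult_def intro!: Ints_sum)

lemma det_int_mats: "A \<in> int_mats \<Longrightarrow> det A \<in> \<int>"
  unfolding det_def int_mats_def by (intro Ints_sum Ints_mult Ints_prod) auto

lemma int_mats_adjugate:
  assumes "N \<in> int_mats" "det N \<noteq> 0"
  shows "det N *\<^sub>R matrix_inv N \<in> int_mats"
proof -
  have "det (\<chi> i l. if l = k then axis j 1 $ i else N $ i $ l) \<in> \<int>" for j k
    by (rule det_int_mats) (use assms(1) in \<open>auto simp: int_mats_def axis_def\<close>)
  then show ?thesis
    using assms(2) by (simp add: int_mats_def matrix_inv_nth)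
qed

lemma GLZ_det_nonzero: "\<gamma> \<in> GLZ \<Longrightarrow> det \<gamma> \<noteq> 0"
  by (auto simp: GLZ_def)

lemma GLZ_1: "mat 1 \<in> GLZ"
  by (simp add: GLZ_def int_mats_1)

lemma GLZ_mult: "A \<in> GLZ \<Longrightarrow> B \<in> GLZ \<Longrightarrow> A ** B \<in> GLZ"
  by (simp add: GLZ_def int_mats_mult det_mul abs_mult)

lemma GLZ_matrix_inv:
  assumes "\<gamma> \<in> GLZ"
  shows "matrix_inv \<gamma> \<in> GLZ"
proof -
  have "det \<gamma> = 1 \<or> det \<gamma> = - 1"
    using assms by (auto simp: GLZ_def abs_if split: if_splits)
  moreover have "det \<gamma> *\<^sub>R matrix_inv \<gamma> \<in> int_mats"
    using assms GLZ_det_nonzero by (auto simp: GLZ_def intro: int_mats_adjugate)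
  ultimately have "matrix_inv \<gamma> \<in> int_mats"
    by (auto simp: int_mats_def)
  then show ?thesis
    using assms GLZ_det_nonzero[OF assms] by (simp add: GLZ_def det_matrix_inv)
qed

lemma GLZ_vec:
  assumes "\<gamma> \<in> GLZ" "z \<in> int_vecs - {0}"
  shows "\<gamma> *v z \<in> int_vecs - {0}"
proof -
  have "matrix_inv \<gamma> *v (\<gamma> *v z) = z"
    using GLZ_det_nonzero[OF assms(1)] by (simp add: matrix_vector_mul_assoc matrix_inv_mult)
  then have "\<gamma> *v z \<noteq> 0"
    using assms(2) by auto
  then show ?thesis
    using assms int_mats_vec by (auto simp: GLZ_def)
qed

lemma countable_vec_Pi:
  assumes "countable S"
  shows "countable {x :: 'a^'n. \<forall>i. x $ i \<in> S}"
proof -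
  have "countable (vec_lambda ` (\<Pi>\<^sub>E i\<in>(UNIV :: 'n set). S))"
    by (intro countable_image countable_PiE) (use assms in auto)
  moreover have "x \<in> vec_lambda ` (\<Pi>\<^sub>E i\<in>UNIV. S)" if "\<forall>i. x $ i \<in> S" for x :: "'a^'n"
    using that by (intro image_eqI[of _ _ "vec_nth x"]) (auto simp: PiE_iff)
  ultimately show ?thesis
    by (auto intro: countable_subset)
qed

lemma countable_GLZ: "countable (GLZ :: (real^'k^'k) set)"
proof -
  have "countable {N :: real^'k^'k. \<forall>i. N $ i \<in> int_vecs}"
    by (intro countable_vec_Pi) (simp add: int_vecs_def countable_vec_Pi countable_int)
  then show ?thesis
    by (rule countable_subset[rotated]) (auto simp: GLZ_def int_mats_def int_vecs_def)
qed

lemma GLZ_near_identity: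
  fixes X :: "real^'k^'k"
  assumes c: "\<And>x. c * norm x \<le> norm (X *v x)" and small: "norm (X ** \<gamma> - X) < c" and \<gamma>: "\<gamma> \<in> GLZ"
  shows "\<gamma> = mat 1"
proof -
  have c_pos: "0 < c"
    using small norm_ge_zero[of "X ** \<gamma> - X"] by linarith
  have "\<gamma> *v axis j 1 = axis j 1" for j
  proof (rule ccontr)
    define v where "v = \<gamma> *v axis j 1 - axis j 1"
    assume "\<gamma> *v axis j 1 \<noteq> axis j 1"
    moreover have "\<gamma> *v axis j 1 \<in> int_vecs"
      using \<gamma> by (auto simp: GLZ_def axis_in_int_vecs intro: int_mats_vec)
    ultimately have "v \<in> int_vecs - {0}"
      using axis_in_int_vecs[of j] by (simp add: v_def int_vecs_def)
    then have "c * 1 \<le> c * norm v"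
      using c_pos by (intro mult_left_mono int_vecs_norm_ge_1) auto
    also have "\<dots> \<le> norm (X *v v)"
      by (rule c)
    also have "X *v v = (X ** \<gamma> - X) *v axis j 1"
      by (simp add: v_def matrix_vector_mult_diff_distrib matrix_vector_mult_diff_rdistrib
        matrix_vector_mul_assoc)
    also have "norm \<dots> \<le> norm (X ** \<gamma> - X) * norm (axis j 1 :: real^'k)"
      by (rule norm_matrix_vector_mult_le)
    finally show False
      using small by simp
  qed
  then have "\<gamma> $ i $ j = mat 1 $ i $ j" for i j
    unfolding matrix_vector_mult_basis by (simp add: vec_eq_iff column_def axis_def mat_def)
  then show ?thesis
    by (simp add: vec_eq_iff)
qed

section \<open>Geometry of numbers\<close>

lemma measure_packing_le:
  fixes S C :: "'a::euclidean_space set"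
  assumes F: "finite F" and S: "S \<in> lmeasurable" and C: "C \<in> lmeasurable"
    and inside: "\<And>f. f \<in> F \<Longrightarrow> (+) (v f) ` S \<subseteq> C"
    and disjoint: "disjoint_family_on (\<lambda>f. (+) (v f) ` S) F"
  shows "real (card F) * measure lebesgue S \<le> measure lebesgue C"
proof -
  have measurable: "(+) w ` S \<in> lmeasurable" for w
    using S by (rule measurable_translation)
  have "real (card F) * measure lebesgue S = (\<Sum>f\<in>F. measure lebesgue ((+) (v f) ` S))"
    by (simp add: measure_translation)
  also have "\<dots> = measure lebesgue (\<Union>f\<in>F. (+) (v f) ` S)"
    using F measurable fmeasurableD2[OF measurable] disjoint
    by (intro measure_finite_Union[symmetric]) (auto simp: fmeasurableD)
  also have "\<dots> \<le> measure lebesgue C"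
    using inside C F measurable
    by (intro measure_mono_fmeasurable) (auto intro!: sets.finite_UN simp: fmeasurableD)
  finally show ?thesis .
qed

lemma translate_in_cbox_vec:
  fixes w y :: "real^'k"
  assumes "norm y \<le> c" "\<And>i. 0 \<le> w $ i" "\<And>i. w $ i \<le> b"
  shows "w + y \<in> cbox (\<chi> i. - c) (\<chi> i. b + c)"
proof -
  have "\<bar>y $ i\<bar> \<le> c" for i
    using norm_bound_component_le_cart[OF assms(1)] .
  then have "- c \<le> w $ i + y $ i" "w $ i + y $ i \<le> b + c" for i
    using assms(2,3)[of i] by (smt (verit))+
  then show ?thesis
    by (simp add: mem_box_cart)
qed

lemma measure_disjoint_lattice_translates_le:
  fixes M :: "real^'k^'k"
  assumes M: "det M \<noteq> 0" and S: "S \<in> lmeasurable"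
    and c: "\<And>x. x \<in> S \<Longrightarrow> norm (matrix_inv M *v x) \<le> c" "c > 0"
    and disjoint: "\<And>x y z. x \<in> S \<Longrightarrow> y \<in> S \<Longrightarrow> z \<in> int_vecs - {0} \<Longrightarrow> M *v z \<noteq> y - x"
  shows "real n ^ CARD('k) * measure lebesgue S \<le> \<bar>det M\<bar> * (real n + 2 * c) ^ CARD('k)"
proof -
  define F where "F = PiE (UNIV :: 'k set) (\<lambda>_. {..<n})"
  define w where "w = (\<lambda>f. (\<chi> i. real (f i)) :: real^'k)"
  define Q where "Q = cbox (\<chi> i::'k. - c) (\<chi> i::'k. real n + c)"
  have "real (card F) * measure lebesgue S \<le> measure lebesgue ((*v) M ` Q)"
  proof (rule measure_packing_le)
    show "finite F" by (simp add: F_def finite_PiE)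
    show "S \<in> lmeasurable" by (rule S)
    show "(*v) M ` Q \<in> lmeasurable"
      by (simp add: measurable_matrix_vector_image M Q_def)
    show "(+) (M *v w f) ` S \<subseteq> (*v) M ` Q" if f: "f \<in> F" for f
    proof clarify
      fix x assume "x \<in> S"
      have "w f + matrix_inv M *v x \<in> Q"
        unfolding Q_def using c(1)[OF \<open>x \<in> S\<close>] f
        by (intro translate_in_cbox_vec) (auto simp: w_def F_def PiE_iff less_imp_le)
      moreover have "M *v w f + x = M *v (w f + matrix_inv M *v x)"
        by (simp add: matrix_vector_right_distrib matrix_vector_mul_assoc matrix_inv_mult M)
      ultimately show "M *v w f + x \<in> (*v) M ` Q" by simp
    qed
    have "x + M *v w f \<noteq> y + M *v w g" if "f \<noteq> g" "x \<in> S" "y \<in> S" for f g x y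
    proof -
      have "w f - w g \<in> int_vecs - {0}"
        using \<open>f \<noteq> g\<close> by (auto simp: w_def int_vecs_def vec_eq_iff)
      then show ?thesis
        using disjoint[OF that(2,3), of "w f - w g"]
        by (auto simp: matrix_vector_mult_diff_distrib algebra_simps)
    qed
    then show "disjoint_family_on (\<lambda>f. (+) (M *v w f) ` S) F"
      unfolding disjoint_family_on_def by (force simp: add.commute)
  qed
  also have "\<dots> = \<bar>det M\<bar> * measure lebesgue Q"
    by (rule measure_matrix_vector_image) (auto simp: M Q_def)
  also have "measure lebesgue Q = (real n + 2 * c) ^ CARD('k)"
    using c(2)
    by (simp add: Q_def measure_completion content_cbox_cart interval_ne_empty_cart algebra_simps)
  finally show ?thesis
    by (simp add: F_def card_PiE)
qed

theorem blichfeldt: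
  fixes M :: "real^'k^'k"
  assumes M: "det M \<noteq> 0" and S: "S \<in> lmeasurable" "bounded S"
    and vol: "\<bar>det M\<bar> < measure lebesgue S"
  shows "\<exists>z \<in> int_vecs - {0}. \<exists>x \<in> S. \<exists>y \<in> S. M *v z = y - x"
proof (rule ccontr)
  assume disjoint_translates: "\<not> ?thesis"
  have "bounded ((*v) (matrix_inv M) ` S)"
    using S(2) by (intro bounded_linear_image matrix_vector_mul_bounded_linear)
  then obtain c where c: "c > 0" "\<And>x. x \<in> S \<Longrightarrow> norm (matrix_inv M *v x) \<le> c"
    by (auto simp: bounded_pos)
  have "measure lebesgue S \<le> \<bar>det M\<bar> * (1 + 2 * c / real n) ^ CARD('k)" if n: "n > 0" for n
  proof -
    have "real n ^ CARD('k) * measure lebesgue S \<le> \<bar>det M\<bar> * (real n + 2 * c) ^ CARD('k)"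
      using disjoint_translates by (intro measure_disjoint_lattice_translates_le[OF M S(1) c(2,1)]) auto
    also have "(real n + 2 * c) ^ CARD('k) = real n ^ CARD('k) * (1 + 2 * c / real n) ^ CARD('k)"
      using n by (simp add: power_mult_distrib[symmetric] field_simps)
    finally show ?thesis
      using n by (simp add: mult.left_commute)
  qed
  moreover have "(\<lambda>n. \<bar>det M\<bar> * (1 + 2 * c / real n) ^ CARD('k)) \<longlonglongrightarrow> \<bar>det M\<bar> * (1 + 0) ^ CARD('k)"
    by (intro tendsto_intros lim_const_over_n)
  ultimately have "measure lebesgue S \<le> \<bar>det M\<bar> * (1 + 0) ^ CARD('k)"
    by (intro LIMSEQ_le_const[of _ _ "measure lebesgue S"]) (auto intro!: exI[of _ 1])
  then show False using vol by simp
qed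

theorem minkowski_box:
  fixes M :: "real^'k^'k"
  assumes M: "det M \<noteq> 0" and a: "\<And>i. a i > 0" and vol: "\<bar>det M\<bar> < (\<Prod>i\<in>UNIV. a i)"
  shows "\<exists>z \<in> int_vecs - {0}. \<forall>i. \<bar>(M *v z) $ i\<bar> < a i"
proof -
  define S where "S = box 0 (\<chi> i. a i)"
  have S: "x \<in> S \<longleftrightarrow> (\<forall>i. 0 < x $ i \<and> x $ i < a i)" for x
    by (simp add: S_def mem_box_cart)
  have "measure lebesgue S = measure lborel (cbox 0 (\<chi> i. a i))"
    by (simp add: S_def measure_completion measure_lborel_box_eq measure_lborel_cbox_eq)
  also have "\<dots> = (\<Prod>i\<in>UNIV. a i)"
    using a by (simp add: content_cbox_cart interval_ne_empty_cart less_imp_le)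
  finally obtain z x y where z: "z \<in> int_vecs - {0}" "x \<in> S" "y \<in> S" "M *v z = y - x"
    using blichfeldt[OF M, of S] vol by (auto simp: S_def)
  have "\<bar>(M *v z) $ i\<bar> < a i" for i
    using z(2,3)[unfolded S, rule_format, of i] by (simp add: z(4) abs_less_iff)
  with z(1) show ?thesis by blast
qed

definition admissible :: "(real^'k \<Rightarrow> real) \<Rightarrow> real \<Rightarrow> (real^'k^'k::finite) set" where
  "admissible \<nu> r = {M. \<forall>z \<in> int_vecs - {0}. r \<le> \<nu> (M *v z)}"

lemma admissible_mult_GLZ:
  assumes "M \<in> admissible \<nu> r" "\<gamma> \<in> GLZ"
  shows "M ** \<gamma> \<in> admissible \<nu> r"
  using assms GLZ_vec[OF assms(2)] by (auto simp: admissible_def simp flip: matrix_vector_mul_assoc)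

lemma admissible_mult_GLZ_iff:
  assumes "\<gamma> \<in> GLZ"
  shows "M ** \<gamma> \<in> admissible \<nu> r \<longleftrightarrow> M \<in> admissible \<nu> r"
  using admissible_mult_GLZ[OF _ assms, of M]
    admissible_mult_GLZ[OF _ GLZ_matrix_inv[OF assms], of "M ** \<gamma>"]
  by (auto simp: matrix_mult_matrix_inv_cancel GLZ_det_nonzero[OF assms])

lemma closed_admissible:
  assumes "continuous_on UNIV \<nu>"
  shows "closed (admissible \<nu> r)"
proof -
  have "continuous_on UNIV (\<lambda>M. \<nu> (M *v z))" for z
    by (intro continuous_on_compose2[OF assms])
      (auto simp: matrix_vector_mult_def intro!: continuous_intros)
  moreover have "admissible \<nu> r = (\<Inter>z\<in>int_vecs - {0}. {M. r \<le> \<nu> (M *v z)})"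
    by (auto simp: admissible_def)
  ultimately show ?thesis
    by (auto intro!: closed_INT closed_Collect_le continuous_intros)
qed

lemma admissible_norm_det_ge:
  fixes M :: "real^'k^'k"
  assumes "\<eta> > 0" "det M \<noteq> 0" "M \<in> admissible norm \<eta>"
  shows "(\<eta> / real CARD('k)) ^ CARD('k) \<le> \<bar>det M\<bar>"
proof (rule ccontr)
  assume "\<not> ?thesis"
  then obtain z where z: "z \<in> int_vecs - {0}" "\<And>i. \<bar>(M *v z) $ i\<bar> < \<eta> / real CARD('k)"
    using minkowski_box[OF assms(2), of "\<lambda>_. \<eta> / real CARD('k)"] assms(1) by auto
  have "\<eta> \<le> norm (M *v z)"
    using assms(3) z(1) by (simp add: admissible_def)
  also have "\<dots> \<le> (\<Sum>i\<in>UNIV. \<bar>(M *v z) $ i\<bar>)"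
    by (rule norm_le_l1_cart)
  also have "\<dots> < (\<Sum>i\<in>(UNIV :: 'k set). \<eta> / real CARD('k))"
    by (intro sum_strict_mono z(2)) auto
  finally show False by simp
qed

lemma strictly_diagonally_dominant_det:
  fixes W :: "real^'k^'k"
  assumes "\<And>i. (\<Sum>j\<in>UNIV - {i}. \<bar>W $ i $ j\<bar>) < \<bar>W $ i $ i\<bar>"
  shows "det W \<noteq> 0"
proof
  assume "det W = 0"
  then obtain x where x: "x \<noteq> 0" "W *v x = 0"
    by (metis invertible_det_nz matrix_left_invertible_ker invertible_left_inverse)
  obtain i where i: "infnorm x = \<bar>x $ i\<bar>"
    by (rule infnorm_attained)
  have xi_pos: "\<bar>x $ i\<bar> > 0"
    using x(1) i infnorm_pos_lt[of x] by simp
  have "0 = (\<Sum>j\<in>UNIV. W $ i $ j * x $ j)"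
    using arg_cong[OF x(2), of "\<lambda>v. v $ i"] by (simp add: matrix_vector_mult_def)
  also have "\<dots> = W $ i $ i * x $ i + (\<Sum>j\<in>UNIV - {i}. W $ i $ j * x $ j)"
    by (simp add: sum.remove)
  finally have "\<bar>W $ i $ i\<bar> * \<bar>x $ i\<bar> = \<bar>\<Sum>j\<in>UNIV - {i}. W $ i $ j * x $ j\<bar>"
    unfolding abs_mult[symmetric] by linarith
  also have "\<dots> \<le> (\<Sum>j\<in>UNIV - {i}. \<bar>W $ i $ j\<bar> * \<bar>x $ i\<bar>)"
    unfolding i[symmetric] by (intro sum_abs[THEN order_trans] sum_mono)
      (simp add: abs_mult mult_left_mono component_le_infnorm_cart)
  also have "\<dots> = (\<Sum>j\<in>UNIV - {i}. \<bar>W $ i $ j\<bar>) * \<bar>x $ i\<bar>"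
    by (simp add: sum_distrib_right)
  finally show False
    using assms[of i] xi_pos by simp
qed

definition entry_cube :: "real \<Rightarrow> (real^'a^'b) set" where
  "entry_cube R = {X. \<forall>i j. \<bar>X $ i $ j\<bar> \<le> R}"

lemma entry_cube_eq_cbox: "entry_cube R = cbox (\<chi> i j. - R) (\<chi> i j. R)"
  by (auto simp: entry_cube_def mem_box Basis_vec_def inner_axis abs_le_iff minus_le_iff)

lemma compact_entry_cube: "compact (entry_cube R)"
  by (simp add: entry_cube_eq_cbox)

lemmas bounded_entry_cube = compact_imp_bounded[OF compact_entry_cube]

lemma borel_entry_cube: "entry_cube R \<in> sets borel"
  by (simp add: entry_cube_eq_cbox)

lemma det_entry_cube_bounded:
  obtains b where "\<And>X :: real^'k^'k. X \<in> entry_cube R \<Longrightarrow> \<bar>det X\<bar> \<le> b"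
proof -
  have "bounded (det ` (entry_cube R :: (real^'k^'k) set))"
    by (intro compact_imp_bounded compact_continuous_image compact_entry_cube continuous_intros)
  then show thesis
    using that by (auto simp: bounded_iff)
qed

lemma exists_lattice_vector_along_axis:
  fixes M :: "real^'k^'k" and i :: 'k and R \<epsilon> :: real
  defines "d \<equiv> real CARD('k)"
  assumes \<epsilon>: "\<epsilon> > 0" and M: "det M \<noteq> 0" "M \<in> admissible norm ((2 * d + 1) * \<epsilon>)"
    and R: "\<bar>det M\<bar> < R * \<epsilon> ^ (CARD('k) - 1)"
  shows "\<exists>z \<in> int_vecs.
    (\<forall>j. j \<noteq> i \<longrightarrow> \<bar>(M *v z) $ j\<bar> \<le> \<epsilon>) \<and> d * \<epsilon> < \<bar>(M *v z) $ i\<bar> \<and> \<bar>(M *v z) $ i\<bar> \<le> R"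
proof -
  have "(\<Prod>j\<in>UNIV. if j = i then R else \<epsilon>) = R * (\<Prod>j\<in>UNIV - {i}. \<epsilon>)"
    by (subst prod.remove[of _ i]) (auto intro!: prod.cong)
  then have "\<bar>det M\<bar> < (\<Prod>j\<in>UNIV. if j = i then R else \<epsilon>)"
    using R by (simp add: card_Diff_singleton)
  moreover have "R > 0"
    using R \<epsilon>
    by (metis abs_ge_zero less_le_trans not_le mult_nonpos_nonneg zero_le_power less_imp_le)
  ultimately have "\<exists>z \<in> int_vecs - {0}. \<forall>j. \<bar>(M *v z) $ j\<bar> < (if j = i then R else \<epsilon>)"
    using \<epsilon> M(1) by (intro minkowski_box) auto
  then obtain z where z: "z \<in> int_vecs - {0}" "\<And>j. \<bar>(M *v z) $ j\<bar> < (if j = i then R else \<epsilon>)"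
    by blast
  have off_axis: "\<bar>(M *v z) $ j\<bar> \<le> \<epsilon>" if "j \<noteq> i" for j
    using z(2)[of j] that by simp
  have "(2 * d + 1) * \<epsilon> \<le> norm (M *v z)"
    using M(2) z(1) by (simp add: admissible_def)
  also have "\<dots> \<le> (\<Sum>j\<in>UNIV. \<bar>(M *v z) $ j\<bar>)"
    by (rule norm_le_l1_cart)
  also have "\<dots> = \<bar>(M *v z) $ i\<bar> + (\<Sum>j\<in>UNIV - {i}. \<bar>(M *v z) $ j\<bar>)"
    by (simp add: sum.remove)
  also have "(\<Sum>j\<in>UNIV - {i}. \<bar>(M *v z) $ j\<bar>) \<le> real (card (UNIV - {i})) * \<epsilon>"
    using off_axis by (intro sum_bounded_above) simp
  also have "\<dots> \<le> d * \<epsilon>"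
    using \<epsilon> by (simp add: d_def card_Diff_singleton)
  finally have "d * \<epsilon> < \<bar>(M *v z) $ i\<bar>"
    using \<epsilon> by (simp add: algebra_simps)
  then show ?thesis
    using z(1) z(2)[of i] off_axis by (intro bexI[of _ z]) auto
qed

text \<open>Minkowski's theorem for a box elongated along each coordinate axis in turn yields lattice
  vectors forming a diagonally dominant matrix, hence a sublattice of bounded index.\<close>

lemma exists_bounded_sublattice:
  fixes M :: "real^'k^'k" and R \<epsilon> :: real
  assumes \<epsilon>: "\<epsilon> > 0" and M: "det M \<noteq> 0" "M \<in> admissible norm ((2 * real CARD('k) + 1) * \<epsilon>)"
    and R: "\<bar>det M\<bar> < R * \<epsilon> ^ (CARD('k) - 1)"
  shows "\<exists>N \<in> int_mats. det N \<noteq> 0 \<and> M ** N \<in> entry_cube (max \<epsilon> R)"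
proof -
  define d where "d = real CARD('k)"
  obtain z where z: "\<And>i. z i \<in> int_vecs" "\<And>i j. j \<noteq> i \<Longrightarrow> \<bar>(M *v z i) $ j\<bar> \<le> \<epsilon>"
    "\<And>i. d * \<epsilon> < \<bar>(M *v z i) $ i\<bar>" "\<And>i. \<bar>(M *v z i) $ i\<bar> \<le> R"
    using exists_lattice_vector_along_axis[OF assms] unfolding d_def by metis
  define N :: "real^'k^'k" where "N = (\<chi> a i. z i $ a)"
  have N: "N \<in> int_mats"
    using z(1) by (auto simp: N_def int_mats_def int_vecs_def)
  have W: "(M ** N) $ a $ i = (M *v z i) $ a" for a i
    by (simp add: N_def matrix_matrix_mult_def matrix_vector_mult_def)
  have "det (M ** N) \<noteq> 0"
  proof (rule strictly_diagonally_dominant_det)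
    fix i
    have "(\<Sum>j\<in>UNIV - {i}. \<bar>(M ** N) $ i $ j\<bar>) \<le> real (card (UNIV - {i})) * \<epsilon>"
      using z(2) by (intro sum_bounded_above) (auto simp: W)
    also have "\<dots> \<le> d * \<epsilon>"
      using \<epsilon> by (simp add: d_def card_Diff_singleton)
    also have "\<dots> < \<bar>(M ** N) $ i $ i\<bar>"
      by (simp add: W z(3))
    finally show "(\<Sum>j\<in>UNIV - {i}. \<bar>(M ** N) $ i $ j\<bar>) < \<bar>(M ** N) $ i $ i\<bar>" .
  qed
  then have "det N \<noteq> 0"
    by (simp add: det_mul)
  moreover have "\<bar>(M ** N) $ a $ i\<bar> \<le> max \<epsilon> R" for a i
    using z(2)[of a i] z(4)[of i] by (cases "a = i") (auto simp: W le_max_iff_disj)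
  ultimately show ?thesis
    using N by (auto simp: entry_cube_def)
qed

lemma GLZ_of_cong:
  fixes N N' :: "real^'k^'k"
  assumes N: "N \<in> int_mats" and N': "N' \<in> int_mats" "det N' = det N" "det N \<noteq> 0"
    and cong: "\<And>i j. \<exists>q \<in> \<int>. N $ i $ j - N' $ i $ j = det N * q"
  shows "\<exists>\<gamma> \<in> GLZ. N = \<gamma> ** N'"
proof -
  obtain X where X: "\<And>i j. X i j \<in> \<int>" "\<And>i j. N $ i $ j - N' $ i $ j = det N * X i j"
    using cong by metis
  define Y :: "real^'k^'k" where "Y = (\<chi> i j. X i j)"
  have Y: "Y \<in> int_mats" "N = N' + det N *\<^sub>R Y"
    using X by (auto simp: Y_def int_mats_def vec_eq_iff algebra_simps)
  define \<gamma> where "\<gamma> = mat 1 + Y ** (det N' *\<^sub>R matrix_inv N')"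
  have "\<gamma> \<in> int_mats"
    unfolding \<gamma>_def using N' Y(1)
    by (intro int_mats_add int_mats_1 int_mats_mult int_mats_adjugate) auto
  moreover have N_eq: "N = \<gamma> ** N'"
    using N'(2,3) Y(2)
    by (simp add: \<gamma>_def matrix_add_rdistrib matrix_scaleR_right matrix_scaleR_left
      matrix_mult_matrix_inv_cancel)
  then have "det \<gamma> * det N' = det N"
    by (metis det_mul)
  then have "\<bar>det \<gamma>\<bar> = 1"
    using N'(2,3) by simp
  ultimately show ?thesis
    using N_eq by (auto simp: GLZ_def)
qed

text \<open>Congruence modulo the determinant is what makes the set of classes finite, so that no
  normal form of integral matrices is needed.\<close>

definition det_residues :: "real^'k^'k \<Rightarrow> int \<times> ('k \<times> 'k \<Rightarrow> int)" where
  "det_residues N = (\<lfloor>det N\<rfloor>, \<lambda>(i, j). \<lfloor>N $ i $ j\<rfloor> mod \<lfloor>det N\<rfloor>)"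

lemma finite_det_residues:
  "finite (det_residues ` {N \<in> int_mats :: (real^'k^'k) set. det N \<noteq> 0 \<and> \<bar>det N\<bar> \<le> J})"
proof (rule finite_subset)
  define I where "I = {-\<lceil>J\<rceil>..\<lceil>J\<rceil>}"
  show "det_residues ` {N \<in> int_mats :: (real^'k^'k) set. det N \<noteq> 0 \<and> \<bar>det N\<bar> \<le> J}
      \<subseteq> I \<times> (\<Pi>\<^sub>E p\<in>UNIV. I)"
  proof (rule image_subsetI)
    fix N :: "real^'k^'k" assume N: "N \<in> {N \<in> int_mats. det N \<noteq> 0 \<and> \<bar>det N\<bar> \<le> J}"
    then have "of_int \<lfloor>det N\<rfloor> = det N"
      using det_int_mats[of N] by auto
    then have D: "\<lfloor>det N\<rfloor> \<noteq> 0" "real_of_int \<bar>\<lfloor>det N\<rfloor>\<bar> \<le> J"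
      using N by auto
    then have det_bound: "\<bar>\<lfloor>det N\<rfloor>\<bar> \<le> \<lceil>J\<rceil>" by linarith
    then have "x mod \<lfloor>det N\<rfloor> \<in> I" for x
      using abs_mod_less[OF D(1), of x] by (auto simp: I_def)
    moreover have "\<lfloor>det N\<rfloor> \<in> I"
      using det_bound by (auto simp: I_def)
    ultimately show "det_residues N \<in> I \<times> (\<Pi>\<^sub>E p\<in>UNIV. I)"
      by (auto simp: det_residues_def PiE_iff)
  qed
  show "finite (I \<times> (\<Pi>\<^sub>E p\<in>(UNIV :: ('k \<times> 'k) set). I))"
    by (auto simp: I_def intro!: finite_PiE)
qed

lemma GLZ_of_det_residues_eq:
  fixes N N' :: "real^'k^'k"
  assumes N: "N \<in> int_mats" "N' \<in> int_mats" "det N \<noteq> 0" and eq: "det_residues N' = det_residues N"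
  shows "\<exists>\<gamma> \<in> GLZ. N = \<gamma> ** N'"
proof (rule GLZ_of_cong)
  have floor: "of_int \<lfloor>x\<rfloor> = x" if "x \<in> \<int>" for x :: real
    using that by (metis Ints_cases floor_of_int)
  have det_floor: "\<lfloor>det N'\<rfloor> = \<lfloor>det N\<rfloor>"
    using eq by (simp add: det_residues_def)
  then show "det N' = det N"
    using floor[OF det_int_mats[OF N(1)]] floor[OF det_int_mats[OF N(2)]] by metis
  fix i j
  have "\<lfloor>N $ i $ j\<rfloor> mod \<lfloor>det N\<rfloor> = \<lfloor>N' $ i $ j\<rfloor> mod \<lfloor>det N\<rfloor>"
    using arg_cong[OF eq, of "\<lambda>x. snd x (i, j)"] det_floor by (simp add: det_residues_def)
  then obtain q where q: "\<lfloor>N $ i $ j\<rfloor> - \<lfloor>N' $ i $ j\<rfloor> = \<lfloor>det N\<rfloor> * q"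
    by (metis mod_eq_dvd_iff dvdE)
  moreover have "of_int \<lfloor>N $ i $ j\<rfloor> = N $ i $ j" "of_int \<lfloor>N' $ i $ j\<rfloor> = N' $ i $ j"
    using N(1,2) by (auto simp: int_mats_def)
  ultimately have "N $ i $ j - N' $ i $ j = det N * of_int q"
    using arg_cong[OF q, of real_of_int] floor[OF det_int_mats[OF N(1)]]
    unfolding of_int_diff of_int_mult by metis
  then show "\<exists>q \<in> \<int>. N $ i $ j - N' $ i $ j = det N * q"
    by auto
qed (use N in auto)

lemma finite_GLZ_classes:
  fixes J :: real
  obtains \<N> :: "(real^'k^'k) set" where "finite \<N>" "\<And>N. N \<in> \<N> \<Longrightarrow> det N \<noteq> 0"
    "\<And>N. N \<in> int_mats \<Longrightarrow> det N \<noteq> 0 \<Longrightarrow> \<bar>det N\<bar> \<le> J \<Longrightarrow> \<exists>N' \<in> \<N>. \<exists>\<gamma> \<in> GLZ. N = \<gamma> ** N'"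
proof -
  define A :: "(real^'k^'k) set" where "A = {N \<in> int_mats. det N \<noteq> 0 \<and> \<bar>det N\<bar> \<le> J}"
  have "finite (det_residues ` A)"
    unfolding A_def by (rule finite_det_residues)
  then obtain \<N> where \<N>: "\<N> \<subseteq> A" "finite \<N>" "det_residues ` A = det_residues ` \<N>"
    using finite_subset_image[of "det_residues ` A" det_residues A] by auto
  show thesis
  proof (rule that[OF \<N>(2)])
    show "det N \<noteq> 0" if "N \<in> \<N>" for N
      using that \<N>(1) by (auto simp: A_def)
    fix N :: "real^'k^'k"
    assume N: "N \<in> int_mats" "det N \<noteq> 0" "\<bar>det N\<bar> \<le> J"
    then have "det_residues N \<in> det_residues ` \<N>"
      unfolding \<N>(3)[symmetric] by (auto simp: A_def)
    then obtain N' where N': "N' \<in> \<N>" "det_residues N' = det_residues N"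
      by auto
    then show "\<exists>N' \<in> \<N>. \<exists>\<gamma> \<in> GLZ. N = \<gamma> ** N'"
      using GLZ_of_det_residues_eq[OF N(1) _ N(2) N'(2)] \<N>(1) by (auto simp: A_def)
  qed
qed

lemma exists_bounded_index_sublattice:
  fixes \<eta> b :: real
  assumes \<eta>: "\<eta> > 0"
  obtains K J where "\<And>M :: real^'k^'k. det M \<noteq> 0 \<Longrightarrow> \<bar>det M\<bar> \<le> b \<Longrightarrow> M \<in> admissible norm \<eta> \<Longrightarrow>
    \<exists>N \<in> int_mats. det N \<noteq> 0 \<and> \<bar>det N\<bar> \<le> J \<and> norm (M ** N) \<le> K"
proof -
  define d where "d = real CARD('k)"
  define \<epsilon> where "\<epsilon> = \<eta> / (2 * d + 1)"
  have \<epsilon>: "\<epsilon> > 0" "(2 * d + 1) * \<epsilon> = \<eta>"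
    using \<eta> by (simp_all add: \<epsilon>_def d_def add_pos_nonneg)
  define B where "B = max \<epsilon> ((\<bar>b\<bar> + 1) / \<epsilon> ^ (CARD('k) - 1))"
  obtain K where K: "\<And>W :: real^'k^'k. W \<in> entry_cube B \<Longrightarrow> norm W \<le> K"
    using bounded_entry_cube[of B] unfolding bounded_iff by blast
  obtain P where P: "\<And>W :: real^'k^'k. W \<in> entry_cube B \<Longrightarrow> \<bar>det W\<bar> \<le> P"
    by (rule det_entry_cube_bounded) blast
  define \<delta> where "\<delta> = (\<eta> / d) ^ CARD('k)"
  have \<delta>: "\<delta> > 0"
    using \<eta> by (simp add: \<delta>_def d_def)
  show thesis
  proof (rule that[of "P / \<delta>" K])
    fix M :: "real^'k^'k"
    assume M: "det M \<noteq> 0" "\<bar>det M\<bar> \<le> b" "M \<in> admissible norm \<eta>"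
    have "\<exists>N \<in> int_mats. det N \<noteq> 0 \<and> M ** N \<in> entry_cube B"
      unfolding B_def using M \<epsilon> by (intro exists_bounded_sublattice) (auto simp: d_def)
    then obtain N where N: "N \<in> int_mats" "det N \<noteq> 0" "M ** N \<in> entry_cube B"
      by blast
    have "\<delta> * \<bar>det N\<bar> \<le> \<bar>det M\<bar> * \<bar>det N\<bar>"
      using admissible_norm_det_ge[OF \<eta> M(1,3)] by (intro mult_right_mono) (auto simp: \<delta>_def d_def)
    also have "\<dots> \<le> P"
      using P[OF N(3)] by (simp add: det_mul abs_mult)
    finally have "\<bar>det N\<bar> \<le> P / \<delta>"
      using \<delta> by (simp add: field_simps)
    then show "\<exists>N \<in> int_mats. det N \<noteq> 0 \<and> \<bar>det N\<bar> \<le> P / \<delta> \<and> norm (M ** N) \<le> K"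
      using N K by blast
  qed
qed

theorem admissible_bounded_representative:
  fixes \<eta> b :: real
  assumes "\<eta> > 0"
  obtains R where "\<And>M :: real^'k^'k. det M \<noteq> 0 \<Longrightarrow> \<bar>det M\<bar> \<le> b \<Longrightarrow> M \<in> admissible norm \<eta> \<Longrightarrow>
    \<exists>\<gamma> \<in> GLZ. norm (M ** \<gamma>) \<le> R"
proof -
  obtain K J where KJ: "\<And>M :: real^'k^'k. det M \<noteq> 0 \<Longrightarrow> \<bar>det M\<bar> \<le> b \<Longrightarrow> M \<in> admissible norm \<eta> \<Longrightarrow>
      \<exists>N \<in> int_mats. det N \<noteq> 0 \<and> \<bar>det N\<bar> \<le> J \<and> norm (M ** N) \<le> K"
    using assms by (rule exists_bounded_index_sublattice) blast
  obtain \<N> :: "(real^'k^'k) set" where \<N>: "finite \<N>" "\<And>N. N \<in> \<N> \<Longrightarrow> det N \<noteq> 0"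
    "\<And>N. N \<in> int_mats \<Longrightarrow> det N \<noteq> 0 \<Longrightarrow> \<bar>det N\<bar> \<le> J \<Longrightarrow> \<exists>N' \<in> \<N>. \<exists>\<gamma> \<in> GLZ. N = \<gamma> ** N'"
    by (rule finite_GLZ_classes) blast
  define c where "c = (\<Sum>N\<in>\<N>. norm (matrix_inv N))"
  have "\<exists>\<gamma> \<in> GLZ. norm (M ** \<gamma>) \<le> K * c"
    if M: "det M \<noteq> 0" "\<bar>det M\<bar> \<le> b" "M \<in> admissible norm \<eta>" for M :: "real^'k^'k"
  proof -
    obtain N where N: "N \<in> int_mats" "det N \<noteq> 0" "\<bar>det N\<bar> \<le> J" "norm (M ** N) \<le> K"
      using KJ[OF M] by blast
    then obtain N' \<gamma> where N': "N' \<in> \<N>" "\<gamma> \<in> GLZ" "N = \<gamma> ** N'"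
      using \<N>(3)[OF N(1-3)] by blast
    have "M ** \<gamma> = (M ** N) ** matrix_inv N'"
      by (simp add: N'(3) matrix_mul_assoc matrix_mult_matrix_inv_cancel \<N>(2)[OF N'(1)])
    then have "norm (M ** \<gamma>) \<le> norm (M ** N) * norm (matrix_inv N')"
      by (simp add: norm_matrix_matrix_mult_le)
    also have "\<dots> \<le> K * c"
      unfolding c_def using N'(1) \<N>(1) N(4)
      by (intro mult_mono member_le_sum) (auto intro: order_trans[OF norm_ge_zero])
    finally show ?thesis using N'(2) by blast
  qed
  then show thesis by (rule that)
qed

section \<open>The diagonal flow and its expanding horospheres\<close>

lemma sum_over_sum_type:
  "(\<Sum>i\<in>(UNIV :: ('m::finite + 'n::finite) set). f i) = (\<Sum>a\<in>UNIV. f (Inl a)) + (\<Sum>b\<in>UNIV. f (Inr b))"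
  unfolding UNIV_Plus_UNIV[symmetric] by (subst sum.Plus) simp_all

lemma prod_over_sum_type:
  "(\<Prod>i\<in>(UNIV :: ('m::finite + 'n::finite) set). f i) = (\<Prod>a\<in>UNIV. f (Inl a)) * (\<Prod>b\<in>UNIV. f (Inr b))"
  unfolding UNIV_Plus_UNIV[symmetric] by (subst prod.Plus) simp_all

lemma vec_sum_eqI:
  fixes x y :: "'a^('m::finite + 'n::finite)"
  assumes "\<And>a. x $ Inl a = y $ Inl a" "\<And>b. x $ Inr b = y $ Inr b"
  shows "x = y"
  unfolding vec_eq_iff
proof
  show "x $ i = y $ i" for i by (cases i) (simp_all add: assms)
qed

lemma block_diag_eq_diag_mat:
  "block_diag a b = diag_mat (\<lambda>i::'m::finite + 'n::finite. case i of Inl _ \<Rightarrow> a | Inr _ \<Rightarrow> b)"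
  by (simp add: block_diag_def diag_mat_def)

lemma block_diag_vec:
  "(block_diag a b *v x) $ Inl i = a * x $ Inl i" "(block_diag a b *v x) $ Inr j = b * x $ Inr j"
  by (simp_all add: block_diag_eq_diag_mat diag_mat_vec)

lemma block_diag_mult: "block_diag a b ** block_diag a' b' = block_diag (a * a') (b * b')"
  unfolding block_diag_eq_diag_mat diag_mat_mult_diag_mat
  by (intro arg_cong[of _ _ diag_mat] ext) (auto split: sum.split)

lemma block_diag_1: "block_diag 1 1 = mat 1"
  by (auto simp: block_diag_def mat_def vec_eq_iff split: sum.split)

lemma det_block_diag:
  "det (block_diag a b :: real^('m::finite + 'n::finite)^('m + 'n)) = a ^ CARD('m) * b ^ CARD('n)"
  by (simp add: block_diag_eq_diag_mat det_diag_mat prod_over_sum_type)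

definition uni :: "real^'n^'m \<Rightarrow> real^('m::finite + 'n::finite)^('m + 'n)" where
  "uni B = (\<chi> i j. case i of
     Inl a \<Rightarrow> (case j of Inl c \<Rightarrow> if a = c then 1 else 0 | Inr b \<Rightarrow> B $ a $ b)
   | Inr b \<Rightarrow> (case j of Inl c \<Rightarrow> 0 | Inr b' \<Rightarrow> if b = b' then 1 else 0))"

lemma uni_vec:
  "(uni B *v x) $ Inl a = x $ Inl a + (\<Sum>b\<in>UNIV. B $ a $ b * x $ Inr b)"
  "(uni B *v x) $ Inr b = x $ Inr b"
  by (simp_all add: uni_def matrix_vector_mult_def sum_over_sum_type if_distrib[of "\<lambda>y. y * _"]
    cong: if_cong)

lemma uni_mult: "uni A ** uni B = uni (A + B)"
  unfolding matrix_eq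
proof
  show "(uni A ** uni B) *v x = uni (A + B) *v x" for x
    unfolding matrix_vector_mul_assoc[symmetric]
    by (rule vec_sum_eqI) (simp_all add: uni_vec sum.distrib algebra_simps)
qed

lemma uni_0: "uni 0 = mat 1"
  by (auto simp: uni_def mat_def vec_eq_iff split: sum.split)

lemma block_diag_uni:
  assumes "b \<noteq> 0"
  shows "block_diag a b ** uni B = uni ((a / b) *\<^sub>R B) ** block_diag a b"
  unfolding matrix_eq
proof
  show "(block_diag a b ** uni B) *v x = (uni ((a / b) *\<^sub>R B) ** block_diag a b) *v x" for x
    unfolding matrix_vector_mul_assoc[symmetric] using assms
    by (intro vec_sum_eqI) (simp_all add: uni_vec block_diag_vec sum_distrib_left algebra_simps)
qed

lemma det_uni: "det (uni B) = 1"
proof -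
  have "block_diag 2 1 ** uni B = uni B ** uni B ** block_diag 2 1"
    using block_diag_uni[of 1 2 B] by (simp add: uni_mult scaleR_2)
  then have "det (block_diag 2 1 ** uni B) = det (uni B ** uni B ** block_diag 2 1)"
    by simp
  then have "det (uni B) = det (uni B) * det (uni B)"
    by (simp add: det_mul det_block_diag)
  moreover have "det (uni B) * det (uni (- B)) = 1"
    unfolding det_mul[symmetric] by (simp add: uni_mult uni_0)
  ultimately show ?thesis
    by (metis mult_cancel_left1 mult_zero_left zero_neq_one)
qed

lemma tendsto_uni [tendsto_intros]:
  assumes "(f \<longlongrightarrow> A) F"
  shows "((\<lambda>x. uni (f x)) \<longlongrightarrow> uni A) F"
proof (intro vec_tendstoI)
  show "((\<lambda>x. uni (f x) $ i $ j) \<longlongrightarrow> uni A $ i $ j) F" for i j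
    by (cases i; cases j) (auto simp: uni_def intro!: tendsto_intros assms)
qed

lemma continuous_on_uni [continuous_intros]:
  "continuous_on S f \<Longrightarrow> continuous_on S (\<lambda>x. uni (f x))"
  by (simp add: continuous_on_def tendsto_uni)

definition flow :: "real \<Rightarrow> real^('m::finite + 'n::finite)^('m + 'n)" where
  "flow t = block_diag (t powr (real CARD('n) / real CARD('m))) (1 / t)"

definition expansion_rate :: "'m::finite itself \<Rightarrow> 'n::finite itself \<Rightarrow> real \<Rightarrow> real" where
  "expansion_rate _ _ t = t powr (real CARD('n) / real CARD('m)) * t"

lemma flow_vec:
  fixes x :: "real^('m::finite + 'n::finite)"
  shows "(flow t *v x) $ Inl i = t powr (real CARD('n) / real CARD('m)) * x $ Inl i"
    "(flow t *v x) $ Inr j = x $ Inr j / t"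
  by (simp_all add: flow_def block_diag_vec)

lemma flow_mult: "s > 0 \<Longrightarrow> t > 0 \<Longrightarrow> flow s ** flow t = flow (s * t)"
  by (simp add: flow_def block_diag_mult powr_mult)

lemma flow_1: "flow 1 = mat 1"
  by (simp add: flow_def block_diag_1)

lemma flow_inverse:
  assumes "t > 0"
  shows "flow (1 / t) ** (flow t ** X) = X" "flow t ** (flow (1 / t) ** X) = X"
  using assms by (simp_all add: matrix_mul_assoc flow_mult flow_1)

lemma powr_exponent_power:
  assumes "t > 0"
  shows "(t powr (real CARD('n::finite) / real CARD('m::finite))) ^ CARD('m) = t ^ CARD('n)"
  using assms by (simp add: powr_realpow[symmetric] powr_powr)

lemma det_flow: "t > 0 \<Longrightarrow> det (flow t) = 1"
  by (simp add: flow_def det_block_diag powr_exponent_power power_divide)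

lemma expansion_rate_ge:
  assumes "t \<ge> 1"
  shows "t \<le> expansion_rate TYPE('m::finite) TYPE('n::finite) t"
proof -
  have "1 * t \<le> t powr (real CARD('n) / real CARD('m)) * t"
    using assms by (intro mult_right_mono) (auto simp: ge_one_powr_ge_zero)
  then show ?thesis by (simp add: expansion_rate_def)
qed

lemma flow_uni:
  fixes B :: "real^'n^'m"
  assumes "t > 0"
  shows "flow t ** uni B = uni (expansion_rate TYPE('m) TYPE('n) t *\<^sub>R B) ** flow t"
  using assms block_diag_uni[of "1 / t" _ B] by (simp add: flow_def expansion_rate_def)

section \<open>Nondivergence estimates\<close>

lemma det_identity_with_row: "det (\<chi> i. if i = j then w else axis i 1) = w $ j" for w :: "real^'a"
proof -
  have "(\<chi> i. if i = j then w else axis i 1) =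
      transpose (\<chi> i l. if l = j then (mat 1 *v w) $ i else mat 1 $ i $ l)"
    by (simp add: vec_eq_iff transpose_def) (simp add: axis_def mat_def)
  then show ?thesis
    by (simp add: cramer_lemma del: matrix_vector_mul_lid)
qed

definition row_slab :: "real \<Rightarrow> real^'a \<Rightarrow> real \<Rightarrow> real \<Rightarrow> (real^'a) set" where
  "row_slab R w p l = {x. (\<forall>i. \<bar>x $ i\<bar> \<le> R) \<and> \<bar>x \<bullet> w - p\<bar> < l}"

lemma row_slab_eq: "row_slab R w p l = cbox (\<chi> i. - R) (\<chi> i. R) \<inter> {x. \<bar>x \<bullet> w - p\<bar> < l}"
  by (auto simp: row_slab_def mem_box_cart abs_le_iff minus_le_iff)

lemma borel_row_slab: "row_slab R w p l \<in> sets borel"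
  unfolding row_slab_eq
  by (intro sets.Int borel_closed[OF closed_cbox] borel_open[OF open_Collect_less]
    continuous_intros)

lemma bounded_row_slab: "bounded (row_slab R w p l)"
  unfolding row_slab_eq by (intro bounded_Int disjI1 bounded_cbox)

lemma emeasure_row_slab_le:
  fixes w :: "real^'a"
  assumes w: "w \<noteq> 0" and R: "R > 0" and l: "l > 0"
  shows "emeasure lborel (row_slab R w p l) \<le> (2 * R) ^ CARD('a) * (l / (R * infnorm w))"
proof -
  define S where "S = row_slab R w p l"
  obtain j where j: "infnorm w = \<bar>w $ j\<bar>"
    by (rule infnorm_attained)
  have wj_nonzero: "w $ j \<noteq> 0"
    using w j infnorm_eq_0[of w] by auto
  have S: "S \<in> lmeasurable"
    unfolding S_def
    by (intro bounded_set_imp_lmeasurable bounded_row_slab) (simp add: borel_row_slab)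
  define A :: "real^'a^'a" where "A = (\<chi> i. if i = j then w else axis i 1)"
  define C where "C = cbox (\<chi> i. if i = j then p - l else - R) (\<chi> i. if i = j then p + l else R)"
  have det_A: "det A = w $ j"
    unfolding A_def by (rule det_identity_with_row)
  have "\<bar>w $ j\<bar> * measure lebesgue S = measure lebesgue ((*v) A ` S)"
    using wj_nonzero S by (simp add: measure_matrix_vector_image det_A)
  also have "\<dots> \<le> measure lebesgue C"
  proof (rule measure_mono_fmeasurable)
    have "A *v x = (\<chi> i. if i = j then x \<bullet> w else x $ i)" for x
      by (simp add: vec_eq_iff A_def matrix_vector_mul_component inner_axis' inner_commute[of w])
    then show "(*v) A ` S \<subseteq> C"
      by (auto simp: S_def row_slab_def C_def mem_box_cart abs_le_iff abs_less_iff minus_le_iff)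
    show "(*v) A ` S \<in> sets lebesgue"
      using wj_nonzero S by (intro fmeasurableD measurable_matrix_vector_image) (simp_all add: det_A)
  qed (simp add: C_def)
  also have "\<dots> = (\<Prod>i\<in>UNIV. if i = j then 2 * l else 2 * R)"
    using R l by (simp add: C_def measure_completion content_cbox_cart interval_ne_empty_cart)
      (intro prod.cong; simp)
  also have "\<dots> = 2 * l * (2 * R) ^ (CARD('a) - 1)"
    by (subst prod.remove[of _ j]) (auto simp: card_Diff_singleton intro!: prod.cong)
  also have "\<dots> = (2 * R) ^ CARD('a) * (l / R)"
    using R by (simp add: power_eq_if)
  finally have "measure lborel S \<le> (2 * R) ^ CARD('a) * (l / (R * infnorm w))"
    using wj_nonzero R by (simp add: measure_completion borel_row_slab S_def j field_simps)
  moreover have "emeasure lborel S = measure lborel S"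
    unfolding S_def using emeasure_bounded_finite[OF bounded_row_slab, of R w p l]
    by (intro emeasure_eq_ennreal_measure) simp
  ultimately show ?thesis
    by (simp add: S_def[symmetric] ennreal_leI)
qed

definition slab :: "real \<Rightarrow> 'b set \<Rightarrow> real^'a \<Rightarrow> ('b \<Rightarrow> real) \<Rightarrow> real \<Rightarrow> (real^'a^'b) set" where
  "slab R I w p l = {X \<in> entry_cube R. \<forall>i\<in>I. \<bar>X $ i \<bullet> w - p i\<bar> < l}"

lemma
  fixes w :: "real^'a" and I :: "'b::finite set"
  assumes w: "w \<noteq> 0" and R: "R > 0" and l: "l > 0"
  shows borel_matrix_slab: "slab R I w p l \<in> sets borel"
    and measure_matrix_slab_le:
      "measure lborel (slab R I w p l) \<le>
        (2 * R) ^ (CARD('a) * CARD('b)) * (l / (R * infnorm w)) ^ card I"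
proof -
  define T where "T = (\<lambda>i. if i \<in> I then row_slab R w (p i) l
    else cbox (\<chi> k. - R) (\<chi> k. R))"
  define b where "b = (\<lambda>i. (2 * R) ^ CARD('a) * (if i \<in> I then l / (R * infnorm w) else 1))"
  have slab_eq: "slab R I w p l = {X. \<forall>i. X $ i \<in> T i}"
    by (auto simp: slab_def row_slab_def entry_cube_def T_def mem_box_cart abs_le_iff minus_le_iff
      split: if_splits)
  have T: "T i \<in> sets borel" for i
    by (simp add: T_def borel_row_slab)
  have b_nonneg: "b i \<ge> 0" for i
    using R l infnorm_pos_le[of w] by (simp add: b_def)
  have "emeasure lborel (T i) \<le> b i" for i
  proof (cases "i \<in> I")
    case True
    then show ?thesis
      using emeasure_row_slab_le[OF assms, of "p i"] by (simp add: T_def b_def)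
  next
    case False
    have "(\<chi> k. - R) \<bullet> b \<le> (\<chi> k. R) \<bullet> b" if "b \<in> Basis" for b :: "real^'a"
      using that R by (auto simp: Basis_vec_def inner_axis)
    then show ?thesis
      using False R by (simp add: T_def b_def emeasure_lborel_cbox prod_Basis_vec inner_axis)
  qed
  then have "emeasure lborel (slab R I w p l) \<le> (\<Prod>i\<in>UNIV. ennreal (b i))"
    unfolding slab_eq emeasure_lborel_vec_Pi[OF T] by (intro prod_mono_ennreal)
  also have "\<dots> = ennreal (\<Prod>i\<in>UNIV. b i)"
    using b_nonneg by (simp add: prod_ennreal)
  finally have "measure lborel (slab R I w p l) \<le> (\<Prod>i\<in>UNIV. b i)"
    using b_nonneg by (simp add: measure_def enn2real_leI prod_nonneg)
  also have "\<dots> = (2 * R) ^ (CARD('a) * CARD('b)) * (l / (R * infnorm w)) ^ card I"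
    by (simp add: b_def prod.distrib power_mult prod.If_cases)
  finally show "measure lborel (slab R I w p l) \<le> \<dots>" .
  show "slab R I w p l \<in> sets borel"
    unfolding slab_eq using T by (rule borel_vec_Pi)
qed

lemma
  assumes "r \<ge> 0"
  shows finite_Ints_abs_le: "finite {x \<in> \<int>. \<bar>x\<bar> \<le> r}"
    and card_Ints_abs_le: "real (card {x \<in> \<int>. \<bar>x\<bar> \<le> r}) \<le> 2 * r + 1"
proof -
  have eq: "{x \<in> \<int>. \<bar>x\<bar> \<le> r} = of_int ` {- \<lfloor>r\<rfloor> .. \<lfloor>r\<rfloor>}"
    by (force elim!: Ints_cases simp: abs_le_iff le_floor_iff minus_le_iff)
  show "finite {x \<in> \<int>. \<bar>x\<bar> \<le> r}"
    unfolding eq by simp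
  have "card {x \<in> \<int>. \<bar>x\<bar> \<le> r} = nat (2 * \<lfloor>r\<rfloor> + 1)"
    unfolding eq by (subst card_image) (auto simp: inj_on_def)
  then show "real (card {x \<in> \<int>. \<bar>x\<bar> \<le> r}) \<le> 2 * r + 1"
    using assms by simp
qed

definition int_sphere :: "nat \<Rightarrow> (real^'a) set" where
  "int_sphere k = {w \<in> int_vecs. infnorm w = real k}"

lemma int_sphere_subset:
  "(int_sphere k :: (real^'a) set) \<subseteq>
    vec_lambda ` (\<Union>j. \<Pi>\<^sub>E i\<in>UNIV. if i = j then {- real k, real k} else {x \<in> \<int>. \<bar>x\<bar> \<le> real k})"
proof
  fix w :: "real^'a" assume w: "w \<in> int_sphere k"
  obtain j where j: "infnorm w = \<bar>w $ j\<bar>"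
    by (rule infnorm_attained)
  have "w $ i \<in> {x \<in> \<int>. \<bar>x\<bar> \<le> real k}" for i
    using w component_le_infnorm_cart[of w i] by (simp add: int_sphere_def int_vecs_def)
  moreover have "w $ j \<in> {- real k, real k}"
    using w j by (auto simp: int_sphere_def)
  ultimately have "vec_nth w \<in>
      (\<Pi>\<^sub>E i\<in>UNIV. if i = j then {- real k, real k} else {x \<in> \<int>. \<bar>x\<bar> \<le> real k})"
    by (simp add: PiE_iff)
  then show "w \<in> vec_lambda `
      (\<Union>j. \<Pi>\<^sub>E i\<in>UNIV. if i = j then {- real k, real k} else {x \<in> \<int>. \<bar>x\<bar> \<le> real k})"
    by (intro image_eqI[of _ _ "vec_nth w"]) auto
qed

lemma
  assumes k: "k \<ge> 1"
  shows finite_int_sphere: "finite (int_sphere k :: (real^'a) set)"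
    and card_int_sphere_le:
      "real (card (int_sphere k :: (real^'a) set))
          \<le> 2 * real CARD('a) * (3 * real k) ^ (CARD('a) - 1)"
proof -
  define S where "S = {x \<in> \<int>. \<bar>x\<bar> \<le> real k}"
  have S: "finite S" "real (card S) \<le> 3 * real k"
    using finite_Ints_abs_le[of "real k"] card_Ints_abs_le[of "real k"] k by (auto simp: S_def)
  define F :: "'a \<Rightarrow> ('a \<Rightarrow> real) set" where
    "F = (\<lambda>j. \<Pi>\<^sub>E i\<in>UNIV. if i = j then {- real k, real k} else S)"
  have sphere_subset: "int_sphere k \<subseteq> vec_lambda ` (\<Union>j. F j)"
    unfolding F_def S_def by (rule int_sphere_subset)
  have finite_F: "finite (F j)" for j
    unfolding F_def by (intro finite_PiE) (auto simp: S(1))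
  show "finite (int_sphere k :: (real^'a) set)"
    by (rule finite_subset[OF sphere_subset]) (simp add: finite_F)
  have "card (int_sphere k :: (real^'a) set) \<le> card (\<Union>j. F j)"
    using card_mono[OF finite_imageI sphere_subset] card_image_le[of "\<Union>j. F j" vec_lambda] finite_F
    by force
  then have "real (card (int_sphere k :: (real^'a) set)) \<le> (\<Sum>j\<in>UNIV. real (card (F j)))"
    using card_UN_le[of UNIV F] by (simp flip: of_nat_sum)
  also have "\<dots> \<le> real CARD('a) * (2 * (3 * real k) ^ (CARD('a) - 1))"
  proof (rule sum_bounded_above)
    fix j
    have "card (F j) = card {- real k, real k} * (\<Prod>i\<in>UNIV - {j}. card S)"
      unfolding F_def card_PiE[OF finite] by (subst prod.remove[of _ j]) (auto intro!: prod.cong)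
    then have "real (card (F j)) = 2 * real (card S) ^ (CARD('a) - 1)"
      using k by (simp add: card_Diff_singleton)
    also have "\<dots> \<le> 2 * (3 * real k) ^ (CARD('a) - 1)"
      using S(2) by (intro mult_left_mono power_mono) auto
    finally show "real (card (F j)) \<le> 2 * (3 * real k) ^ (CARD('a) - 1)" .
  qed
  finally show "real (card (int_sphere k :: (real^'a) set))
      \<le> 2 * real CARD('a) * (3 * real k) ^ (CARD('a) - 1)"
    by simp
qed

definition int_ball :: "real \<Rightarrow> (real^'a) set" where
  "int_ball X = {w \<in> int_vecs - {0}. infnorm w \<le> X}"

lemma int_ball_eq_Union_int_sphere: "int_ball X = (\<Union>k\<in>{1..nat \<lfloor>X\<rfloor>}. int_sphere k)"
proof (intro equalityI subsetI)
  fix w assume w: "w \<in> int_ball X"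
  obtain j where j: "infnorm w = \<bar>w $ j\<bar>"
    by (rule infnorm_attained)
  have "w $ j \<in> \<int>"
    using w by (simp add: int_ball_def int_vecs_def)
  then obtain n where "w $ j = of_int n"
    by (rule Ints_cases)
  then have norm: "infnorm w = real (nat \<bar>n\<bar>)"
    by (simp add: j)
  moreover have "1 \<le> infnorm w"
    using w by (intro int_vecs_infnorm_ge_1) (simp add: int_ball_def)
  ultimately have "nat \<bar>n\<bar> \<in> {1..nat \<lfloor>X\<rfloor>}" "w \<in> int_sphere (nat \<bar>n\<bar>)"
    using w by (auto simp: int_ball_def int_sphere_def le_nat_floor)
  then show "w \<in> (\<Union>k\<in>{1..nat \<lfloor>X\<rfloor>}. int_sphere k)" by blast
next
  fix w assume "w \<in> (\<Union>k\<in>{1..nat \<lfloor>X\<rfloor>}. int_sphere k)"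
  then obtain k where "w \<in> int_vecs" "infnorm w = real k" "1 \<le> k" "int k \<le> \<lfloor>X\<rfloor>"
    by (auto simp: int_sphere_def le_nat_iff)
  then show "w \<in> int_ball X"
    using infnorm_eq_0[of w] by (auto simp: int_ball_def le_floor_iff)
qed

lemma finite_int_ball: "finite (int_ball X)"
  unfolding int_ball_eq_Union_int_sphere by (auto intro: finite_int_sphere)

lemma sum_int_ball_inverse_power_le:
  assumes n: "1 \<le> n" "n \<le> CARD('a)" and X: "X \<ge> 0"
  shows "(\<Sum>w\<in>(int_ball X :: (real^'a) set). 1 / infnorm w ^ (CARD('a) - n))
    \<le> 2 * real CARD('a) * 3 ^ (CARD('a) - 1) * X ^ n"
proof -
  define c where "c = 2 * real CARD('a) * 3 ^ (CARD('a) - 1)"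
  have "(\<Sum>w\<in>(int_ball X :: (real^'a) set). 1 / infnorm w ^ (CARD('a) - n)) =
      (\<Sum>k\<in>{1..nat \<lfloor>X\<rfloor>}. \<Sum>w\<in>(int_sphere k :: (real^'a) set). 1 / infnorm w ^ (CARD('a) - n))"
    unfolding int_ball_eq_Union_int_sphere
    by (rule sum.UNION_disjoint) (auto simp: finite_int_sphere, auto simp: int_sphere_def)
  also have "\<dots> =
      (\<Sum>k\<in>{1..nat \<lfloor>X\<rfloor>}. real (card (int_sphere k :: (real^'a) set)) / real k ^ (CARD('a) - n))"
    by (intro sum.cong refl) (simp add: int_sphere_def)
  also have "\<dots> \<le> (\<Sum>k\<in>{1..nat \<lfloor>X\<rfloor>}. c * X ^ (n - 1))"
  proof (rule sum_mono)
    fix k assume k: "k \<in> {1..nat \<lfloor>X\<rfloor>}"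
    then have k_bounds: "real k \<le> X" "k > 0"
      using X by (auto simp: le_nat_iff le_floor_iff)
    have "real (card (int_sphere k :: (real^'a) set)) / real k ^ (CARD('a) - n)
        \<le> c * real k ^ (CARD('a) - 1) / real k ^ (CARD('a) - n)"
      using k by (intro divide_right_mono order_trans[OF card_int_sphere_le])
        (auto simp: c_def power_mult_distrib)
    also have "CARD('a) - 1 = (CARD('a) - n) + (n - 1)"
      using n by simp
    also have "c * real k ^ (CARD('a) - n + (n - 1)) / real k ^ (CARD('a) - n)
        = c * real k ^ (n - 1)"
      using k_bounds by (simp add: power_add)
    also have "\<dots> \<le> c * X ^ (n - 1)"
      using k_bounds by (intro mult_left_mono power_mono) (auto simp: c_def)
    finally show "real (card (int_sphere k :: (real^'a) set)) / real k ^ (CARD('a) - n)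
        \<le> c * X ^ (n - 1)" .
  qed
  also have "\<dots> = real (nat \<lfloor>X\<rfloor>) * (c * X ^ (n - 1))" by simp
  also have "\<dots> \<le> X * (c * X ^ (n - 1))"
    using X by (intro mult_right_mono) (auto simp: c_def)
  also have "\<dots> = c * X ^ n"
    using n by (simp add: power_eq_if)
  finally show ?thesis by (simp add: c_def)
qed

lemma bounded_borel_fmeasurable:
  fixes S :: "'a::euclidean_space set"
  shows "S \<in> sets borel \<Longrightarrow> bounded S \<Longrightarrow> S \<in> fmeasurable lborel"
  using emeasure_bounded_finite by (intro fmeasurableI) auto

lemma
  fixes I :: "'b::finite set" and w :: "real^'a"
  assumes w: "w \<noteq> 0" and R: "R > 0" and l: "l > 0" and P: "finite P"
    "real (card P) \<le> (Y * infnorm w) ^ e"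
    and dims: "CARD('a) + e = card I + n" "e \<le> card I"
  shows borel_Union_slabs: "(\<Union>p\<in>P. slab R I w p l) \<in> sets borel"
    and measure_Union_slabs_le: "measure lborel (\<Union>p\<in>P. slab R I w p l)
      \<le> (2 * R) ^ (CARD('a) * CARD('b)) * Y ^ e / R ^ card I * l ^ card I *
        (1 / infnorm w ^ (CARD('a) - n))"
proof -
  define M where "M = (2 * R) ^ (CARD('a) * CARD('b))"
  have norm: "infnorm w > 0"
    using w by (simp add: infnorm_pos_lt)
  show "(\<Union>p\<in>P. slab R I w p l) \<in> sets borel"
    using P(1) borel_matrix_slab[OF w R l] by (intro sets.finite_UN) auto
  have "measure lborel (\<Union>p\<in>P. slab R I w p l) \<le> (\<Sum>p\<in>P. measure lborel (slab R I w p l))"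
    using P(1) borel_matrix_slab[OF w R l] by (intro measure_UNION_le) auto
  also have "\<dots> \<le> real (card P) * (M * (l / (R * infnorm w)) ^ card I)"
    unfolding M_def by (intro sum_bounded_above measure_matrix_slab_le[OF w R l])
  also have "\<dots> \<le> (Y * infnorm w) ^ e * (M * (l / (R * infnorm w)) ^ card I)"
    using R l norm by (intro mult_right_mono P(2)) (auto simp: M_def)
  also have "\<dots> = M * Y ^ e / R ^ card I * l ^ card I * (infnorm w ^ e / infnorm w ^ card I)"
    by (simp add: power_mult_distrib power_divide)
  also have "infnorm w ^ e / infnorm w ^ card I = 1 / infnorm w ^ (CARD('a) - n)"
  proof -
    have "card I = e + (CARD('a) - n)"
      using dims by linarith
    then show ?thesis
      using norm by (simp add: power_add)
  qed
  finally show "measure lborel (\<Union>p\<in>P. slab R I w p l)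
      \<le> (2 * R) ^ (CARD('a) * CARD('b)) * Y ^ e / R ^ card I * l ^ card I *
        (1 / infnorm w ^ (CARD('a) - n))"
    by (simp add: M_def)
qed

lemma measure_subset_slabs_le:
  fixes I :: "'b::finite set" and P :: "real^'a \<Rightarrow> ('b \<Rightarrow> real) set"
  assumes R: "R > 0" and Y: "Y \<ge> 0"
    and P: "\<And>w. w \<in> int_vecs - {0} \<Longrightarrow> finite (P w)"
      "\<And>w. w \<in> int_vecs - {0} \<Longrightarrow> real (card (P w)) \<le> (Y * infnorm w) ^ e"
    and dims: "CARD('a) + e = card I + n" "1 \<le> n" "e \<le> card I"
  obtains C where "C \<ge> 0"
    "\<And>l X B. l > 0 \<Longrightarrow> X \<ge> 0 \<Longrightarrow> B \<in> sets borel \<Longrightarrow> B \<subseteq> (\<Union>w\<in>int_ball X. \<Union>p\<in>P w. slab R I w p l) \<Longrightarrow>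
      measure lborel B \<le> C * l ^ card I * X ^ n"
proof -
  define K where "K = (2 * R) ^ (CARD('a) * CARD('b)) * Y ^ e / R ^ card I"
  define C where "C = K * (2 * real CARD('a) * 3 ^ (CARD('a) - 1))"
  have K: "K \<ge> 0" using R Y by (simp add: K_def)
  show thesis
  proof (rule that[of C])
    show "C \<ge> 0" using K by (simp add: C_def)
    fix l X :: real and B
    assume l: "l > 0" and X: "X \<ge> 0"
      and B: "B \<in> sets borel" "B \<subseteq> (\<Union>w\<in>int_ball X. \<Union>p\<in>P w. slab R I w p l)"
    have borel: "(\<Union>p\<in>P w. slab R I w p l) \<in> sets borel"
      and meas: "measure lborel (\<Union>p\<in>P w. slab R I w p l)
          \<le> K * l ^ card I * (1 / infnorm w ^ (CARD('a) - n))"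
      if "w \<in> int_ball X" for w
      using that borel_Union_slabs[OF _ R l P dims(1,3)]
        measure_Union_slabs_le[OF _ R l P dims(1,3)]
      by (simp_all add: int_ball_def K_def)
    have "(\<Union>w\<in>int_ball X. \<Union>p\<in>P w. slab R I w p l) \<in> sets borel"
      by (rule sets.finite_UN[OF finite_int_ball borel])
    moreover have "bounded (\<Union>w\<in>int_ball X. \<Union>p\<in>P w. slab R I w p l)"
      by (rule bounded_subset[OF bounded_entry_cube[of R]]) (auto simp: slab_def)
    ultimately have "measure lborel B \<le> measure lborel (\<Union>w\<in>int_ball X. \<Union>p\<in>P w. slab R I w p l)"
      using B by (intro measure_mono_fmeasurable bounded_borel_fmeasurable) auto
    also have "\<dots> \<le> (\<Sum>w\<in>int_ball X. measure lborel (\<Union>p\<in>P w. slab R I w p l))"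
      using finite_int_ball borel by (intro measure_UNION_le) auto
    also have "\<dots> \<le>
        (\<Sum>w\<in>(int_ball X :: (real^'a) set). K * l ^ card I * (1 / infnorm w ^ (CARD('a) - n)))"
      by (intro sum_mono meas)
    also have "\<dots> =
        K * l ^ card I * (\<Sum>w\<in>(int_ball X :: (real^'a) set). 1 / infnorm w ^ (CARD('a) - n))"
      by (rule sum_distrib_left[symmetric])
    also have "\<dots> \<le> K * l ^ card I * (2 * real CARD('a) * 3 ^ (CARD('a) - 1) * X ^ n)"
      using K l dims by (intro mult_left_mono sum_int_ball_inverse_power_le X) auto
    also have "\<dots> = C * l ^ card I * X ^ n"
      by (simp add: C_def)
    finally show "measure lborel B \<le> C * l ^ card I * X ^ n" .
  qed
qed

lemma borel_inadmissible:
  fixes f :: "'a::topological_space \<Rightarrow> real^'k^'k"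
  assumes "continuous_on UNIV f" "V \<in> sets borel"
  shows "{x \<in> V. f x \<notin> admissible norm \<eta>} \<in> sets borel"
proof -
  have "open (f -` (- admissible norm \<eta>))"
    using closed_admissible[of norm \<eta>] assms(1)
    by (intro open_vimage open_Compl) (auto intro: continuous_intros)
  moreover have "{x \<in> V. f x \<notin> admissible norm \<eta>} = V \<inter> f -` (- admissible norm \<eta>)"
    by auto
  ultimately show ?thesis
    using assms(2) by simp
qed

lemma flow_short_components:
  fixes y :: "real^('m::finite + 'n::finite)"
  assumes "s \<ge> 1" "norm (flow s *v y) < \<eta>"
  shows "\<bar>y $ Inl i\<bar> < \<eta> / s powr (real CARD('n) / real CARD('m))" "\<bar>y $ Inr j\<bar> < \<eta> * s"
proof -
  have a: "s powr (real CARD('n) / real CARD('m)) > 0"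
    using assms(1) by simp
  have "\<bar>(flow s *v y) $ Inl i\<bar> < \<eta>" "\<bar>(flow s *v y) $ Inr j\<bar> < \<eta>"
    using assms(2) component_le_norm_cart[of "flow s *v y"] by (meson le_less_trans)+
  then show "\<bar>y $ Inl i\<bar> < \<eta> / s powr (real CARD('n) / real CARD('m))" "\<bar>y $ Inr j\<bar> < \<eta> * s"
    using assms(1) a by (simp_all add: flow_vec abs_mult pos_less_divide_eq field_simps)
qed

lemma flow_scale_power:
  assumes "s > 0"
  shows "(\<eta> / s powr (real CARD('n::finite) / real CARD('m::finite))) ^ CARD('m) *
    (b * \<eta> * s) ^ CARD('n) = b ^ CARD('n) * \<eta> ^ (CARD('m) + CARD('n))"
  using assms by (simp add: power_divide powr_exponent_power power_mult_distrib power_add)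

lemma divide_stretch_le:
  assumes "s \<ge> 1" "\<eta> > 0"
  shows "\<eta> / s powr (real CARD('n::finite) / real CARD('m::finite)) \<le> \<eta>"
proof -
  have "1 \<le> s powr (real CARD('n) / real CARD('m))"
    using assms(1) by (simp add: ge_one_powr_ge_zero)
  then show ?thesis
    using assms(2) by (simp add: divide_le_eq)
qed

lemma flow_short_vector:
  fixes X :: "real^('m::finite + 'n::finite)^('m + 'n)"
  assumes X: "X \<in> entry_cube R" and low: "c > 0" "c * norm z \<le> norm (X *v z)" and s: "s \<ge> 1"
    and \<eta>: "\<eta> > 0"
    and z: "z \<in> int_vecs - {0}" "norm (flow s *v (X *v z)) < \<eta>"
  shows "z \<in> int_ball (real CARD('m + 'n) / c * \<eta> * s)"
    and "X \<in> slab R (range Inl) z (\<lambda>_. 0) (\<eta> / s powr (real CARD('n) / real CARD('m)))"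
proof -
  note short = flow_short_components[OF s z(2)]
  have "\<bar>(X *v z) $ i\<bar> \<le> \<eta> * s" for i
  proof (cases i)
    case (Inl a)
    have "\<eta> \<le> \<eta> * s"
      using s \<eta> by simp
    then show ?thesis
      using Inl short(1)[of a] divide_stretch_le[OF s \<eta>, where 'n = 'n and 'm = 'm] by simp
  next
    case (Inr b)
    then show ?thesis using short(2)[of b] by simp
  qed
  then have "(\<Sum>i\<in>UNIV. \<bar>(X *v z) $ i\<bar>) \<le> real CARD('m + 'n) * (\<eta> * s)"
    by (rule sum_bounded_above)
  then have "c * norm z \<le> real CARD('m + 'n) * (\<eta> * s)"
    using low(2) norm_le_l1_cart[of "X *v z"] by linarith
  moreover have "c * infnorm z \<le> c * norm z"
    using infnorm_le_norm[of z] low(1) by simp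
  ultimately have "c * infnorm z \<le> real CARD('m + 'n) * (\<eta> * s)"
    by (rule order_trans[rotated])
  then have "infnorm z \<le> real CARD('m + 'n) / c * \<eta> * s"
    using low(1) by (simp add: pos_le_divide_eq mult_ac)
  then show "z \<in> int_ball (real CARD('m + 'n) / c * \<eta> * s)"
    using z(1) by (simp add: int_ball_def)
  show "X \<in> slab R (range Inl) z (\<lambda>_. 0) (\<eta> / s powr (real CARD('n) / real CARD('m)))"
    using short(1) X by (auto simp: slab_def matrix_vector_mul_component)
qed

lemma measure_inadmissible_flow_le:
  fixes V :: "(real^('m::finite + 'n::finite)^('m + 'n)) set"
  assumes V: "V \<in> sets borel" "V \<subseteq> entry_cube R" and R: "R > 0"
    and low: "c > 0" "\<And>X x. X \<in> V \<Longrightarrow> c * norm x \<le> norm (X *v x)"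
  obtains C where "C \<ge> 0" "\<And>s \<eta>. s \<ge> 1 \<Longrightarrow> \<eta> > 0 \<Longrightarrow>
    measure lborel {X \<in> V. flow s ** X \<notin> admissible norm \<eta>} \<le> C * \<eta> ^ (CARD('m) + CARD('n))"
proof -
  define d where "d = real CARD('m + 'n)"
  define I where "I = range (Inl :: 'm \<Rightarrow> 'm + 'n)"
  have card_I: "card I = CARD('m)"
    by (simp add: I_def card_image)
  obtain C where C: "C \<ge> 0"
    "\<And>l X B. l > 0 \<Longrightarrow> X \<ge> 0 \<Longrightarrow> B \<in> sets borel \<Longrightarrow>
      B \<subseteq> (\<Union>w\<in>int_ball X. \<Union>p\<in>{\<lambda>_. 0}. slab R I (w :: real^('m + 'n)) p l) \<Longrightarrow>
      measure lborel B \<le> C * l ^ card I * X ^ CARD('n)"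
    using measure_subset_slabs_le[OF R, of 1 "\<lambda>_ :: real^('m + 'n). {\<lambda>_. 0}" 0 I "CARD('n)"]
    by (auto simp: card_I Suc_le_eq)
  show thesis
  proof (rule that[of "C * (d / c) ^ CARD('n)"])
    show "C * (d / c) ^ CARD('n) \<ge> 0"
      using C(1) low(1) by (simp add: d_def)
    fix s \<eta> :: real
    assume s: "s \<ge> 1" and \<eta>: "\<eta> > 0"
    define B where "B = {X \<in> V. flow s ** X \<notin> admissible norm \<eta>}"
    define l where "l = \<eta> / s powr (real CARD('n) / real CARD('m))"
    have "B \<subseteq> (\<Union>w\<in>int_ball (d / c * \<eta> * s). \<Union>p\<in>{\<lambda>_. 0}. slab R I w p l)"
    proof
      fix X assume "X \<in> B"
      then obtain z where X: "X \<in> V" and z: "z \<in> int_vecs - {0}" "norm (flow s *v (X *v z)) < \<eta>"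
        by (auto simp: B_def admissible_def not_le matrix_vector_mul_assoc)
      show "X \<in> (\<Union>w\<in>int_ball (d / c * \<eta> * s). \<Union>p\<in>{\<lambda>_. 0}. slab R I w p l)"
        using flow_short_vector[OF _ low(1) low(2)[OF X] s \<eta> z] X V(2) unfolding d_def I_def l_def
        by blast
    qed
    moreover have "B \<in> sets borel"
      unfolding B_def by (intro borel_inadmissible continuous_intros V(1))
    ultimately have "measure lborel B \<le> C * l ^ card I * (d / c * \<eta> * s) ^ CARD('n)"
      using s \<eta> low(1) by (intro C(2)) (auto simp: l_def d_def)
    then show "measure lborel {X \<in> V. flow s ** X \<notin> admissible norm \<eta>}
        \<le> C * (d / c) ^ CARD('n) * \<eta> ^ (CARD('m) + CARD('n))"
      using flow_scale_power[of s \<eta> "d / c", where 'm = 'm and 'n = 'n] s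
      by (simp add: B_def card_I l_def mult.assoc)
  qed
qed

lemma abs_inner_le_infnorm: "\<bar>x \<bullet> y\<bar> \<le> real CARD('a) * (infnorm x * infnorm y)" for x y :: "real^'a"
proof -
  have "\<bar>x \<bullet> y\<bar> \<le> (\<Sum>i\<in>UNIV. \<bar>x $ i\<bar> * \<bar>y $ i\<bar>)"
    unfolding inner_vec_def by (rule order_trans[OF sum_abs]) (simp add: abs_mult)
  also have "\<dots> \<le> real CARD('a) * (infnorm x * infnorm y)"
    by (intro sum_bounded_above mult_mono) (auto simp: component_le_infnorm_cart infnorm_pos_le)
  finally show ?thesis .
qed

lemma infnorm_entry_cube_row:
  assumes "A \<in> entry_cube R"
  shows "infnorm (A $ i) \<le> R"
proof -
  obtain j where "infnorm (A $ i) = \<bar>A $ i $ j\<bar>"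
    by (rule infnorm_attained)
  then show ?thesis
    using assms by (simp add: entry_cube_def)
qed

lemma int_vecs_lower_block_nonzero:
  fixes z :: "real^('m::finite + 'n::finite)"
  assumes z: "z \<in> int_vecs - {0}" and upper: "\<And>i. \<bar>z $ Inl i\<bar> < 1"
  shows "(\<chi> b. z $ Inr b) \<noteq> 0"
proof
  assume lower: "(\<chi> b. z $ Inr b) = 0"
  have "z $ Inl i = 0" for i
    using upper[of i] z Ints_nonzero_abs_ge1[of "z $ Inl i"] by (force simp: int_vecs_def)
  moreover have "z $ Inr j = 0" for j
    using arg_cong[OF lower, of "\<lambda>v. v $ j"] by simp
  ultimately show False
    using z vec_sum_eqI[of z 0] by simp
qed

lemma flow_uni_short_vector:
  fixes A :: "real^'n^'m" and z :: "real^('m + 'n)"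
  defines "q \<equiv> \<chi> b. z $ Inr b"
  assumes A: "A \<in> entry_cube R" and R: "R > 0" and s: "s \<ge> 1" and \<eta>: "0 < \<eta>" "\<eta> < 1"
    and z: "z \<in> int_vecs - {0}" "norm (flow s *v (uni A *v z)) < \<eta>"
  shows "q \<in> int_ball (\<eta> * s)"
    and "\<bar>A $ i \<bullet> q + z $ Inl i\<bar> < \<eta> / s powr (real CARD('n) / real CARD('m))"
    and "\<bar>z $ Inl i\<bar> \<le> (real CARD('n) * R + 1) * infnorm q"
proof -
  define l where "l = \<eta> / s powr (real CARD('n) / real CARD('m))"
  have l_less_1: "l < 1"
    unfolding l_def using divide_stretch_le[OF s \<eta>(1)] \<eta>(2) by (rule le_less_trans)
  have upper: "\<bar>A $ i \<bullet> q + z $ Inl i\<bar> < l" for i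
    using flow_short_components(1)[OF s z(2)]
    by (simp add: uni_vec l_def q_def inner_vec_def add.commute)
  then show "\<bar>A $ i \<bullet> q + z $ Inl i\<bar> < \<eta> / s powr (real CARD('n) / real CARD('m))"
    by (simp add: l_def)
  have lower: "\<bar>q $ j\<bar> < \<eta> * s" for j
    using flow_short_components(2)[OF s z(2)] by (simp add: uni_vec q_def)
  have z_int: "z $ i \<in> \<int>" for i
    using z(1) by (simp add: int_vecs_def)
  have "q \<noteq> 0"
  proof
    assume "q = 0"
    then have "\<bar>z $ Inl i\<bar> < 1" for i
      using upper[of i] l_less_1 by simp
    then show False
      using int_vecs_lower_block_nonzero[OF z(1)] \<open>q = 0\<close> unfolding q_def by blast
  qed
  moreover have "q \<in> int_vecs"
    using z_int by (simp add: q_def int_vecs_def)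
  moreover obtain j where "infnorm q = \<bar>q $ j\<bar>"
    by (rule infnorm_attained)
  ultimately show q: "q \<in> int_ball (\<eta> * s)"
    using lower[of j] by (simp add: int_ball_def)
  have "\<bar>A $ i \<bullet> q\<bar> \<le> real CARD('n) * (R * infnorm q)"
    by (intro order_trans[OF abs_inner_le_infnorm] mult_left_mono mult_right_mono
      infnorm_entry_cube_row A) (auto simp: infnorm_pos_le)
  then have "\<bar>z $ Inl i\<bar> \<le> real CARD('n) * (R * infnorm q) + 1"
    using upper[of i] l_less_1 by linarith
  also have "\<dots> \<le> (real CARD('n) * R + 1) * infnorm q"
    using int_vecs_infnorm_ge_1[of q] q by (simp add: int_ball_def algebra_simps)
  finally show "\<bar>z $ Inl i\<bar> \<le> (real CARD('n) * R + 1) * infnorm q" .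
qed

lemma
  fixes w :: "real^'n"
  assumes w: "w \<in> int_vecs - {0}" and y: "y \<ge> 0"
  defines "P \<equiv> \<Pi>\<^sub>E i\<in>(UNIV :: 'm::finite set). {x \<in> \<int>. \<bar>x\<bar> \<le> y * infnorm w}"
  shows finite_PiE_Ints_le: "finite P"
    and card_PiE_Ints_le: "real (card P) \<le> ((2 * y + 1) * infnorm w) ^ CARD('m)"
proof -
  have bound_nonneg: "y * infnorm w \<ge> 0"
    using y by (simp add: infnorm_pos_le)
  show "finite P"
    unfolding P_def by (intro finite_PiE finite_Ints_abs_le bound_nonneg) simp
  have "real (card {x \<in> \<int>. \<bar>x\<bar> \<le> y * infnorm w}) \<le> 2 * (y * infnorm w) + 1"
    by (rule card_Ints_abs_le[OF bound_nonneg])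
  also have "\<dots> \<le> (2 * y + 1) * infnorm w"
    using int_vecs_infnorm_ge_1[OF w] by (simp add: algebra_simps)
  finally show "real (card P) \<le> ((2 * y + 1) * infnorm w) ^ CARD('m)"
    by (simp add: P_def card_PiE power_mono)
qed

lemma inadmissible_flow_uni_subset_slabs:
  fixes R :: real
  assumes R: "R > 0" and s: "s \<ge> 1" and \<eta>: "0 < \<eta>" "\<eta> < 1"
  shows "{A \<in> entry_cube R :: (real^'n^'m) set. flow s ** uni A \<notin> admissible norm \<eta>} \<subseteq>
    (\<Union>w\<in>int_ball (\<eta> * s). \<Union>p\<in>(\<Pi>\<^sub>E i\<in>UNIV. {x \<in> \<int>. \<bar>x\<bar> \<le> (real CARD('n) * R + 1) * infnorm w}).
      slab R UNIV w p (\<eta> / s powr (real CARD('n) / real CARD('m))))"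
proof
  fix A assume "A \<in> {A \<in> entry_cube R :: (real^'n^'m) set. flow s ** uni A \<notin> admissible norm \<eta>}"
  then obtain z where A: "A \<in> entry_cube R"
    and z: "z \<in> int_vecs - {0}" "norm (flow s *v (uni A *v z)) < \<eta>"
    by (auto simp: admissible_def not_le matrix_vector_mul_assoc)
  note short = flow_uni_short_vector[OF A R s \<eta> z]
  have "A \<in> slab R UNIV (\<chi> b. z $ Inr b)
      (\<lambda>i. - z $ Inl i) (\<eta> / s powr (real CARD('n) / real CARD('m)))"
    using A short(2) by (simp add: slab_def)
  moreover have "(\<lambda>i. - z $ Inl i) \<in>
      (\<Pi>\<^sub>E i\<in>UNIV. {x \<in> \<int>. \<bar>x\<bar> \<le> (real CARD('n) * R + 1) * infnorm (\<chi> b. z $ Inr b :: real^'n)})"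
    using short(3) z(1) by (simp add: PiE_iff int_vecs_def)
  ultimately show "A \<in> (\<Union>w\<in>int_ball (\<eta> * s).
      \<Union>p\<in>(\<Pi>\<^sub>E i\<in>UNIV. {x \<in> \<int>. \<bar>x\<bar> \<le> (real CARD('n) * R + 1) * infnorm w}).
      slab R UNIV w p (\<eta> / s powr (real CARD('n) / real CARD('m))))"
    using short(1) by blast
qed

lemma measure_inadmissible_flow_uni_le:
  fixes R :: real
  assumes R: "R > 0"
  obtains C where "C \<ge> 0" "\<And>s \<eta>. s \<ge> 1 \<Longrightarrow> 0 < \<eta> \<Longrightarrow> \<eta> < 1 \<Longrightarrow>
    measure lborel {A \<in> entry_cube R :: (real^'n^'m) set. flow s ** uni A \<notin> admissible norm \<eta>}
      \<le> C * \<eta> ^ (CARD('m) + CARD('n))"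
proof -
  define y where "y = real CARD('n) * R + 1"
  have y: "y \<ge> 0" using R by (simp add: y_def)
  define P :: "real^'n \<Rightarrow> ('m \<Rightarrow> real) set" where "P = (\<lambda>w. \<Pi>\<^sub>E i\<in>UNIV. {x \<in> \<int>. \<bar>x\<bar> \<le> y * infnorm w})"
  obtain C where C: "C \<ge> 0"
    "\<And>l X B. l > 0 \<Longrightarrow> X \<ge> 0 \<Longrightarrow> B \<in> sets borel \<Longrightarrow> B \<subseteq> (\<Union>w\<in>int_ball X. \<Union>p\<in>P w. slab R UNIV w p l) \<Longrightarrow>
      measure lborel B \<le> C * l ^ CARD('m) * X ^ CARD('n)"
    using measure_subset_slabs_le[OF R, of "2 * y + 1" P "CARD('m)" UNIV "CARD('n)"]
      finite_PiE_Ints_le[OF _ y] card_PiE_Ints_le[OF _ y] y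
    by (auto simp: P_def Suc_le_eq)
  show thesis
  proof (rule that[OF C(1)])
    fix s \<eta> :: real assume s: "s \<ge> 1" and \<eta>: "0 < \<eta>" "\<eta> < 1"
    define B where "B = {A \<in> entry_cube R :: (real^'n^'m) set. flow s ** uni A \<notin> admissible norm \<eta>}"
    define l where "l = \<eta> / s powr (real CARD('n) / real CARD('m))"
    have "B \<subseteq> (\<Union>w\<in>int_ball (\<eta> * s). \<Union>p\<in>P w. slab R UNIV w p l)"
      unfolding B_def P_def l_def y_def by (rule inadmissible_flow_uni_subset_slabs[OF R s \<eta>])
    moreover have "B \<in> sets borel"
      unfolding B_def by (intro borel_inadmissible continuous_intros borel_entry_cube)
    ultimately have "measure lborel B \<le> C * l ^ CARD('m) * (\<eta> * s) ^ CARD('n)"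
      using s \<eta> by (intro C(2)) (auto simp: l_def)
    then show "measure lborel
        {A \<in> entry_cube R :: (real^'n^'m) set. flow s ** uni A \<notin> admissible norm \<eta>}
      \<le> C * \<eta> ^ (CARD('m) + CARD('n))"
      using flow_scale_power[of s \<eta> 1, where 'm = 'm and 'n = 'n] s
      by (simp add: B_def l_def mult.assoc)
  qed
qed

lemma exists_small_power:
  fixes C e :: real
  assumes "C \<ge> 0" "e > 0" "p \<ge> 1"
  obtains \<eta> where "0 < \<eta>" "\<eta> < 1" "C * \<eta> ^ p \<le> e"
proof -
  define \<eta> where "\<eta> = min (1 / 2) (e / (C + 1))"
  have \<eta>: "0 < \<eta>" "\<eta> < 1" "\<eta> \<le> e / (C + 1)"
    using assms by (auto simp: \<eta>_def)
  have "C * \<eta> ^ p \<le> (C + 1) * \<eta> ^ 1"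
    using \<eta> assms by (intro mult_mono power_decreasing) auto
  also have "\<dots> \<le> e"
    using \<eta>(3) assms(1) by (simp add: field_simps)
  finally show thesis using that \<eta> by blast
qed

section \<open>Almost every orbit is nondivergent\<close>

lemma
  fixes B :: "nat \<Rightarrow> 'a::euclidean_space set"
  assumes B: "\<And>k. B k \<in> lmeasurable" "\<And>k. measure lebesgue (B k) \<le> e"
  shows lmeasurable_eventually: "{x. \<forall>\<^sub>F k in sequentially. x \<in> B k} \<in> lmeasurable"
    and measure_eventually_le: "measure lebesgue {x. \<forall>\<^sub>F k in sequentially. x \<in> B k} \<le> e"
proof -
  define D where "D = (\<lambda>N. \<Inter>k\<in>{N..}. B k)"
  have D_subset: "D N \<subseteq> B N" and nest: "D N \<subseteq> D (Suc N)" for N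
    by (auto simp: D_def)
  have "D N \<in> sets lebesgue" for N
    unfolding D_def using B(1) by (intro sets.countable_INT') (auto simp: fmeasurableD)
  then have D: "D N \<in> lmeasurable" "measure lebesgue (D N) \<le> e" for N
    using fmeasurableI2[OF B(1) D_subset] measure_mono_fmeasurable[OF D_subset _ B(1)] B(2) order_trans
    by blast+
  have "{x. \<forall>\<^sub>F k in sequentially. x \<in> B k} = (\<Union>N. D N)"
    by (auto simp: D_def eventually_sequentially)
  then show "{x. \<forall>\<^sub>F k in sequentially. x \<in> B k} \<in> lmeasurable"
    "measure lebesgue {x. \<forall>\<^sub>F k in sequentially. x \<in> B k} \<le> e"
    using measurable_nested_Union[where S = D, OF D nest]
      measure_nested_Union[where S = D, OF D nest] D(2)
    by (auto intro: LIMSEQ_le_const2)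
qed

definition divergent :: "(real^'n^'m) set" where
  "divergent = {A. \<forall>\<eta>>0. \<forall>\<^sub>F k in sequentially. flow (real k) ** uni A \<notin> admissible norm \<eta>}"

lemma negligible_divergent_Int_cube:
  assumes R: "R > 0"
  shows "negligible (divergent \<inter> entry_cube R :: (real^'n^'m) set)"
  unfolding negligible_outer_le
proof (intro allI impI)
  fix e :: real assume e: "e > 0"
  obtain C where C: "C \<ge> 0" "\<And>s \<eta>. s \<ge> 1 \<Longrightarrow> 0 < \<eta> \<Longrightarrow> \<eta> < 1 \<Longrightarrow>
    measure lborel {A \<in> entry_cube R :: (real^'n^'m) set. flow s ** uni A \<notin> admissible norm \<eta>}
      \<le> C * \<eta> ^ (CARD('m) + CARD('n))"
    using measure_inadmissible_flow_uni_le[OF R] by blast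
  obtain \<eta> where \<eta>: "0 < \<eta>" "\<eta> < 1" "C * \<eta> ^ (CARD('m) + CARD('n)) \<le> e"
    using exists_small_power[OF C(1) e, of "CARD('m) + CARD('n)"] by (auto simp: Suc_le_eq)
  define B where "B = (\<lambda>k. {A \<in> entry_cube R :: (real^'n^'m) set.
      flow (real (Suc k)) ** uni A \<notin> admissible norm \<eta>})"
  have borel: "B k \<in> sets borel" for k
    unfolding B_def by (intro borel_inadmissible continuous_intros borel_entry_cube)
  have measurable: "B k \<in> lmeasurable" for k
    using borel[of k] bounded_subset[OF bounded_entry_cube, of "B k" R]
    by (intro bounded_set_imp_lmeasurable) (auto simp: B_def)
  have meas: "measure lebesgue (B k) \<le> e" for k
    using C(2)[of "real (Suc k)" \<eta>] \<eta> borel[of k] by (simp add: B_def measure_completion)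
  have "divergent \<inter> entry_cube R \<subseteq> {A. \<forall>\<^sub>F k in sequentially. A \<in> B k}"
  proof
    fix A :: "real^'n^'m"
    assume A: "A \<in> divergent \<inter> entry_cube R"
    then have "\<forall>\<^sub>F k in sequentially. flow (real k) ** uni A \<notin> admissible norm \<eta>"
      using \<eta>(1) by (simp add: divergent_def)
    then have "\<forall>\<^sub>F k in sequentially. flow (real (Suc k)) ** uni A \<notin> admissible norm \<eta>"
      by (subst eventually_sequentially_Suc)
    then show "A \<in> {A. \<forall>\<^sub>F k in sequentially. A \<in> B k}"
      using A by (simp add: B_def)
  qed
  with lmeasurable_eventually[of B, OF measurable meas] measure_eventually_le[of B, OF measurable meas]
  show "\<exists>T. (divergent \<inter> entry_cube R :: (real^'n^'m) set) \<subseteq> T \<and>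
      T \<in> lmeasurable \<and> measure lebesgue T \<le> e"
    by blast
qed

theorem negligible_divergent: "negligible (divergent :: (real^'n^'m) set)"
proof -
  have "\<exists>N. A \<in> entry_cube (real (Suc N))" for A :: "real^'n^'m"
  proof -
    obtain N where "norm A \<le> real N"
      using real_arch_simple by blast
    then have "\<bar>A $ i $ j\<bar> \<le> real (Suc N)" for i j
      using abs_matrix_nth_le_norm[of A i j] by simp
    then show ?thesis
      by (auto simp: entry_cube_def)
  qed
  then have "divergent = (\<Union>N. divergent \<inter> entry_cube (real (Suc N)) :: (real^'n^'m) set)"
    by blast
  also have "negligible \<dots>"
    by (intro negligible_countable_Union countable_image)
      (auto intro!: negligible_divergent_Int_cube)
  finally show ?thesis .
qed

section \<open>The diagonal flow is nonwandering\<close>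

lemma emeasure_UN_countable_le:
  assumes A [measurable]: "\<And>i. i \<in> I \<Longrightarrow> A i \<in> sets M" and I: "countable I"
  shows "emeasure M (\<Union>i\<in>I. A i) \<le> (\<integral>\<^sup>+i. emeasure M (A i) \<partial>count_space I)"
proof -
  have Union_sets: "(\<Union>i\<in>I. A i) \<in> sets M"
    using A I by (intro sets.countable_UN') auto
  have indicator_le: "indicator (\<Union>i\<in>I. A i) x \<le> (\<integral>\<^sup>+i. indicator (A i) x \<partial>count_space I)" for x
  proof (cases "x \<in> (\<Union>i\<in>I. A i)")
    case True
    then obtain j where j: "j \<in> I" "x \<in> A j" by blast
    have "1 = (\<integral>\<^sup>+i. indicator {j} i \<partial>count_space I)"
      using j(1) by simp
    also have "\<dots> \<le> (\<integral>\<^sup>+i. indicator (A i) x \<partial>count_space I)"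
      using j by (intro nn_integral_mono) (auto simp: indicator_def)
    finally show ?thesis using True by simp
  qed simp
  have "emeasure M (\<Union>i\<in>I. A i) = (\<integral>\<^sup>+x. indicator (\<Union>i\<in>I. A i) x \<partial>M)"
    using Union_sets by simp
  also have "\<dots> \<le> (\<integral>\<^sup>+x. \<integral>\<^sup>+i. indicator (A i) x \<partial>count_space I \<partial>M)"
    by (intro nn_integral_mono indicator_le)
  also have "\<dots> = (\<integral>\<^sup>+i. \<integral>\<^sup>+x. indicator (A i) x \<partial>M \<partial>count_space I)"
    using I A by (intro nn_integral_count_space_nn_integral) auto
  also have "\<dots> = (\<integral>\<^sup>+i. emeasure M (A i) \<partial>count_space I)"
    using A by (intro nn_integral_cong) auto
  finally show ?thesis .
qed

lemma emeasure_disjoint_sequence_contradiction: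
  fixes W :: "nat \<Rightarrow> 'a set"
  assumes W: "\<And>k. W k \<in> sets M" "\<And>k. W k \<subseteq> K" "disjoint_family W"
    and K: "K \<in> fmeasurable M" and \<epsilon>: "\<epsilon> > 0" "\<And>k. ennreal \<epsilon> \<le> emeasure M (W k)"
  shows False
proof -
  have bound: "real N * \<epsilon> \<le> measure M K" for N
  proof -
    have "ennreal (real N * \<epsilon>) = (\<Sum>k<N. ennreal \<epsilon>)"
      using \<epsilon>(1) by (simp add: ennreal_mult ennreal_of_nat_eq_real_of_nat)
    also have "\<dots> \<le> (\<Sum>k<N. emeasure M (W k))"
      by (intro sum_mono \<epsilon>(2))
    also have "\<dots> = emeasure M (\<Union>k<N. W k)"
      using W(1,3) by (intro sum_emeasure) (auto simp: disjoint_family_on_def)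
    also have "\<dots> \<le> emeasure M K"
      using W(2) K by (intro emeasure_mono) (auto simp: fmeasurableD)
    also have "\<dots> = ennreal (measure M K)"
      by (rule emeasure_eq_measure2[OF K])
    finally show ?thesis by simp
  qed
  obtain N where "measure M K / \<epsilon> < real N"
    using reals_Archimedean2 by blast
  then show False
    using bound[of N] \<epsilon>(1) by (simp add: field_simps)
qed

lemma emeasure_UN_le_disjoint_images:
  assumes I: "countable I" and A: "\<And>i. i \<in> I \<Longrightarrow> A i \<in> sets M" "\<And>i. i \<in> I \<Longrightarrow> g i ` A i \<in> sets M"
    and preserving: "\<And>i. i \<in> I \<Longrightarrow> emeasure M (g i ` A i) = emeasure M (A i)"
    and disjoint: "disjoint_family_on (\<lambda>i. g i ` A i) I"
  shows "emeasure M (\<Union>i\<in>I. A i) \<le> emeasure M (\<Union>i\<in>I. g i ` A i)"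
proof -
  have "emeasure M (\<Union>i\<in>I. A i) \<le> (\<integral>\<^sup>+i. emeasure M (A i) \<partial>count_space I)"
    using A(1) I by (rule emeasure_UN_countable_le)
  also have "\<dots> = (\<integral>\<^sup>+i. emeasure M (g i ` A i) \<partial>count_space I)"
    by (intro nn_integral_cong) (simp add: preserving)
  also have "\<dots> = emeasure M (\<Union>i\<in>I. g i ` A i)"
    using A(2) I disjoint by (rule emeasure_UN_countable[symmetric])
  finally show ?thesis .
qed

text \<open>Poincare recurrence for the action of a countable group, without a fundamental domain: were
  all the images of \<open>V\<close> disjoint, each iterate would place a fixed amount of volume in \<open>K\<close>.\<close>

theorem measure_preserving_family_recurrence:
  fixes f :: "nat \<Rightarrow> 'i \<Rightarrow> 'a \<Rightarrow> 'a"
  assumes \<Gamma>: "countable \<Gamma>" and K: "K \<in> fmeasurable M" and \<epsilon>: "\<epsilon> > 0"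
    and vimage: "\<And>k \<gamma>. \<gamma> \<in> \<Gamma> \<Longrightarrow> V \<inter> f k \<gamma> -` K \<in> sets M"
    and image: "\<And>k \<gamma> A. \<gamma> \<in> \<Gamma> \<Longrightarrow> A \<in> sets M \<Longrightarrow> f k \<gamma> ` A \<in> sets M"
    and preserving: "\<And>k \<gamma> A. \<gamma> \<in> \<Gamma> \<Longrightarrow> A \<in> sets M \<Longrightarrow> emeasure M (f k \<gamma> ` A) = emeasure M A"
    and return: "\<And>k. ennreal \<epsilon> \<le> emeasure M (\<Union>\<gamma>\<in>\<Gamma>. V \<inter> f k \<gamma> -` K)"
  obtains k \<gamma> k' \<gamma>' X X' where "\<gamma> \<in> \<Gamma>" "\<gamma>' \<in> \<Gamma>" "(k, \<gamma>) \<noteq> (k', \<gamma>')" "k' \<le> k"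
    "X \<in> V" "X' \<in> V" "f k \<gamma> X = f k' \<gamma>' X'"
proof -
  have "\<exists>k \<gamma> k' \<gamma>'. \<gamma> \<in> \<Gamma> \<and> \<gamma>' \<in> \<Gamma> \<and> (k, \<gamma>) \<noteq> (k', \<gamma>') \<and> f k \<gamma> ` V \<inter> f k' \<gamma>' ` V \<noteq> {}"
  proof (rule ccontr)
    assume no_overlap: "\<not> ?thesis"
    define A where "A = (\<lambda>k \<gamma>. V \<inter> f k \<gamma> -` K)"
    define W where "W = (\<lambda>k. \<Union>\<gamma>\<in>\<Gamma>. f k \<gamma> ` A k \<gamma>)"
    have sets: "A k \<gamma> \<in> sets M" "f k \<gamma> ` A k \<gamma> \<in> sets M" if "\<gamma> \<in> \<Gamma>" for k \<gamma>
      using vimage image that by (auto simp: A_def)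
    have disjoint: "f k \<gamma> ` A k \<gamma> \<inter> f k' \<gamma>' ` A k' \<gamma>' = {}"
      if "\<gamma> \<in> \<Gamma>" "\<gamma>' \<in> \<Gamma>" "(k, \<gamma>) \<noteq> (k', \<gamma>')" for k \<gamma> k' \<gamma>'
    proof -
      have "f k \<gamma> ` V \<inter> f k' \<gamma>' ` V = {}"
        using no_overlap that by blast
      then show ?thesis by (auto simp: A_def)
    qed
    have "emeasure M (\<Union>\<gamma>\<in>\<Gamma>. A k \<gamma>) \<le> emeasure M (W k)" for k
      unfolding W_def using \<Gamma> sets disjoint
      by (intro emeasure_UN_le_disjoint_images) (auto simp: preserving disjoint_family_on_def)
    then have "ennreal \<epsilon> \<le> emeasure M (W k)" for k
      using return[of k] order_trans unfolding A_def by blast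
    moreover have "W k \<in> sets M" for k
      unfolding W_def using sets(2) \<Gamma> by (intro sets.countable_UN') auto
    moreover have "disjoint_family W"
      unfolding disjoint_family_on_def W_def using disjoint by blast
    moreover have "W k \<subseteq> K" for k
      by (auto simp: W_def A_def)
    ultimately show False
      using emeasure_disjoint_sequence_contradiction[OF _ _ _ K \<epsilon>] by blast
  qed
  then obtain k \<gamma> k' \<gamma>' X X'
    where overlap: "\<gamma> \<in> \<Gamma>" "\<gamma>' \<in> \<Gamma>" "(k, \<gamma>) \<noteq> (k', \<gamma>')" "X \<in> V" "X' \<in> V" "f k \<gamma> X = f k' \<gamma>' X'"
    by blast
  then show thesis
    using that[of \<gamma> \<gamma>' k k' X X'] that[of \<gamma>' \<gamma> k' k X' X] by (cases "k' \<le> k") auto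
qed

definition GLZ_saturation :: "(real^'k^'k) set \<Rightarrow> (real^'k^'k) set" where
  "GLZ_saturation U = {M. \<exists>\<gamma> \<in> GLZ. M ** \<gamma> \<in> U}"

lemma mult_GLZ_in_GLZ_saturation_iff:
  assumes "\<gamma> \<in> GLZ"
  shows "M ** \<gamma> \<in> GLZ_saturation U \<longleftrightarrow> M \<in> GLZ_saturation U"
proof
  assume "M ** \<gamma> \<in> GLZ_saturation U"
  then show "M \<in> GLZ_saturation U"
    using GLZ_mult[OF assms] by (auto simp: GLZ_saturation_def simp flip: matrix_mul_assoc)
next
  assume "M \<in> GLZ_saturation U"
  then obtain \<beta> where \<beta>: "\<beta> \<in> GLZ" "M ** \<beta> \<in> U"
    by (auto simp: GLZ_saturation_def)
  have "M ** \<gamma> ** (matrix_inv \<gamma> ** \<beta>) \<in> U"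
    using \<beta>(2)
    by (simp add: matrix_mul_assoc matrix_mult_matrix_inv_cancel GLZ_det_nonzero[OF assms])
  then show "M ** \<gamma> \<in> GLZ_saturation U"
    using GLZ_mult[OF GLZ_matrix_inv[OF assms] \<beta>(1)] by (auto simp: GLZ_saturation_def)
qed

lemma open_GLZ_saturation:
  assumes "open U"
  shows "open (GLZ_saturation U)"
proof -
  have "GLZ_saturation U = (\<Union>\<gamma>\<in>GLZ. (\<lambda>M. M ** \<gamma>) -` U)"
    by (auto simp: GLZ_saturation_def)
  then show ?thesis
    using assms by (auto intro!: open_UN open_vimage continuous_intros)
qed

lemma half_measure_flow_admissible:
  fixes V :: "(real^('m::finite + 'n::finite)^('m + 'n)) set"
  assumes V: "V \<in> sets borel" "V \<subseteq> entry_cube R" and R: "R > 0" and vol: "measure lborel V > 0"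
    and low: "c > 0" "\<And>X x. X \<in> V \<Longrightarrow> c * norm x \<le> norm (X *v x)"
  obtains \<eta> where "\<eta> > 0" "\<And>s. s \<ge> 1 \<Longrightarrow>
    ennreal (measure lborel V / 2) \<le> emeasure lborel {X \<in> V. flow s ** X \<in> admissible norm \<eta>}"
proof -
  define \<mu> where "\<mu> = measure lborel V"
  obtain C where C: "C \<ge> 0" "\<And>s \<eta>. s \<ge> 1 \<Longrightarrow> \<eta> > 0 \<Longrightarrow>
      measure lborel {X \<in> V. flow s ** X \<notin> admissible norm \<eta>} \<le> C * \<eta> ^ (CARD('m) + CARD('n))"
    using measure_inadmissible_flow_le[OF V R low] by blast
  obtain \<eta> where \<eta>: "0 < \<eta>" "C * \<eta> ^ (CARD('m) + CARD('n)) \<le> \<mu> / 2"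
    using exists_small_power[OF C(1), of "\<mu> / 2" "CARD('m) + CARD('n)"] vol
    by (auto simp: \<mu>_def Suc_le_eq)
  have fmeasurable_V: "V \<in> fmeasurable lborel"
    using V bounded_subset[OF bounded_entry_cube] by (intro bounded_borel_fmeasurable)
  have "ennreal (\<mu> / 2) \<le> emeasure lborel {X \<in> V. flow s ** X \<in> admissible norm \<eta>}"
      if s: "s \<ge> 1" for s
  proof -
    define B where "B = {X \<in> V. flow s ** X \<notin> admissible norm \<eta>}"
    have B: "B \<in> sets borel"
      unfolding B_def by (intro borel_inadmissible continuous_intros V(1))
    have "measure lborel (V - B) = \<mu> - measure lborel B"
      using fmeasurable_V B fmeasurableI2[OF fmeasurable_V, of B] unfolding \<mu>_def
      by (subst measure_Diff) (auto simp: B_def fmeasurableD2)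
    then have "\<mu> / 2 \<le> measure lborel (V - B)"
      using C(2)[OF s \<eta>(1)] \<eta>(2) unfolding B_def by linarith
    then have "ennreal (\<mu> / 2) \<le> emeasure lborel (V - B)"
      using fmeasurableI2[OF fmeasurable_V, of "V - B"] V(1) B
      by (subst emeasure_eq_measure2) (auto intro: ennreal_leI)
    also have "V - B = {X \<in> V. flow s ** X \<in> admissible norm \<eta>}"
      by (auto simp: B_def)
    finally show ?thesis .
  qed
  then show thesis
    using that \<eta>(1) unfolding \<mu>_def by blast
qed

lemma flow_returns_to_compact:
  fixes V :: "(real^('m::finite + 'n::finite)^('m + 'n)) set"
  assumes V: "V \<in> sets borel" "V \<subseteq> entry_cube R" and R: "R > 0" and vol: "measure lborel V > 0"
    and low: "c > 0" "\<And>X x. X \<in> V \<Longrightarrow> c * norm x \<le> norm (X *v x)"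
  obtains r where "\<And>s. s \<ge> 1 \<Longrightarrow>
    ennreal (measure lborel V / 2) \<le>
      emeasure lborel (\<Union>\<gamma>\<in>GLZ. V \<inter> (\<lambda>X. flow s ** X ** \<gamma>) -` cball 0 r)"
proof -
  obtain \<eta> where \<eta>: "\<eta> > 0" "\<And>s. s \<ge> 1 \<Longrightarrow>
      ennreal (measure lborel V / 2) \<le> emeasure lborel {X \<in> V. flow s ** X \<in> admissible norm \<eta>}"
    using half_measure_flow_admissible[OF assms] by blast
  obtain b where b: "\<And>X :: real^('m + 'n)^('m + 'n). X \<in> entry_cube R \<Longrightarrow> \<bar>det X\<bar> \<le> b"
    by (rule det_entry_cube_bounded) blast
  obtain r where r: "\<And>M :: real^('m + 'n)^('m + 'n). det M \<noteq> 0 \<Longrightarrow> \<bar>det M\<bar> \<le> b \<Longrightarrow>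
      M \<in> admissible norm \<eta> \<Longrightarrow>
      \<exists>\<gamma> \<in> GLZ. norm (M ** \<gamma>) \<le> r"
    using admissible_bounded_representative[OF \<eta>(1)] by blast
  have "ennreal (measure lborel V / 2) \<le>
      emeasure lborel (\<Union>\<gamma>\<in>GLZ. V \<inter> (\<lambda>X. flow s ** X ** \<gamma>) -` cball 0 r)"
    if s: "s \<ge> 1" for s
  proof (rule order_trans[OF \<eta>(2)[OF s] emeasure_mono])
    show "{X \<in> V. flow s ** X \<in> admissible norm \<eta>}
        \<subseteq> (\<Union>\<gamma>\<in>GLZ. V \<inter> (\<lambda>X. flow s ** X ** \<gamma>) -` cball 0 r)"
    proof
      fix X assume X: "X \<in> {X \<in> V. flow s ** X \<in> admissible norm \<eta>}"
      have "det X \<noteq> 0"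
        using low X by (intro det_nonzero_if_bounded_below[of c X]) auto
      then have "\<exists>\<gamma> \<in> GLZ. norm (flow s ** X ** \<gamma>) \<le> r"
        using X b V(2) s by (intro r) (auto simp: det_mul det_flow)
      then show "X \<in> (\<Union>\<gamma>\<in>GLZ. V \<inter> (\<lambda>X. flow s ** X ** \<gamma>) -` cball 0 r)"
        using X by auto
    qed
    show "(\<Union>\<gamma>\<in>GLZ. V \<inter> (\<lambda>X. flow s ** X ** \<gamma>) -` cball 0 r) \<in> sets lborel"
      using V(1) measurable_sets[OF borel_measurable_linear[OF linear_matrix_conj], of "cball 0 r"]
      by (intro sets.countable_UN' countable_GLZ) auto
  qed
  then show thesis by (rule that)
qed

lemma exists_uniformly_invertible_ball:
  fixes h :: "real^'k^'k"
  assumes "det h \<noteq> 0" "h \<in> U" "open U"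
  obtains \<delta> c R where "\<delta> > 0" "c > 0" "R > 0" "ball h \<delta> \<subseteq> U" "ball h \<delta> \<subseteq> entry_cube R"
    "\<And>X x. X \<in> ball h \<delta> \<Longrightarrow> c * norm x \<le> norm (X *v x)"
    "\<And>X Y. X \<in> ball h \<delta> \<Longrightarrow> Y \<in> ball h \<delta> \<Longrightarrow> norm (Y - X) < c"
proof -
  obtain c where c: "c > 0" "\<And>x. c * norm x \<le> norm (h *v x)"
    using matrix_bounded_below[OF assms(1)] by blast
  obtain \<rho> where \<rho>: "\<rho> > 0" "ball h \<rho> \<subseteq> U"
    using assms openE by blast
  define \<delta> where "\<delta> = min \<rho> (c / 4)"
  have \<delta>: "\<delta> > 0" "\<delta> \<le> \<rho>" "\<delta> \<le> c / 4"
    using \<rho> c by (auto simp: \<delta>_def)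
  show thesis
  proof (rule that[of \<delta> "c / 2" "norm h + \<delta>"])
    show "ball h \<delta> \<subseteq> U"
      using \<rho>(2) \<delta>(2) by auto
    show "ball h \<delta> \<subseteq> entry_cube (norm h + \<delta>)"
    proof
      fix X assume "X \<in> ball h \<delta>"
      then have "norm X \<le> norm h + \<delta>"
        using norm_triangle_sub[of X h] by (simp add: dist_norm norm_minus_commute)
      then show "X \<in> entry_cube (norm h + \<delta>)"
        using abs_matrix_nth_le_norm[of X] by (auto simp: entry_cube_def intro: order_trans)
    qed
    show "c / 2 * norm x \<le> norm (X *v x)" if "X \<in> ball h \<delta>" for X x
      using that \<delta> c
      by (intro norm_matrix_lower_bound_ball[of c h]) (auto simp: dist_norm norm_minus_commute)
    show "norm (Y - X) < c / 2" if "X \<in> ball h \<delta>" "Y \<in> ball h \<delta>" for X Y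
      using that \<delta>(3) dist_triangle3[of Y X h] by (simp flip: dist_norm)
  qed (use \<delta> c in \<open>auto simp: add_nonneg_pos\<close>)
qed

lemma flow_orbit_coincidence:
  assumes s: "s > 0" "s' > 0" and \<gamma>: "\<gamma> \<in> GLZ" "\<gamma>' \<in> GLZ"
    and eq: "flow s ** X ** \<gamma> = flow s' ** X' ** \<gamma>'"
  shows "flow (s / s') ** X ** (\<gamma> ** matrix_inv \<gamma>') = X'"
proof -
  have "flow (s / s') ** X ** (\<gamma> ** matrix_inv \<gamma>')
      = flow (1 / s') ** (flow s ** X ** \<gamma>) ** matrix_inv \<gamma>'"
    using s by (simp add: matrix_mul_assoc flow_mult)
  also have "\<dots> = X'"
    unfolding eq using GLZ_det_nonzero[OF \<gamma>(2)] s
    by (simp add: flow_inverse matrix_inv_mult flip: matrix_mul_assoc)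
  finally show ?thesis .
qed

lemma flow_recurrence:
  fixes V :: "(real^('m::finite + 'n::finite)^('m + 'n)) set"
  assumes V: "V \<in> sets borel" "V \<subseteq> entry_cube R" and R: "R > 0" and vol: "measure lborel V > 0"
    and low: "c > 0" "\<And>X x. X \<in> V \<Longrightarrow> c * norm x \<le> norm (X *v x)" and b: "b \<ge> 1"
  obtains k \<beta> X where "\<beta> \<in> GLZ" "(k, \<beta>) \<noteq> (0, mat 1)" "X \<in> V" "flow (b ^ k) ** X ** \<beta> \<in> V"
proof -
  have power_ge_1: "b ^ k \<ge> 1" "b ^ k > 0" for k
    using b by (simp_all add: one_le_power)
  obtain r where r: "\<And>s. s \<ge> 1 \<Longrightarrow> ennreal (measure lborel V / 2)
      \<le> emeasure lborel (\<Union>\<gamma>\<in>GLZ. V \<inter> (\<lambda>X. flow s ** X ** \<gamma>) -` cball 0 r)"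
    using flow_returns_to_compact[OF V R vol low] by blast
  have unimodular: "\<bar>det (flow (b ^ k) :: real^('m + 'n)^('m + 'n))\<bar> = 1" for k
    using power_ge_1 by (simp add: det_flow)
  have borel: "V \<inter> (\<lambda>X. flow (b ^ k) ** X ** \<gamma>) -` cball 0 r \<in> sets lborel" for k \<gamma>
    using V(1) measurable_sets[OF borel_measurable_linear[OF linear_matrix_conj], of "cball 0 r"]
    by (intro sets.Int) auto
  obtain k k' X X' and \<gamma> \<gamma>' :: "real^('m + 'n)^('m + 'n)"
    where return: "\<gamma> \<in> GLZ" "\<gamma>' \<in> GLZ" "(k, \<gamma>) \<noteq> (k', \<gamma>')" "k' \<le> k"
      "X \<in> V" "X' \<in> V" "flow (b ^ k) ** X ** \<gamma> = flow (b ^ k') ** X' ** \<gamma>'"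
  proof (rule measure_preserving_family_recurrence[OF countable_GLZ, of "cball 0 r" lborel
        "measure lborel V / 2" V "\<lambda>k \<gamma> X. flow (b ^ k) ** X ** \<gamma>"])
    fix k and \<gamma> :: "real^('m + 'n)^('m + 'n)" and A :: "(real^('m + 'n)^('m + 'n)) set"
    assume \<gamma>: "\<gamma> \<in> GLZ" and A: "A \<in> sets lborel"
    have det: "\<bar>det \<gamma>\<bar> = 1"
      using \<gamma> by (simp add: GLZ_def)
    show "(\<lambda>X. flow (b ^ k) ** X ** \<gamma>) ` A \<in> sets lborel"
      using borel_matrix_conj_image[OF unimodular det] A by simp
    show "emeasure lborel ((\<lambda>X. flow (b ^ k) ** X ** \<gamma>) ` A) = emeasure lborel A"
      using emeasure_matrix_conj_image[OF unimodular det] A by simp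
  qed (use r power_ge_1 vol borel in \<open>auto intro: bounded_borel_fmeasurable\<close>)
  define \<beta> where "\<beta> = \<gamma> ** matrix_inv \<gamma>'"
  have "flow (b ^ (k - k')) ** X ** \<beta> \<in> V"
    using flow_orbit_coincidence[OF power_ge_1(2) power_ge_1(2) return(1,2,7)] return(4,6) b
    by (simp add: \<beta>_def power_diff)
  moreover have "\<beta> \<in> GLZ"
    using return(1,2) by (simp add: \<beta>_def GLZ_mult GLZ_matrix_inv)
  moreover have "\<gamma> = \<gamma>'" if "\<beta> = mat 1"
    using that GLZ_det_nonzero[OF return(2)]
    by (metis \<beta>_def matrix_mul_lid matrix_mult_matrix_inv_cancel(2))
  then have "(k - k', \<beta>) \<noteq> (0, mat 1)"
    using return(3,4) by auto
  ultimately show thesis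
    using that return(5) by blast
qed

theorem flow_nonwandering:
  fixes h :: "real^('m::finite + 'n::finite)^('m + 'n)"
  assumes h: "det h \<noteq> 0" "h \<in> U" "open U"
  shows "\<exists>t \<ge> T. \<exists>X \<in> U. flow t ** X \<in> GLZ_saturation U"
proof -
  define b where "b = max T 2"
  obtain \<delta> c R where V: "\<delta> > 0" "c > 0" "R > 0" "ball h \<delta> \<subseteq> U" "ball h \<delta> \<subseteq> entry_cube R"
    and low: "\<And>X x. X \<in> ball h \<delta> \<Longrightarrow> c * norm x \<le> norm (X *v x)"
    and near: "\<And>X Y. X \<in> ball h \<delta> \<Longrightarrow> Y \<in> ball h \<delta> \<Longrightarrow> norm (Y - X) < c"
    using exists_uniformly_invertible_ball[OF h] by blast
  have b_ge_1: "b \<ge> 1"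
    by (simp add: b_def)
  obtain k \<beta> X where return: "\<beta> \<in> GLZ" "(k, \<beta>) \<noteq> (0, mat 1)" "X \<in> ball h \<delta>"
      "flow (b ^ k) ** X ** \<beta> \<in> ball h \<delta>"
    using borel_open[OF open_ball] V(5,3) content_ball_pos[OF V(1)] V(2) low b_ge_1
    by (rule flow_recurrence) blast
  have "k \<noteq> 0"
  proof
    assume "k = 0"
    then have "norm (X ** \<beta> - X) < c"
      using near[OF return(3,4)] by (simp add: flow_1)
    then have "\<beta> = mat 1"
      by (rule GLZ_near_identity[OF low[OF return(3)] _ return(1)])
    then show False
      using \<open>k = 0\<close> return(2) by simp
  qed
  then have "b ^ 1 \<le> b ^ k"
    by (intro power_increasing b_ge_1) simp
  then have "T \<le> b ^ k"
    by (simp add: b_def)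
  moreover have "flow (b ^ k) ** X \<in> GLZ_saturation U"
    using return(1,4) V(4) by (auto simp: GLZ_saturation_def)
  ultimately show ?thesis
    using return(3) V(4) by blast
qed

section \<open>Topological transitivity of the flow\<close>

lemma LIMSEQ_I_inverse_Suc:
  fixes X :: "nat \<Rightarrow> 'a::metric_space"
  assumes "\<And>n. dist (X n) L < inverse (real (Suc n))"
  shows "X \<longlonglongrightarrow> L"
  using assms by (intro metric_tendsto_imp_tendsto[OF LIMSEQ_inverse_real_of_nat])
    (auto intro!: always_eventually less_imp_le simp: dist_real_def)

lemma tendsto_row_op [tendsto_intros]:
  assumes "(f \<longlongrightarrow> X) F" "(r \<longlongrightarrow> s) F"
  shows "((\<lambda>x. row_op i j (r x) (f x)) \<longlongrightarrow> row_op i j s X) F"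
  unfolding row_op_def by (intro vec_tendstoI) (auto intro!: tendsto_intros assms)

lemma row_op_0: "row_op i j 0 X = X"
  by (simp add: row_op_def vec_eq_iff)

lemma flow_row_op:
  fixes X :: "real^('m::finite + 'n::finite)^('m + 'n)"
  assumes t: "t > 0"
  shows "flow t ** row_op (Inl a) (Inr b) (s / expansion_rate TYPE('m) TYPE('n) t) X =
      row_op (Inl a) (Inr b) s (flow t ** X)"
    "flow (1 / t) ** row_op (Inr b) (Inl a) (s / expansion_rate TYPE('m) TYPE('n) t) X =
      row_op (Inr b) (Inl a) s (flow (1 / t) ** X)"
  using t unfolding flow_def block_diag_eq_diag_mat
  by (subst diag_mat_row_op; simp add: expansion_rate_def powr_divide)+

lemma nonwandering_sequence:
  fixes y :: "real^('m::finite + 'n::finite)^('m + 'n)"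
  assumes "det y \<noteq> 0"
  obtains t :: "nat \<Rightarrow> real" and X \<gamma> where "\<And>n. t n \<ge> 1" "filterlim t at_top sequentially"
    "\<And>n. \<gamma> n \<in> GLZ"
    "X \<longlonglongrightarrow> y" "(\<lambda>n. flow (t n) ** X n ** \<gamma> n) \<longlonglongrightarrow> y"
proof -
  have "\<exists>t X \<gamma>. t \<ge> real (Suc n) \<and> \<gamma> \<in> GLZ \<and> dist X y < inverse (real (Suc n)) \<and>
      dist (flow t ** X ** \<gamma>) y < inverse (real (Suc n))" for n
  proof -
    obtain t X where "t \<ge> real (Suc n)" "X \<in> ball y (inverse (real (Suc n)))"
      "flow t ** X \<in> GLZ_saturation (ball y (inverse (real (Suc n))))"
      using flow_nonwandering[OF assms, of "ball y (inverse (real (Suc n)))" "real (Suc n)"] by auto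
    then show ?thesis
      by (auto simp: GLZ_saturation_def dist_commute)
  qed
  then obtain t X \<gamma> where t: "\<And>n. t n \<ge> real (Suc n)" and \<gamma>: "\<And>n. \<gamma> n \<in> GLZ"
    and lim: "\<And>n. dist (X n) y < inverse (real (Suc n))"
      "\<And>n. dist (flow (t n) ** X n ** \<gamma> n) y < inverse (real (Suc n))"
    by metis
  show thesis
  proof (rule that[of t \<gamma> X])
    show "filterlim t at_top sequentially"
      using t by (intro filterlim_at_top_mono[OF filterlim_real_sequentially])
        (auto intro!: always_eventually order_trans[OF _ t])
    show "t n \<ge> 1" for n
      using t[of n] by simp
  qed (use \<gamma> lim in \<open>auto intro: LIMSEQ_I_inverse_Suc\<close>)
qed

lemma limit_in_closure:
  fixes f :: "nat \<Rightarrow> 'a::metric_space"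
  assumes "f \<longlonglongrightarrow> x" "\<forall>\<^sub>F n in sequentially. f n \<in> V"
  shows "x \<in> closure V"
  by (rule Lim_in_closed_set[OF closed_closure _ sequentially_bot assms(1)])
    (use assms(2) closure_subset[of V] in \<open>auto elim: eventually_mono\<close>)

definition flow_invariant :: "(real^('m::finite + 'n::finite)^('m + 'n)) set \<Rightarrow> bool" where
  "flow_invariant V \<longleftrightarrow> (\<forall>X \<in> V. \<forall>t > 0. \<forall>\<gamma> \<in> GLZ. flow t ** X ** \<gamma> \<in> V)"

text \<open>A topological version of the Mautner phenomenon: a row operation which the flow contracts
  can be absorbed into a nonwandering orbit.\<close>

lemma row_op_limit_in_closure:
  fixes V :: "(real^'k^'k::finite) set"
  assumes V: "open V" "y \<in> V" and lim: "f \<longlonglongrightarrow> y" "g \<longlonglongrightarrow> y" "\<epsilon> \<longlonglongrightarrow> 0"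
    and absorb: "\<And>n. row_op i j (\<epsilon> n) (f n) \<in> V \<Longrightarrow> row_op i j s (g n) \<in> V"
  shows "row_op i j s y \<in> closure V"
proof (rule limit_in_closure)
  show "(\<lambda>n. row_op i j s (g n)) \<longlonglongrightarrow> row_op i j s y"
    by (intro tendsto_intros lim)
  have "(\<lambda>n. row_op i j (\<epsilon> n) (f n)) \<longlonglongrightarrow> y"
    using tendsto_row_op[OF lim(1,3), of i j] by (simp add: row_op_0)
  then have "\<forall>\<^sub>F n in sequentially. row_op i j (\<epsilon> n) (f n) \<in> V"
    by (rule topological_tendstoD[OF _ V])
  then show "\<forall>\<^sub>F n in sequentially. row_op i j s (g n) \<in> V"
    by (rule eventually_mono) (rule absorb)
qed

lemma contracted_row_op_in_closure:
  fixes V :: "(real^('m::finite + 'n::finite)^('m + 'n)) set"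
  assumes V: "open V" "V \<subseteq> {X. det X \<noteq> 0}" "flow_invariant V" and y: "y \<in> V"
  shows "row_op (Inl a) (Inr b) s y \<in> closure V" "row_op (Inr b) (Inl a) s y \<in> closure V"
proof -
  have "det y \<noteq> 0"
    using V(2) y by auto
  then obtain t X \<gamma> where t: "\<And>n. t n \<ge> 1" "filterlim t at_top sequentially" and \<gamma>: "\<And>n. \<gamma> n \<in> GLZ"
    and lim: "X \<longlonglongrightarrow> y" "(\<lambda>n. flow (t n) ** X n ** \<gamma> n) \<longlonglongrightarrow> y"
    by (rule nonwandering_sequence) blast
  define Z where "Z = (\<lambda>n. flow (t n) ** X n ** \<gamma> n)"
  define r where "r = (\<lambda>n. expansion_rate TYPE('m) TYPE('n) (t n))"
  have t_pos: "t n > 0" for n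
    using t(1)[of n] by simp
  have "filterlim r at_top sequentially"
    using expansion_rate_ge[OF t(1), where 'm = 'm and 'n = 'n] unfolding r_def
    by (intro filterlim_at_top_mono[OF t(2)]) auto
  then have small: "(\<lambda>n. s / r n) \<longlonglongrightarrow> 0"
    by (intro real_tendsto_divide_at_top[OF tendsto_const])
  have Z: "Z \<longlonglongrightarrow> y"
    unfolding Z_def by (rule lim(2))
  show "row_op (Inl a) (Inr b) s y \<in> closure V"
  proof (rule row_op_limit_in_closure[OF V(1) y lim(1) Z small])
    fix n assume absorbed: "row_op (Inl a) (Inr b) (s / r n) (X n) \<in> V"
    have "row_op (Inl a) (Inr b) s (Z n)
        = flow (t n) ** row_op (Inl a) (Inr b) (s / r n) (X n) ** \<gamma> n"
      by (simp add: Z_def r_def row_op_matrix_mult flow_row_op(1)[OF t_pos])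
    then show "row_op (Inl a) (Inr b) s (Z n) \<in> V"
      using absorbed V(3) t_pos \<gamma> by (simp add: flow_invariant_def)
  qed
  show "row_op (Inr b) (Inl a) s y \<in> closure V"
  proof (rule row_op_limit_in_closure[OF V(1) y Z lim(1) small])
    fix n assume absorbed: "row_op (Inr b) (Inl a) (s / r n) (Z n) \<in> V"
    have "X n = flow (1 / t n) ** Z n ** matrix_inv (\<gamma> n)"
      using t_pos[of n] GLZ_det_nonzero[OF \<gamma>[of n]]
      by (simp add: Z_def flow_inverse matrix_inv_mult flip: matrix_mul_assoc)
    then have "row_op (Inr b) (Inl a) s (X n) =
        flow (1 / t n) ** row_op (Inr b) (Inl a) (s / r n) (Z n) ** matrix_inv (\<gamma> n)"
      by (simp add: r_def row_op_matrix_mult flow_row_op(2)[OF t_pos])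
    then show "row_op (Inr b) (Inl a) s (X n) \<in> V"
      using absorbed V(3) t_pos GLZ_matrix_inv[OF \<gamma>] by (simp add: flow_invariant_def)
  qed
qed

lemma row_op_in_closure:
  fixes V :: "(real^('m::finite + 'n::finite)^('m + 'n)) set"
  assumes V: "open V" "V \<subseteq> {X. det X \<noteq> 0}" "flow_invariant V" and y: "y \<in> closure V" and ij: "i \<noteq> j"
  shows "row_op i j s y \<in> closure V"
proof -
  have "continuous_on (closure V) (row_op i j s)" for i j s
    by (simp add: continuous_on_def tendsto_row_op[OF _ tendsto_const])
  then have "row_op (Inl a) (Inr b) s ` closure V \<subseteq> closure V"
      "row_op (Inr b) (Inl a) s ` closure V \<subseteq> closure V" for a b s
    using contracted_row_op_in_closure[OF V] by (intro image_closure_subset; auto)+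
  then have mixed: "row_op (Inl a) (Inr b) s z \<in> closure V" "row_op (Inr b) (Inl a) s z \<in> closure V"
    if "z \<in> closure V" for a b s z
    using that by blast+
  show ?thesis
  proof (cases i; cases j)
    fix a b assume "i = Inl a" "j = Inr b"
    then show ?thesis using mixed y by blast
  next
    fix a b assume "i = Inr a" "j = Inl b"
    then show ?thesis using mixed y by blast
  next
    fix a b c assume ab: "i = Inl a" "j = Inl b"
    then have "row_op i j s y =
        row_op i (Inr c) s (row_op (Inr c) j 1 (row_op i (Inr c) (- s) (row_op (Inr c) j (- 1) y)))"
      using ij by (intro row_op_commutator) auto
    then show ?thesis using mixed y ab by metis
  next
    fix a b c assume ab: "i = Inr a" "j = Inr b"
    then have "row_op i j s y =
        row_op i (Inl c) s (row_op (Inl c) j 1 (row_op i (Inl c) (- s) (row_op (Inl c) j (- 1) y)))"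
      using ij by (intro row_op_commutator) auto
    then show ?thesis using mixed y ab by metis
  qed
qed

lemma row_op_products_in_closure:
  fixes V :: "(real^('m::finite + 'n::finite)^('m + 'n)) set"
  assumes V: "open V" "V \<subseteq> {X. det X \<noteq> 0}" "flow_invariant V" and "E \<in> row_op_products"
    "y \<in> closure V"
  shows "E ** y \<in> closure V"
  using assms(4,5)
proof induction
  case (step X i j s)
  then show ?case
    using row_op_in_closure[OF V] by (simp add: row_op_matrix_mult[symmetric])
qed simp

lemma reflection_in_GLZ: "single_diag k (- 1) \<in> GLZ"
  by (simp add: GLZ_def int_mats_def det_diag_mat) (simp add: diag_mat_def)

lemma same_covolume_in_closure:
  fixes V :: "(real^('m::finite + 'n::finite)^('m + 'n)) set"
  assumes V: "open V" "V \<subseteq> {X. det X \<noteq> 0}" "flow_invariant V" and h: "h \<in> V"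
    and M: "\<bar>det M\<bar> = \<bar>det h\<bar>"
  shows "M \<in> closure V"
proof -
  fix k :: "'m + 'n"
  have det_eq: "N \<in> closure V" if N: "det N = det g" "g \<in> V" for N g
  proof -
    have g: "det g \<noteq> 0"
      using V(2) N(2) by auto
    define X where "X = N ** matrix_inv g"
    have "det X = 1"
      using N(1) g by (simp add: X_def det_mul det_matrix_inv)
    moreover have "single_diag k 1 = mat 1"
      by (simp add: diag_mat_1 cong: if_cong)
    ultimately have "X \<in> row_op_products"
      using matrix_eq_row_op_products[of X k] by (auto cong: if_cong)
    then show ?thesis
      using row_op_products_in_closure[OF V, of X g] N(2) closure_subset[of V]
      by (auto simp: X_def matrix_mult_matrix_inv_cancel g)
  qed
  have "flow 1 ** h ** single_diag k (- 1) \<in> V"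
    using V(3) h reflection_in_GLZ[of k] unfolding flow_invariant_def by (metis zero_less_one)
  moreover have "det M = det h \<or> det M = det (flow 1 ** h ** single_diag k (- 1))"
    using M by (auto simp: det_mul det_diag_mat flow_1 abs_if split: if_splits)
  ultimately show ?thesis
    using det_eq h by blast
qed

definition flow_saturation ::
  "(real^('m::finite + 'n::finite)^('m + 'n)) set \<Rightarrow> (real^('m + 'n)^('m + 'n)) set" where
  "flow_saturation U = (\<Union>t\<in>{0<..}. \<Union>\<gamma>\<in>GLZ. (\<lambda>X. flow t ** X ** \<gamma>) ` U)"

lemma subset_flow_saturation: "U \<subseteq> flow_saturation U"
  unfolding flow_saturation_def using GLZ_1
  by (force intro!: bexI[of _ 1] bexI[of _ "mat 1"] simp: flow_1)

lemma flow_invariant_flow_saturation: "flow_invariant (flow_saturation U)"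
  unfolding flow_invariant_def
proof (intro ballI allI impI)
  fix X and t :: real and \<gamma> :: "real^('a + 'b)^('a + 'b)"
  assume "X \<in> flow_saturation U" and t: "t > 0" and \<gamma>: "\<gamma> \<in> GLZ"
  then obtain s \<beta> Y where Y: "s > 0" "\<beta> \<in> GLZ" "Y \<in> U" "X = flow s ** Y ** \<beta>"
    by (auto simp: flow_saturation_def)
  have "flow t ** X ** \<gamma> = flow (t * s) ** Y ** (\<beta> ** \<gamma>)"
    using t Y(1) by (simp add: Y(4) matrix_mul_assoc flow_mult)
  then show "flow t ** X ** \<gamma> \<in> flow_saturation U"
    unfolding flow_saturation_def
    using t Y GLZ_mult[OF Y(2) \<gamma>] by (intro UN_I[of "t * s"] UN_I[of "\<beta> ** \<gamma>"]) auto
qed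

lemma open_flow_saturation:
  assumes "open U"
  shows "open (flow_saturation U)"
  unfolding flow_saturation_def
proof (intro open_UN ballI)
  fix t :: real and \<gamma> :: "real^('a + 'b)^('a + 'b)"
  assume t: "t \<in> {0<..}" and \<gamma>: "\<gamma> \<in> GLZ"
  have "flow t ** (flow (1 / t) ** X ** matrix_inv \<gamma>) ** \<gamma> = X" for X
    using t GLZ_det_nonzero[OF \<gamma>] by (simp add: flow_inverse matrix_inv_mult flip: matrix_mul_assoc)
  then have "surj (\<lambda>X. flow t ** X ** \<gamma>)"
    by (rule surjI)
  then show "open ((\<lambda>X. flow t ** X ** \<gamma>) ` U)"
    by (rule open_surjective_linear_image[OF assms linear_matrix_conj])
qed

theorem flow_transitive:
  fixes h M :: "real^('m::finite + 'n::finite)^('m + 'n)"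
  assumes h: "det h \<noteq> 0" "h \<in> U" "open U" and M: "\<bar>det M\<bar> = \<bar>det h\<bar>" "M \<in> W" "open W"
  shows "\<exists>t \<ge> 1. \<exists>X \<in> U. flow t ** X \<in> GLZ_saturation W"
proof -
  define U' where "U' = U \<inter> {X. det X \<noteq> 0}"
  have U': "open U'" "h \<in> U'"
    using h open_det_nonzero by (auto simp: U'_def)
  have "flow_saturation U' \<subseteq> {X. det X \<noteq> 0}"
    by (auto simp: flow_saturation_def U'_def det_mul det_flow dest: GLZ_det_nonzero)
  then have "M \<in> closure (flow_saturation U')"
    using U' M(1) subset_flow_saturation
    by (intro same_covolume_in_closure open_flow_saturation flow_invariant_flow_saturation) auto
  then have "W \<inter> flow_saturation U' \<noteq> {}"
    using open_Int_closure_eq_empty[OF M(3), of "flow_saturation U'"] M(2) by blast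
  then obtain t Y \<gamma> where t: "t > 0" "\<gamma> \<in> GLZ" "Y \<in> U'" "flow t ** Y ** \<gamma> \<in> W"
    by (auto simp: flow_saturation_def)
  define Z where "Z = U' \<inter> (\<lambda>X. flow t ** X) -` GLZ_saturation W"
  have "open Z"
    unfolding Z_def using U'(1) M(3)
    by (intro open_Int open_vimage open_GLZ_saturation continuous_intros)
  moreover have "Y \<in> Z"
    using t by (auto simp: Z_def GLZ_saturation_def)
  ultimately obtain s X where s: "s \<ge> 1 / t" "X \<in> Z" "flow s ** X \<in> GLZ_saturation Z"
    using flow_nonwandering[of Y Z "1 / t"] t(3) by (auto simp: U'_def)
  then obtain \<beta> where \<beta>: "\<beta> \<in> GLZ" "flow t ** (flow s ** X ** \<beta>) \<in> GLZ_saturation W"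
    by (auto simp: GLZ_saturation_def Z_def)
  have "s > 0"
    using s(1) t(1) by (meson less_le_trans zero_less_divide_1_iff)
  then have "flow (t * s) ** X \<in> GLZ_saturation W"
    using \<beta> mult_GLZ_in_GLZ_saturation_iff[OF \<beta>(1), of "flow (t * s) ** X" W] t(1)
    by (simp add: matrix_mul_assoc flow_mult)
  moreover have "t * s \<ge> 1"
    using s(1) t(1) by (simp add: field_simps)
  ultimately show ?thesis
    using s(2) by (auto simp: Z_def U'_def)
qed

lemma transitive_sequence:
  fixes h M :: "real^('m::finite + 'n::finite)^('m + 'n)"
  assumes "det h \<noteq> 0" "\<bar>det M\<bar> = \<bar>det h\<bar>"
  obtains t :: "nat \<Rightarrow> real" and Y \<gamma> where "\<And>n. t n \<ge> 1" "\<And>n. \<gamma> n \<in> GLZ" "Y \<longlonglongrightarrow> h"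
    "(\<lambda>n. flow (t n) ** Y n ** \<gamma> n) \<longlonglongrightarrow> M"
proof -
  have "\<exists>t Y \<gamma>. t \<ge> 1 \<and> \<gamma> \<in> GLZ \<and> dist Y h < inverse (real (Suc n)) \<and>
      dist (flow t ** Y ** \<gamma>) M < inverse (real (Suc n))" for n
  proof -
    obtain t Y where "t \<ge> 1" "Y \<in> ball h (inverse (real (Suc n)))"
      "flow t ** Y \<in> GLZ_saturation (ball M (inverse (real (Suc n))))"
      using flow_transitive[OF assms(1) _ _ assms(2),
          of "ball h (inverse (real (Suc n)))" "ball M (inverse (real (Suc n)))"]
      by auto
    then show ?thesis
      by (auto simp: GLZ_saturation_def dist_commute)
  qed
  then obtain t Y \<gamma> where "\<And>n. t n \<ge> 1" "\<And>n. \<gamma> n \<in> GLZ" "\<And>n. dist (Y n) h < inverse (real (Suc n))"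
      "\<And>n. dist (flow (t n) ** Y n ** \<gamma> n) M < inverse (real (Suc n))"
    by metis
  then show thesis
    by (intro that[of t \<gamma> Y] LIMSEQ_I_inverse_Suc)
qed

section \<open>Expanding horospheres are dense\<close>

definition upper_left :: "real^('m::finite + 'n::finite)^('m + 'n) \<Rightarrow> real^'m^'m" where
  "upper_left X = (\<chi> a c. X $ Inl a $ Inl c)"

definition upper_right :: "real^('m::finite + 'n::finite)^('m + 'n) \<Rightarrow> real^'n^'m" where
  "upper_right X = (\<chi> a b. X $ Inl a $ Inr b)"

lemma blocks_of_1: "upper_left (mat 1) = mat 1" "upper_right (mat 1) = 0"
  by (simp_all add: upper_left_def upper_right_def mat_def vec_eq_iff)

lemma tendsto_upper_left [tendsto_intros]:
  "(f \<longlongrightarrow> X) F \<Longrightarrow> ((\<lambda>x. upper_left (f x)) \<longlongrightarrow> upper_left X) F"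
  unfolding upper_left_def by (intro vec_tendstoI) (auto intro!: tendsto_intros)

lemma tendsto_upper_right [tendsto_intros]:
  "(f \<longlongrightarrow> X) F \<Longrightarrow> ((\<lambda>x. upper_right (f x)) \<longlongrightarrow> upper_right X) F"
  unfolding upper_right_def by (intro vec_tendstoI) (auto intro!: tendsto_intros)

lemma upper_right_mult_uni:
  fixes X :: "real^('m::finite + 'n::finite)^('m + 'n)"
  shows "upper_right (X ** uni B) = upper_left X ** B + upper_right X"
  by (simp add: vec_eq_iff upper_left_def upper_right_def matrix_matrix_mult_def sum_over_sum_type
    uni_def if_distrib[of "\<lambda>y. _ * y"] cong: if_cong)

lemma block_diag_conj_nth:
  "(block_diag a b ** X ** block_diag a' b') $ i $ j =
    (case i of Inl _ \<Rightarrow> a | Inr _ \<Rightarrow> b) * X $ i $ j * (case j of Inl _ \<Rightarrow> a' | Inr _ \<Rightarrow> b')"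
proof -
  have "(Y ** diag_mat f) $ i $ j = Y $ i $ j * f j" for Y f
    by (simp add: matrix_matrix_mult_def diag_mat_def if_distrib[of "\<lambda>y. _ * y"] cong: if_cong)
  then show ?thesis
    by (simp add: block_diag_eq_diag_mat diag_mat_mult_nth)
qed

lemma norm_flow_conj_minus_1_le:
  fixes p :: "real^('m::finite + 'n::finite)^('m + 'n)"
  assumes "upper_right p = 0" "t \<ge> 1"
  shows "norm (flow t ** p ** flow (1 / t) - mat 1) \<le> norm (p - mat 1)"
proof (rule norm_matrix_mono)
  fix i j :: "'m + 'n"
  define a where "a = t powr (real CARD('n) / real CARD('m))"
  have a: "a \<ge> 1" "(1 / t) powr (real CARD('n) / real CARD('m)) = 1 / a"
    using assms(2) by (simp_all add: a_def ge_one_powr_ge_zero powr_divide)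
  have conj: "(flow t ** p ** flow (1 / t)) $ i $ j =
      (case i of Inl _ \<Rightarrow> a | Inr _ \<Rightarrow> 1 / t) * p $ i $ j * (case j of Inl _ \<Rightarrow> 1 / a | Inr _ \<Rightarrow> t)"
    by (simp add: flow_def block_diag_conj_nth a a_def[symmetric])
  show "\<bar>(flow t ** p ** flow (1 / t) - mat 1) $ i $ j\<bar> \<le> \<bar>(p - mat 1) $ i $ j\<bar>"
  proof (cases i; cases j)
    fix u v assume ij: "i = Inl u" "j = Inr v"
    then have "p $ i $ j = 0"
      using assms(1) by (simp add: upper_right_def vec_eq_iff)
    then show ?thesis by (simp add: conj)
  next
    fix u v assume ij: "i = Inr u" "j = Inl v"
    have "1 \<le> t * a"
      using mult_mono[of 1 t 1 a] assms(2) a(1) by simp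
    then have "\<bar>p $ i $ j\<bar> / (t * a) \<le> \<bar>p $ i $ j\<bar> / 1"
      by (intro divide_left_mono) auto
    then show ?thesis
      using assms(2) a(1) conj by (simp add: ij mat_def abs_mult)
  qed (use assms(2) a(1) conj in simp_all)
qed

text \<open>Near the identity a matrix is a product of a block lower triangular one, which conjugation
  by the flow keeps small, and a unipotent upper one.\<close>

lemma lower_unipotent_decomposition:
  fixes X :: "nat \<Rightarrow> real^('m::finite + 'n::finite)^('m + 'n)"
  assumes "X \<longlonglongrightarrow> mat 1"
  obtains B where "(\<lambda>n. X n ** uni (- B n)) \<longlonglongrightarrow> mat 1"
    "\<forall>\<^sub>F n in sequentially. upper_right (X n ** uni (- B n)) = 0"
proof -
  have blocks: "(\<lambda>n. upper_left (X n)) \<longlonglongrightarrow> mat 1" "(\<lambda>n. upper_right (X n)) \<longlonglongrightarrow> 0"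
    using tendsto_upper_left[OF assms] tendsto_upper_right[OF assms] by (simp_all add: blocks_of_1)
  define B where "B = (\<lambda>n. matrix_inv (upper_left (X n)) ** upper_right (X n))"
  have "B \<longlonglongrightarrow> matrix_inv (mat 1) ** 0"
    unfolding B_def by (intro tendsto_intros blocks) simp
  then have "B \<longlonglongrightarrow> 0"
    by (simp add: matrix_matrix_mult_def zero_vec_def)
  then have "(\<lambda>n. X n ** uni (- B n)) \<longlonglongrightarrow> mat 1 ** uni (- 0)"
    by (intro tendsto_intros assms)
  then have "(\<lambda>n. X n ** uni (- B n)) \<longlonglongrightarrow> mat 1"
    by (simp add: uni_0)
  moreover have "\<forall>\<^sub>F n in sequentially. det (upper_left (X n)) \<noteq> 0"
    using tendsto_imp_eventually_ne[OF tendsto_det[OF blocks(1)]] by simp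
  then have "\<forall>\<^sub>F n in sequentially. upper_right (X n ** uni (- B n)) = 0"
  proof eventually_elim
    case (elim n)
    have "upper_left (X n) ** (- B n) = - upper_right (X n)"
      using bounded_bilinear.minus_right[OF bounded_bilinear_matrix_matrix_mult,
          of "upper_left (X n)" "B n"]
      by (simp add: B_def matrix_mult_matrix_inv_cancel elim)
    then show ?case by (simp add: upper_right_mult_uni)
  qed
  ultimately show thesis by (rule that)
qed

lemma flow_conj_mult:
  assumes "t > 0"
  shows "flow t ** (X ** uni (- B)) ** flow (1 / t) ** (flow t ** uni B ** Y) = flow t ** X ** Y"
proof -
  have "flow t ** (X ** uni (- B)) ** flow (1 / t) ** (flow t ** uni B ** Y) =
      flow t ** X ** uni (- B) ** (flow (1 / t) ** (flow t ** (uni B ** Y)))"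
    by (simp add: matrix_mul_assoc)
  also have "\<dots> = flow t ** X ** uni (- B) ** (uni B ** Y)"
    using assms by (simp add: flow_inverse)
  also have "\<dots> = flow t ** X ** (uni (- B) ** uni B) ** Y"
    by (simp add: matrix_mul_assoc)
  also have "\<dots> = flow t ** X ** Y"
    by (simp add: uni_mult uni_0)
  finally show ?thesis .
qed

theorem horosphere_dense:
  fixes h M :: "real^('m::finite + 'n::finite)^('m + 'n)"
  assumes h: "det h \<noteq> 0" and M: "\<bar>det M\<bar> = \<bar>det h\<bar>" "M \<in> U" "open U"
  shows "\<exists>t \<ge> 1. \<exists>B. flow t ** uni B ** h \<in> GLZ_saturation U"
proof -
  obtain t Y \<gamma> where t: "\<And>n. t n \<ge> 1" and \<gamma>: "\<And>n. \<gamma> n \<in> GLZ" and Y: "Y \<longlonglongrightarrow> h"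
    and G: "(\<lambda>n. flow (t n) ** Y n ** \<gamma> n) \<longlonglongrightarrow> M"
    using h M(1) by (rule transitive_sequence) blast
  define X where "X = (\<lambda>n. Y n ** matrix_inv h)"
  have "X \<longlonglongrightarrow> h ** matrix_inv h"
    unfolding X_def by (intro tendsto_intros Y)
  then have "X \<longlonglongrightarrow> mat 1"
    by (simp add: matrix_inv_mult h)
  then obtain B where B: "(\<lambda>n. X n ** uni (- B n)) \<longlonglongrightarrow> mat 1"
    "\<forall>\<^sub>F n in sequentially. upper_right (X n ** uni (- B n)) = 0"
    using lower_unipotent_decomposition by blast
  define P where "P = (\<lambda>n. flow (t n) ** (X n ** uni (- B n)) ** flow (1 / t n))"
  have "\<forall>\<^sub>F n in sequentially. norm (P n - mat 1) \<le> norm (X n ** uni (- B n) - mat 1)"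
    using B(2) by eventually_elim (simp add: P_def norm_flow_conj_minus_1_le t)
  then have P: "P \<longlonglongrightarrow> mat 1"
    using metric_tendsto_imp_tendsto[OF B(1), of P "mat 1"] by (simp add: dist_norm)
  have P_mult: "P n ** (flow (t n) ** uni (B n) ** h ** \<gamma> n) = flow (t n) ** Y n ** \<gamma> n" for n
    using flow_conj_mult[of "t n" "X n" "B n" "h ** \<gamma> n"] t[of n]
    by (simp add: P_def X_def matrix_mul_assoc)
      (simp add: matrix_mult_matrix_inv_cancel h flip: matrix_mul_assoc[of "flow (t n)"])
  have "(\<lambda>n. matrix_inv (P n) ** (flow (t n) ** Y n ** \<gamma> n)) \<longlonglongrightarrow> matrix_inv (mat 1) ** M"
    by (intro tendsto_intros P G) simp
  then have "(\<lambda>n. matrix_inv (P n) ** (flow (t n) ** Y n ** \<gamma> n)) \<longlonglongrightarrow> M"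
    by (simp add: matrix_inv_1)
  then have "\<forall>\<^sub>F n in sequentially. matrix_inv (P n) ** (flow (t n) ** Y n ** \<gamma> n) \<in> U"
    by (rule topological_tendstoD[OF _ M(3,2)])
  moreover have "\<forall>\<^sub>F n in sequentially. det (P n) \<noteq> 0"
    using tendsto_imp_eventually_ne[OF tendsto_det[OF P]] by simp
  ultimately have "\<forall>\<^sub>F n in sequentially. flow (t n) ** uni (B n) ** h ** \<gamma> n \<in> U"
    by eventually_elim (simp add: matrix_mult_matrix_inv_cancel flip: P_mult)
  then obtain n where "flow (t n) ** uni (B n) ** h ** \<gamma> n \<in> U"
    using eventually_happens[of _ sequentially] by auto
  then show ?thesis
    using t \<gamma> unfolding GLZ_saturation_def by blast
qed

section \<open>Sets without density points\<close>

lemma measure_disjoint_deficit_le: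
  fixes B :: "'i \<Rightarrow> 'a::euclidean_space set"
  assumes F: "finite F" and B: "\<And>i. B i \<in> lmeasurable" "pairwise (\<lambda>i j. disjnt (B i) (B j)) F"
    and W: "W - E \<in> lmeasurable" "\<And>i. i \<in> F \<Longrightarrow> B i \<subseteq> W" and E: "E \<in> sets lebesgue" and \<delta>: "\<delta> \<ge> 0"
    and deficit: "\<And>i. i \<in> F \<Longrightarrow> \<delta> * measure lebesgue (B i) \<le> measure lebesgue (B i - E)"
  shows "\<delta> * measure lebesgue (\<Union>i\<in>F. B i) \<le> measure lebesgue (W - E)"
proof -
  have diff_measurable: "B i - E \<in> lmeasurable" for i
    using B(1) E by (intro fmeasurable_Diff)
  have disjoint: "disjoint_family_on (\<lambda>i. B i - E) F"
    using B(2) unfolding disjoint_family_on_def pairwise_def disjnt_def by blast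
  have "\<delta> * measure lebesgue (\<Union>i\<in>F. B i) \<le> \<delta> * (\<Sum>i\<in>F. measure lebesgue (B i))"
    using F \<delta> B(1) by (intro mult_left_mono measure_UNION_le) (auto simp: fmeasurableD)
  also have "\<dots> = (\<Sum>i\<in>F. \<delta> * measure lebesgue (B i))"
    by (rule sum_distrib_left)
  also have "\<dots> \<le> (\<Sum>i\<in>F. measure lebesgue (B i - E))"
    by (intro sum_mono deficit)
  also have "\<dots> = measure lebesgue (\<Union>i\<in>F. B i - E)"
    using F diff_measurable fmeasurableD2[OF diff_measurable]
    by (intro measure_finite_Union[symmetric] disjoint) (auto simp: fmeasurableD)
  also have "\<dots> \<le> measure lebesgue (W - E)"
    using W(2) F diff_measurable
    by (intro measure_mono_fmeasurable W(1) sets.finite_UN) (auto intro: fmeasurableD)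
  finally show ?thesis .
qed

lemma Vitali_cover_measure_le:
  fixes a :: "'i \<Rightarrow> 'a::euclidean_space"
  assumes fine: "\<And>x d. x \<in> S \<Longrightarrow> 0 < d \<Longrightarrow> \<exists>i. i \<in> K \<and> x \<in> ball (a i) (r i) \<and> r i < d"
    and packing: "\<And>F. F \<subseteq> K \<Longrightarrow> finite F \<Longrightarrow>
        pairwise (\<lambda>i j. disjnt (ball (a i) (r i)) (ball (a j) (r j))) F \<Longrightarrow>
      measure lebesgue (\<Union>i\<in>F. ball (a i) (r i)) \<le> e"
  shows "\<exists>T. S \<subseteq> T \<and> T \<in> lmeasurable \<and> measure lebesgue T \<le> e"
proof -
  define B where "B = (\<lambda>i. ball (a i) (r i))"
  obtain C where C: "countable C" "C \<subseteq> K" "pairwise (\<lambda>i j. disjnt (B i) (B j)) C"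
      "negligible (S - (\<Union>i\<in>C. B i))"
    unfolding B_def by (rule Vitali_covering_theorem_balls[OF fine]) blast
  have B: "B i \<in> lmeasurable" for i
    by (simp add: B_def)
  have bound: "measure lebesgue (\<Union>i\<in>F. B i) \<le> e" if "F \<subseteq> C" "finite F" for F
    using packing[of F] pairwise_subset[OF C(3) that(1)] that C(2) by (auto simp: B_def)
  have meas: "(\<Union>i\<in>C. B i) \<in> lmeasurable"
    by (rule fmeasurable_UN_bound[OF C(1) B]) (erule (1) bound)
  define T where "T = (\<Union>i\<in>C. B i) \<union> (S - (\<Union>i\<in>C. B i))"
  have "T \<in> lmeasurable"
    unfolding T_def using meas negligible_imp_measurable[OF C(4)] by (rule fmeasurable.Un)
  moreover have "measure lebesgue T = measure lebesgue (\<Union>i\<in>C. B i)"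
    unfolding T_def using C(4) meas
    by (intro measure_Un_null_set) (auto simp: negligible_iff_null_sets fmeasurableD)
  moreover have "measure lebesgue (\<Union>i\<in>C. B i) \<le> e"
    by (rule measure_UN_bound[OF C(1) B]) (erule (1) bound)
  ultimately show ?thesis
    unfolding T_def by (intro exI[of _ T]) (auto simp: T_def)
qed

lemma negligible_uniform_density_deficit:
  fixes S E :: "'a::euclidean_space set"
  assumes E: "E \<in> sets lebesgue" "S \<subseteq> E" and \<delta>: "\<delta> > 0"
    and deficit: "\<And>x e. x \<in> S \<Longrightarrow> e > 0 \<Longrightarrow>
      \<exists>d. 0 < d \<and> d < e \<and> \<delta> * measure lebesgue (ball x d) \<le> measure lebesgue (ball x d - E)"
  shows "negligible S"
  unfolding negligible_outer_le
proof (intro allI impI)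
  fix e :: real assume e: "e > 0"
  have "0 < e * \<delta>" using e \<delta> by simp
  then obtain W where W: "open W" "E \<subseteq> W" "W - E \<in> lmeasurable"
      "emeasure lebesgue (W - E) < ennreal (e * \<delta>)"
    using sets_lebesgue_outer_open[OF E(1)] by blast
  then have excess: "measure lebesgue (W - E) < e * \<delta>"
    using emeasure_eq_measure2[OF W(3)] by (simp add: ennreal_less_iff)
  define K where "K = {i. ball (fst i) (snd i) \<subseteq> W \<and>
    \<delta> * measure lebesgue (ball (fst i) (snd i)) \<le> measure lebesgue (ball (fst i) (snd i) - E)}"
  show "\<exists>T. S \<subseteq> T \<and> T \<in> lmeasurable \<and> measure lebesgue T \<le> e"
  proof (rule Vitali_cover_measure_le[of S K fst snd])
    fix x :: 'a and d :: real assume x: "x \<in> S" and d: "0 < d"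
    obtain \<rho> where \<rho>: "\<rho> > 0" "ball x \<rho> \<subseteq> W"
      using W x E(2) openE by blast
    obtain d' where d': "0 < d'" "d' < min d \<rho>"
        "\<delta> * measure lebesgue (ball x d') \<le> measure lebesgue (ball x d' - E)"
      using deficit[OF x, of "min d \<rho>"] d \<rho> by auto
    then have "(x, d') \<in> K"
      using \<rho> by (auto simp: K_def)
    then show "\<exists>i. i \<in> K \<and> x \<in> ball (fst i) (snd i) \<and> snd i < d"
      using d' by (intro exI[of _ "(x, d')"]) auto
  next
    fix F assume F: "F \<subseteq> K" "finite F"
      "pairwise (\<lambda>i j. disjnt (ball (fst i) (snd i)) (ball (fst j) (snd j))) F"
    have "\<delta> * measure lebesgue (\<Union>i\<in>F. ball (fst i) (snd i)) \<le> measure lebesgue (W - E)"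
      using F(1) \<delta> by (intro measure_disjoint_deficit_le F(2,3) W(3) E(1)) (auto simp: K_def)
    also have "\<dots> \<le> \<delta> * e"
      using excess by (simp add: mult.commute)
    finally show "measure lebesgue (\<Union>i\<in>F. ball (fst i) (snd i)) \<le> e"
      using \<delta> by simp
  qed
qed

theorem negligible_density_deficit:
  fixes S E :: "'a::euclidean_space set"
  assumes E: "E \<in> sets lebesgue" "S \<subseteq> E"
    and deficit: "\<And>x. x \<in> S \<Longrightarrow>
      \<exists>\<delta>>0. \<forall>e>0. \<exists>d. 0 < d \<and> d < e \<and>
        \<delta> * measure lebesgue (ball x d) \<le> measure lebesgue (ball x d - E)"
  shows "negligible S"
proof -
  define S' where "S' = (\<lambda>j. {x \<in> S. \<forall>e>0. \<exists>d. 0 < d \<and> d < e \<and>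
    inverse (real (Suc j)) * measure lebesgue (ball x d) \<le> measure lebesgue (ball x d - E)})"
  have "negligible (S' j)" for j
    using E
    by (intro negligible_uniform_density_deficit[of E _ "inverse (real (Suc j))"])
      (auto simp: S'_def)
  moreover have "S \<subseteq> (\<Union>j. S' j)"
  proof
    fix x assume x: "x \<in> S"
    obtain \<delta> where \<delta>: "\<delta> > 0" "\<And>e. e > 0 \<Longrightarrow>
        \<exists>d. 0 < d \<and> d < e \<and> \<delta> * measure lebesgue (ball x d) \<le> measure lebesgue (ball x d - E)"
      using deficit[OF x] by blast
    obtain j where "inverse (real (Suc j)) < \<delta>"
      using reals_Archimedean[OF \<delta>(1)] by blast
    then have "inverse (real (Suc j)) * measure lebesgue T
        \<le> \<delta> * measure lebesgue T" for T :: "'a set"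
      by (intro mult_right_mono) auto
    then have "x \<in> S' j"
      using x \<delta>(2) unfolding S'_def by (blast intro: order_trans)
    then show "x \<in> (\<Union>j. S' j)" by blast
  qed
  ultimately show ?thesis
    by (intro negligible_subset[OF negligible_Union_nat, of S' S])
qed

lemma shrinking_balls_deficit:
  fixes x v :: "'a::euclidean_space" and q :: "nat \<Rightarrow> real"
  assumes q: "filterlim q at_top sequentially" and \<delta>: "\<delta> > 0" and E: "closed E"
    and avoid: "\<forall>\<^sub>F n in sequentially. ball (x + (1 / q n) *\<^sub>R v) (\<delta> / q n) \<inter> E = {}"
  shows "\<exists>c>0. \<forall>e>0. \<exists>d. 0 < d \<and> d < e \<and>
    c * measure lebesgue (ball x d) \<le> measure lebesgue (ball x d - E)"
proof -
  define D where "D = norm v + \<delta>"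
  have D: "D > 0" using \<delta> by (simp add: D_def add_nonneg_pos)
  have "\<exists>d. 0 < d \<and> d < e \<and>
      (\<delta> / D) ^ DIM('a) * measure lebesgue (ball x d) \<le> measure lebesgue (ball x d - E)"
    if e: "e > 0" for e
  proof -
    have "\<forall>\<^sub>F n in sequentially. q n > D / e"
      using q unfolding filterlim_at_top_dense by blast
    from eventually_happens[OF eventually_conj[OF avoid this]]
    obtain n where n: "ball (x + (1 / q n) *\<^sub>R v) (\<delta> / q n) \<inter> E = {}" "q n > D / e"
      by auto
    have q_pos: "q n > 0"
      using n(2) D e by (meson divide_pos_pos less_trans)
    define V where "V = ball (x + (1 / q n) *\<^sub>R v) (\<delta> / q n)"
    define d where "d = D / q n"
    have d: "0 < d" "d < e"
      using D q_pos n(2) e by (auto simp: d_def field_simps)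
    have "V \<subseteq> ball x d"
      using q_pos by (auto simp: V_def ball_subset_ball_iff d_def D_def dist_norm add_divide_distrib)
    then have "V \<subseteq> ball x d - E"
      using n(1) by (auto simp: V_def)
    then have "measure lebesgue V \<le> measure lebesgue (ball x d - E)"
      using E by (intro measure_mono_fmeasurable) (auto intro: fmeasurable_Diff simp: V_def)
    moreover have "measure lebesgue V = (\<delta> / D) ^ DIM('a) * measure lebesgue (ball x d)"
      using D \<delta> q_pos d(1) unfolding V_def d_def
      by (simp add: measure_completion content_ball_conv_unit_ball[of "\<delta> / q n"]
        content_ball_conv_unit_ball[of "D / q n"]
          power_divide)
    ultimately show ?thesis
      using d by auto
  qed
  then show ?thesis
    using \<delta> D by (intro exI[of _ "(\<delta> / D) ^ DIM('a)"]) auto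
qed

section \<open>Almost every orbit is dense\<close>

lemma nondivergent_bounded_representatives:
  fixes A :: "real^'n^'m"
  assumes "A \<notin> divergent"
  obtains R where "\<And>K. \<exists>k\<ge>K. \<exists>\<gamma> \<in> GLZ. norm (flow (real k) ** uni A ** \<gamma>) \<le> R"
proof -
  obtain \<eta> where \<eta>: "\<eta> > 0" "\<exists>\<^sub>F k in sequentially. flow (real k) ** uni A \<in> admissible norm \<eta>"
    using assms by (auto simp: divergent_def frequently_def)
  obtain R where R: "\<And>M :: real^('m + 'n)^('m + 'n). det M \<noteq> 0 \<Longrightarrow> \<bar>det M\<bar> \<le> 1 \<Longrightarrow>
      M \<in> admissible norm \<eta> \<Longrightarrow>
      \<exists>\<gamma> \<in> GLZ. norm (M ** \<gamma>) \<le> R"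
    using admissible_bounded_representative[OF \<eta>(1)] by blast
  have "\<exists>k\<ge>K. \<exists>\<gamma> \<in> GLZ. norm (flow (real k) ** uni A ** \<gamma>) \<le> R" for K
  proof -
    obtain k where k: "k \<ge> max K 1" "flow (real k) ** uni A \<in> admissible norm \<eta>"
      using \<eta>(2) unfolding frequently_sequentially by blast
    then have "\<exists>\<gamma> \<in> GLZ. norm (flow (real k) ** uni A ** \<gamma>) \<le> R"
      by (intro R) (simp_all add: det_mul det_flow det_uni)
    then show ?thesis using k(1) by auto
  qed
  then show thesis by (rule that)
qed

lemma nondivergent_limit_lattice:
  fixes A :: "real^'n^'m"
  assumes "A \<notin> divergent"
  obtains k :: "nat \<Rightarrow> real" and h :: "real^('m + 'n)^('m + 'n)" and \<gamma>
    where "\<bar>det h\<bar> = 1" "\<And>i. k i \<ge> 1" "filterlim k at_top sequentially" "\<And>i. \<gamma> i \<in> GLZ"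
      "(\<lambda>i. flow (k i) ** uni A ** \<gamma> i) \<longlonglongrightarrow> h"
proof -
  obtain R where R: "\<And>K. \<exists>k\<ge>K. \<exists>\<gamma> \<in> GLZ. norm (flow (real k) ** uni A ** \<gamma>) \<le> R"
    using assms by (rule nondivergent_bounded_representatives) blast
  have "\<exists>k \<gamma>. Suc i \<le> k \<and> \<gamma> \<in> GLZ \<and> norm (flow (real k) ** uni A ** \<gamma>) \<le> R" for i
    using R[of "Suc i"] by blast
  then obtain s \<gamma> where s: "\<And>i. Suc i \<le> s i" and \<gamma>: "\<And>i. \<gamma> i \<in> GLZ"
    and bound: "\<And>i. norm (flow (real (s i)) ** uni A ** \<gamma> i) \<le> R"
    by metis
  have s_ge_1: "real (s i) \<ge> 1" "real (s i) > 0" for i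
    using s[of i] by auto
  define Y where "Y = (\<lambda>i. flow (real (s i)) ** uni A ** \<gamma> i)"
  have "bounded (range Y)"
    using bound by (auto simp: Y_def bounded_iff)
  then obtain h \<phi> where h: "strict_mono \<phi>" "(Y \<circ> \<phi>) \<longlonglongrightarrow> h"
    using bounded_imp_convergent_subsequence[of Y] by blast
  have "\<bar>det ((Y \<circ> \<phi>) i)\<bar> = 1" for i
    using \<gamma>[of "\<phi> i"] s_ge_1 by (simp add: Y_def det_mul det_flow det_uni GLZ_def)
  then have "(\<lambda>i. \<bar>det ((Y \<circ> \<phi>) i)\<bar>) \<longlonglongrightarrow> 1"
    by simp
  then have "\<bar>det h\<bar> = 1"
    by (rule LIMSEQ_unique[OF tendsto_rabs[OF tendsto_det[OF h(2)]]])
  moreover have "filterlim (\<lambda>i. real (s (\<phi> i))) at_top sequentially"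
  proof (rule filterlim_at_top_mono[OF filterlim_real_sequentially])
    have "i \<le> s (\<phi> i)" for i
      using s[of "\<phi> i"] strict_mono_imp_increasing[OF h(1), of i] by linarith
    then show "\<forall>\<^sub>F i in sequentially. real i \<le> real (s (\<phi> i))"
      by simp
  qed
  ultimately show thesis
    using that[of h "\<lambda>i. real (s (\<phi> i))" "\<lambda>i. \<gamma> (\<phi> i)"] h(2) s_ge_1 \<gamma> by (simp add: Y_def o_def)
qed

definition never_visits ::
  "(real^('m::finite + 'n::finite)^('m + 'n)) set \<Rightarrow> real \<Rightarrow> (real^'n^'m) set" where
  "never_visits U T = {A. \<forall>t\<ge>T. flow t ** uni A \<notin> GLZ_saturation U}"

lemma closed_never_visits:
  assumes "open U"
  shows "closed (never_visits U T)"
proof -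
  have "never_visits U T = (\<Inter>t\<in>{T..}. - ((\<lambda>A. flow t ** uni A) -` GLZ_saturation U))"
    by (auto simp: never_visits_def)
  then show ?thesis
    using assms
    by (auto intro!: closed_INT closed_Compl open_vimage open_GLZ_saturation continuous_intros)
qed

lemma flow_uni_shift:
  fixes A B :: "real^'n^'m"
  assumes "t > 0" "k > 0"
  shows "flow t ** uni B ** (flow k ** uni A) =
    flow (t * k) ** uni (A + (1 / expansion_rate TYPE('m) TYPE('n) k) *\<^sub>R B)"
proof -
  have "expansion_rate TYPE('m) TYPE('n) k > 0"
    using assms(2) by (simp add: expansion_rate_def)
  then have "uni B ** flow k = flow k ** uni ((1 / expansion_rate TYPE('m) TYPE('n) k) *\<^sub>R B)"
    using flow_uni[OF assms(2), of "(1 / expansion_rate TYPE('m) TYPE('n) k) *\<^sub>R B"] by simp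
  then have "flow t ** uni B ** (flow k ** uni A) =
      (flow t ** flow k) ** (uni ((1 / expansion_rate TYPE('m) TYPE('n) k) *\<^sub>R B) ** uni A)"
    by (metis matrix_mul_assoc)
  then show ?thesis
    using assms by (simp add: flow_mult uni_mult add.commute)
qed

lemma horosphere_dense_uniform:
  fixes h M :: "real^('m::finite + 'n::finite)^('m + 'n)"
  assumes h: "det h \<noteq> 0" and M: "\<bar>det M\<bar> = \<bar>det h\<bar>" "M \<in> U" "open U"
  obtains t \<delta> H and B :: "real^'n^'m" where "t \<ge> 1" "\<delta> > 0" "open H" "h \<in> H"
    "\<And>B' Y. dist B B' < \<delta> \<Longrightarrow> Y \<in> H \<Longrightarrow> flow t ** uni B' ** Y \<in> GLZ_saturation U"
proof -
  obtain t B where tB: "t \<ge> 1" "flow t ** uni B ** h \<in> GLZ_saturation U"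
    using horosphere_dense[OF assms] by blast
  define \<Phi> where "\<Phi> = (\<lambda>x :: (real^'n^'m) \<times> (real^('m + 'n)^('m + 'n)).
      flow t ** uni (fst x) ** snd x)"
  have "open (\<Phi> -` GLZ_saturation U)"
    unfolding \<Phi>_def using M(3) by (intro open_vimage open_GLZ_saturation continuous_intros)
  moreover have "(B, h) \<in> \<Phi> -` GLZ_saturation U"
    using tB(2) by (simp add: \<Phi>_def)
  ultimately obtain P H where PH: "open P" "open H" "(B, h) \<in> P \<times> H" "P \<times> H \<subseteq> \<Phi> -` GLZ_saturation U"
    by (rule open_prod_elim)
  obtain \<delta> where \<delta>: "\<delta> > 0" "ball B \<delta> \<subseteq> P"
    using PH(1,3) openE by blast
  have "flow t ** uni B' ** Y \<in> GLZ_saturation U" if "dist B B' < \<delta>" "Y \<in> H" for B' Y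
  proof -
    have "(B', Y) \<in> P \<times> H"
      using that \<delta>(2) by auto
    then show ?thesis
      using PH(4) by (auto simp: \<Phi>_def)
  qed
  then show thesis
    using that tB(1) \<delta>(1) PH(2,3) by blast
qed

lemma ball_disjoint_never_visits:
  fixes A B :: "real^'n^'m"
  assumes t: "t \<ge> 1" and k: "k \<ge> 1" "k \<ge> T" and \<gamma>: "\<gamma> \<in> GLZ"
    and visit: "\<And>B'. dist B B' < \<delta> \<Longrightarrow> flow t ** uni B' ** (flow k ** uni A ** \<gamma>) \<in> GLZ_saturation U"
  defines "q \<equiv> expansion_rate TYPE('m) TYPE('n) k"
  shows "ball (A + (1 / q) *\<^sub>R B) (\<delta> / q) \<inter> never_visits U T = {}"
proof -
  have q: "q > 0"
    using expansion_rate_ge[OF k(1), where 'm = 'm and 'n = 'n] k(1) by (simp add: q_def)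
  have "A' \<notin> never_visits U T" if A': "A' \<in> ball (A + (1 / q) *\<^sub>R B) (\<delta> / q)" for A'
  proof -
    define B' where "B' = q *\<^sub>R (A' - A)"
    have A'_eq: "A' = A + (1 / q) *\<^sub>R B'"
      using q by (simp add: B'_def)
    have "dist B B' = q * dist (A + (1 / q) *\<^sub>R B) A'"
      using q by (simp add: A'_eq dist_norm flip: scaleR_diff_right)
    also have "\<dots> < q * (\<delta> / q)"
      using A' q by (intro mult_strict_left_mono) auto
    finally have "flow t ** uni B' ** (flow k ** uni A) ** \<gamma> \<in> GLZ_saturation U"
      using visit[of B'] q by (simp add: matrix_mul_assoc)
    then have "flow (t * k) ** uni A' \<in> GLZ_saturation U"
      using t k(1) by (simp add: mult_GLZ_in_GLZ_saturation_iff \<gamma> flow_uni_shift A'_eq q_def)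
    moreover have "T \<le> t * k"
      using k mult_right_mono[OF t, of k] by linarith
    ultimately show ?thesis
      by (auto simp: never_visits_def)
  qed
  then show ?thesis by blast
qed

text \<open>A nondivergent orbit returns to a compact set of lattices; the fixed ball of unipotents that
  leads from a limit lattice to the target scales back to a fixed proportion of a ball around \<open>A\<close>.\<close>

lemma never_visits_density_deficit:
  fixes A :: "real^'n^'m" and U :: "(real^('m + 'n)^('m + 'n)) set"
  assumes U: "open U" "M \<in> U" "\<bar>det M\<bar> = 1" and A: "A \<notin> divergent"
  shows "\<exists>c>0. \<forall>e>0. \<exists>d. 0 < d \<and> d < e \<and>
    c * measure lebesgue (ball A d) \<le> measure lebesgue (ball A d - never_visits U T)"
proof -
  obtain k :: "nat \<Rightarrow> real" and h :: "real^('m + 'n)^('m + 'n)" and \<gamma>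
    where det_h: "\<bar>det h\<bar> = 1" and k: "\<And>i. k i \<ge> 1" "filterlim k at_top sequentially"
      and \<gamma>: "\<And>i. \<gamma> i \<in> GLZ" and h: "(\<lambda>i. flow (k i) ** uni A ** \<gamma> i) \<longlonglongrightarrow> h"
    using A by (rule nondivergent_limit_lattice) blast
  have "det h \<noteq> 0" "\<bar>det M\<bar> = \<bar>det h\<bar>"
    using det_h U(3) by auto
  then obtain t \<delta> H B where t: "t \<ge> 1" and \<delta>: "\<delta> > 0" and H: "open H" "h \<in> H"
    and visit: "\<And>B' Y. dist B B' < \<delta> \<Longrightarrow> Y \<in> H \<Longrightarrow> flow t ** uni B' ** Y \<in> GLZ_saturation U"
    using U(2,1) by (rule horosphere_dense_uniform) blast
  define q where "q = (\<lambda>i. expansion_rate TYPE('m) TYPE('n) (k i))"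
  have "k i \<le> q i" for i
    unfolding q_def using k(1) by (rule expansion_rate_ge)
  then have q: "filterlim q at_top sequentially"
    by (intro filterlim_at_top_mono[OF k(2)]) simp
  have "\<forall>\<^sub>F i in sequentially. flow (k i) ** uni A ** \<gamma> i \<in> H"
    by (rule topological_tendstoD[OF h H])
  moreover have "\<forall>\<^sub>F i in sequentially. k i \<ge> T"
    using k(2) unfolding filterlim_at_top by blast
  ultimately have "\<forall>\<^sub>F i in sequentially.
      ball (A + (1 / q i) *\<^sub>R B) (\<delta> / q i) \<inter> never_visits U T = {}"
  proof eventually_elim
    case (elim i)
    show ?case
      unfolding q_def using t k(1) elim(2) \<gamma> visit[OF _ elim(1)]
      by (rule ball_disjoint_never_visits)
  qed
  then show ?thesis
    by (rule shrinking_balls_deficit[OF q \<delta> closed_never_visits[OF U(1)]])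
qed

lemma negligible_never_visits:
  fixes U :: "(real^('m::finite + 'n::finite)^('m + 'n)) set"
  assumes U: "open U" "M \<in> U" "\<bar>det M\<bar> = 1"
  shows "negligible (never_visits U T :: (real^'n^'m) set)"
proof -
  have "never_visits U T \<in> sets lebesgue"
    using closed_never_visits[OF U(1)] by auto
  then have "negligible (never_visits U T - divergent)"
    using never_visits_density_deficit[OF U]
    by (intro negligible_density_deficit[of "never_visits U T"]) blast+
  then have "negligible ((never_visits U T - divergent) \<union> divergent)"
    using negligible_divergent by (rule negligible_Un)
  then show ?thesis
    by (rule negligible_subset) auto
qed

definition dense_orbit :: "real^'n^'m \<Rightarrow> bool" where
  "dense_orbit A \<longleftrightarrow> (\<forall>U. open U \<longrightarrow> (\<exists>M \<in> U. \<bar>det M\<bar> = 1) \<longrightarrow>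
    (\<exists>\<^sub>F t in at_top. flow t ** uni A \<in> GLZ_saturation U))"

theorem negligible_not_dense_orbit: "negligible {A :: real^'n^'m. \<not> dense_orbit A}"
proof -
  obtain \<B> :: "(real^('m + 'n)^('m + 'n)) set set" where \<B>: "countable \<B>" "topological_basis \<B>"
    using ex_countable_basis by blast
  define \<U> where "\<U> = {U \<in> \<B>. \<exists>M \<in> U. \<bar>det M\<bar> = 1}"
  have "\<exists>U \<in> \<U>. \<exists>T::nat. A \<in> never_visits U (real T)" if A: "\<not> dense_orbit A" for A :: "real^'n^'m"
  proof -
    obtain U M where U: "open U" "M \<in> U" "\<bar>det M\<bar> = 1"
      and avoids: "\<forall>\<^sub>F t in at_top. flow t ** uni A \<notin> GLZ_saturation U"
      using A by (auto simp: dense_orbit_def frequently_def)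
    obtain U' where U': "U' \<in> \<B>" "M \<in> U'" "U' \<subseteq> U"
      using topological_basisE[OF \<B>(2) U(1,2)] by blast
    obtain T0 where T0: "\<And>t. t \<ge> T0 \<Longrightarrow> flow t ** uni A \<notin> GLZ_saturation U"
      using avoids unfolding eventually_at_top_linorder by blast
    obtain T :: nat where "T0 \<le> real T"
      using real_arch_simple by blast
    then have "A \<in> never_visits U' (real T)"
      using T0 U'(3) by (fastforce simp: never_visits_def GLZ_saturation_def)
    then show ?thesis
      using U' U(3) by (auto simp: \<U>_def)
  qed
  then have "{A :: real^'n^'m. \<not> dense_orbit A} \<subseteq> (\<Union>U\<in>\<U>. \<Union>T::nat. never_visits U (real T))"
    by blast
  moreover have "negligible (\<Union>U\<in>\<U>. \<Union>T::nat. never_visits U (real T))"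
    using \<B> by (intro negligible_countable_Union countable_image)
      (auto simp: \<U>_def intro!: negligible_countable_Union negligible_never_visits
        dest: topological_basis_open)
  ultimately show ?thesis
    by (rule negligible_subset[rotated])
qed

section \<open>Norms and the critical covolume\<close>

lemma is_norm_0: "is_norm \<nu> \<Longrightarrow> \<nu> 0 = 0"
  by (simp add: is_norm_def)

lemma is_norm_scaleR: "is_norm \<nu> \<Longrightarrow> \<nu> (a *\<^sub>R x) = \<bar>a\<bar> * \<nu> x"
  by (simp add: is_norm_def)

lemma is_norm_pos: "is_norm \<nu> \<Longrightarrow> x \<noteq> 0 \<Longrightarrow> \<nu> x > 0"
  by (metis is_norm_def less_le)

lemma is_norm_triangle: "is_norm \<nu> \<Longrightarrow> \<nu> (x + y) \<le> \<nu> x + \<nu> y"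
  by (simp add: is_norm_def)

lemma is_norm_bounds:
  fixes \<nu> :: "'a::euclidean_space \<Rightarrow> real"
  assumes \<nu>: "is_norm \<nu>"
  obtains c C where "c > 0" "C > 0" "\<And>x. c * norm x \<le> \<nu> x" "\<And>x. \<nu> x \<le> C * norm x"
proof -
  have "convex_on UNIV \<nu>"
  proof (rule convex_onI)
    fix t x y assume "0 < t" "t < (1::real)"
    then show "\<nu> ((1 - t) *\<^sub>R x + t *\<^sub>R y) \<le> (1 - t) * \<nu> x + t * \<nu> y"
      using is_norm_triangle[OF \<nu>, of "(1 - t) *\<^sub>R x" "t *\<^sub>R y"] by (simp add: is_norm_scaleR[OF \<nu>])
  qed simp
  then have "continuous_on UNIV \<nu>"
    by (intro convex_on_continuous) auto
  then have cont: "continuous_on (sphere 0 1) \<nu>"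
    by (rule continuous_on_subset) simp
  have nonempty: "sphere 0 1 \<noteq> ({} :: 'a set)"
    by simp
  obtain a where a: "norm a = 1" "\<And>x. norm x = 1 \<Longrightarrow> \<nu> a \<le> \<nu> x"
    using continuous_attains_inf[OF compact_sphere nonempty cont] by auto
  obtain b where b: "norm b = 1" "\<And>x. norm x = 1 \<Longrightarrow> \<nu> x \<le> \<nu> b"
    using continuous_attains_sup[OF compact_sphere nonempty cont] by auto
  have "\<nu> a * norm x \<le> \<nu> x \<and> \<nu> x \<le> \<nu> b * norm x" for x
  proof (cases "x = 0")
    case False
    have "norm ((1 / norm x) *\<^sub>R x) = 1" "\<nu> x = norm x * \<nu> ((1 / norm x) *\<^sub>R x)"
      using False by (simp_all add: is_norm_scaleR[OF \<nu>])
    then show ?thesis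
      using a(2) b(2) by (metis mult.commute mult_left_mono norm_ge_zero)
  qed (simp add: is_norm_0[OF \<nu>])
  moreover have "\<nu> a > 0" "\<nu> b > 0"
    using a(1) b(1) by (auto intro!: is_norm_pos[OF \<nu>])
  ultimately show thesis
    using that by blast
qed

lemma is_norm_perturbation_le:
  fixes \<nu> :: "real^'k \<Rightarrow> real" and M N :: "real^'k^'k"
  assumes \<nu>: "c > 0" "C > 0" "\<And>x. c * norm x \<le> \<nu> x" "\<And>x. \<nu> x \<le> C * norm x"
    and M: "\<And>x. b * norm x \<le> norm (M *v x)" and \<theta>: "\<theta> \<ge> 0" "C * norm (M - N) \<le> \<theta> * (c * b)"
  shows "\<nu> ((M - N) *v z) \<le> \<theta> * \<nu> (M *v z)"
proof -
  have "\<nu> ((M - N) *v z) \<le> C * (norm (M - N) * norm z)"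
    using \<nu>(2) by (intro order_trans[OF \<nu>(4)] mult_left_mono norm_matrix_vector_mult_le) simp
  also have "\<dots> = (C * norm (M - N)) * norm z"
    by simp
  also have "\<dots> \<le> \<theta> * (c * b) * norm z"
    by (intro mult_right_mono \<theta>(2)) simp
  also have "\<dots> = \<theta> * (c * (b * norm z))"
    by simp
  also have "\<dots> \<le> \<theta> * (c * norm (M *v z))"
    using \<nu>(1) by (intro mult_left_mono M \<theta>(1)) simp
  also have "\<dots> \<le> \<theta> * \<nu> (M *v z)"
    by (intro mult_left_mono \<nu>(3) \<theta>(1))
  finally show ?thesis .
qed

lemma admissible_open_neighbourhood:
  fixes \<nu> :: "real^'k \<Rightarrow> real"
  assumes \<nu>: "is_norm \<nu>" and M: "M \<in> admissible \<nu> \<rho>" "det M \<noteq> 0" and r: "0 < r" "r < \<rho>"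
  obtains U where "open U" "M \<in> U" "U \<subseteq> admissible \<nu> r"
proof -
  obtain c C where c: "c > 0" "C > 0" "\<And>x. c * norm x \<le> \<nu> x" "\<And>x. \<nu> x \<le> C * norm x"
    using is_norm_bounds[OF \<nu>] by blast
  obtain b where b: "b > 0" "\<And>x. b * norm x \<le> norm (M *v x)"
    using matrix_bounded_below[OF M(2)] by blast
  define \<theta> where "\<theta> = 1 - r / \<rho>"
  define \<delta> where "\<delta> = \<theta> * (c * b) / C"
  have \<theta>: "\<theta> > 0"
    using r by (simp add: \<theta>_def)
  then have \<delta>: "\<delta> > 0" "C * \<delta> = \<theta> * (c * b)"
    using c(1,2) b(1) by (simp_all add: \<delta>_def)
  have "ball M \<delta> \<subseteq> admissible \<nu> r"
    unfolding admissible_def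
  proof (intro subsetI CollectI ballI)
    fix N and z :: "real^'k" assume N: "N \<in> ball M \<delta>" and z: "z \<in> int_vecs - {0}"
    have "C * norm (M - N) \<le> C * \<delta>"
      using N c(2) by (intro mult_left_mono) (auto simp: dist_norm)
    then have "\<nu> ((M - N) *v z) \<le> \<theta> * \<nu> (M *v z)"
      using \<theta> unfolding \<delta>(2) by (intro is_norm_perturbation_le[OF c b(2)]) simp_all
    moreover have "M *v z = N *v z + (M - N) *v z"
      by (simp add: matrix_vector_mult_diff_rdistrib)
    then have "\<nu> (M *v z) \<le> \<nu> (N *v z) + \<nu> ((M - N) *v z)"
      using is_norm_triangle[OF \<nu>] by metis
    ultimately have "r / \<rho> * \<nu> (M *v z) \<le> \<nu> (N *v z)"
      by (simp add: \<theta>_def algebra_simps)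
    moreover have "\<rho> \<le> \<nu> (M *v z)"
      using M(1) z by (simp add: admissible_def)
    then have "r / \<rho> * \<rho> \<le> r / \<rho> * \<nu> (M *v z)"
      using r by (intro mult_left_mono) auto
    ultimately show "r \<le> \<nu> (N *v z)"
      using r by simp
  qed
  then show thesis
    using that[of "ball M \<delta>"] \<delta>(1) by simp
qed

lemma lattice_avoids_nu_ball_iff:
  fixes \<nu> :: "real^'k \<Rightarrow> real"
  assumes \<nu>: "is_norm \<nu>" and L: "lattice_basis g L"
  shows "L \<inter> nu_ball \<nu> 1 = {0} \<longleftrightarrow> g \<in> admissible \<nu> 1"
proof -
  have zero: "0 \<in> L"
    using L by (auto simp: lattice_basis_def int_vecs_def intro!: image_eqI[of _ _ 0])
  have inj: "g *v z = 0 \<longleftrightarrow> z = 0" for z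
    using L
    by (auto simp: lattice_basis_def) (metis invertible_left_inverse matrix_left_invertible_ker)
  have "L \<inter> nu_ball \<nu> 1 = {0} \<longleftrightarrow> (\<forall>x \<in> L. x \<noteq> 0 \<longrightarrow> 1 \<le> \<nu> x)"
    using zero is_norm_0[OF \<nu>] unfolding nu_ball_def set_eq_iff
    by (metis (mono_tags, lifting) Int_iff mem_Collect_eq not_less singletonD singletonI
      zero_less_one)
  also have "\<dots> \<longleftrightarrow> g \<in> admissible \<nu> 1"
    using L inj by (auto simp: lattice_basis_def admissible_def)
  finally show ?thesis .
qed

lemma critical_covolume_eq_Inf_admissible:
  fixes \<nu> :: "real^'k \<Rightarrow> real"
  assumes "is_norm \<nu>"
  shows "critical_covolume \<nu> = Inf ((\<lambda>g. \<bar>det g\<bar>) ` {g \<in> admissible \<nu> 1. det g \<noteq> 0})"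
proof -
  have "{covolume L | L. is_lattice L \<and> L \<inter> nu_ball \<nu> 1 = {0}}
      = (\<lambda>g. \<bar>det g\<bar>) ` {g \<in> admissible \<nu> 1. det g \<noteq> 0}"
  proof (intro equalityI subsetI)
    fix v assume "v \<in> {covolume L | L. is_lattice L \<and> L \<inter> nu_ball \<nu> 1 = {0}}"
    then obtain L g where "lattice_basis g L" "L \<inter> nu_ball \<nu> 1 = {0}" "v = \<bar>det g\<bar>"
      using covolume_eq by (auto simp: is_lattice_def)
    then show "v \<in> (\<lambda>g. \<bar>det g\<bar>) ` {g \<in> admissible \<nu> 1. det g \<noteq> 0}"
      using lattice_avoids_nu_ball_iff[OF assms] by (auto simp: lattice_basis_def invertible_det_nz)
  next
    fix v assume "v \<in> (\<lambda>g. \<bar>det g\<bar>) ` {g \<in> admissible \<nu> 1. det g \<noteq> 0}"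
    then obtain g where g: "g \<in> admissible \<nu> 1" "det g \<noteq> 0" "v = \<bar>det g\<bar>"
      by blast
    then have basis: "lattice_basis g ((*v) g ` int_vecs)"
      by (simp add: lattice_basis_def invertible_det_nz)
    have "v = covolume ((*v) g ` int_vecs)" "is_lattice ((*v) g ` int_vecs)"
      using g(3) covolume_eq[OF basis] basis by (auto simp: is_lattice_def)
    moreover have "(*v) g ` int_vecs \<inter> nu_ball \<nu> 1 = {0}"
      using g(1) lattice_avoids_nu_ball_iff[OF assms basis] by simp
    ultimately show "v \<in> {covolume L | L. is_lattice L \<and> L \<inter> nu_ball \<nu> 1 = {0}}"
      by blast
  qed
  then show ?thesis
    by (simp add: critical_covolume_def)
qed

lemma exists_admissible:
  fixes \<nu> :: "real^'k \<Rightarrow> real"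
  assumes \<nu>: "is_norm \<nu>"
  shows "\<exists>g \<in> admissible \<nu> 1. det g \<noteq> 0"
proof -
  obtain c C where c: "c > 0" "C > 0" "\<And>x. c * norm x \<le> \<nu> x" "\<And>x. \<nu> x \<le> C * norm x"
    using is_norm_bounds[OF \<nu>] by blast
  have "1 \<le> \<nu> (diag_mat (\<lambda>_. 1 / c) *v z)" if "z \<in> int_vecs - {0}" for z
  proof -
    have "diag_mat (\<lambda>_. 1 / c) *v z = (1 / c) *\<^sub>R z"
      by (simp add: vec_eq_iff diag_mat_vec)
    moreover have "1 \<le> norm z"
      using that by (rule int_vecs_norm_ge_1)
    ultimately show ?thesis
      using c(1) c(3)[of "(1 / c) *\<^sub>R z"] by simp
  qed
  then show ?thesis
    using c(1)
    by (intro bexI[of _ "diag_mat (\<lambda>_. 1 / c)"]) (simp_all add: admissible_def det_diag_mat)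
qed

lemma critical_covolume_pos:
  fixes \<nu> :: "real^'k \<Rightarrow> real"
  assumes \<nu>: "is_norm \<nu>"
  shows "critical_covolume \<nu> > 0"
proof -
  obtain c C where C: "c > 0" "C > 0" "\<And>x. c * norm x \<le> \<nu> x" "\<And>x. \<nu> x \<le> C * norm x"
    using is_norm_bounds[OF \<nu>] by blast
  define \<epsilon> where "\<epsilon> = (1 / C / real CARD('k)) ^ CARD('k)"
  have "\<epsilon> \<le> \<bar>det g\<bar>" if g: "g \<in> admissible \<nu> 1" "det g \<noteq> 0" for g
  proof -
    have "1 / C \<le> norm (g *v z)" if "z \<in> int_vecs - {0}" for z
      using g(1) that C(2) order_trans[OF _ C(4)[of "g *v z"], of 1]
      by (simp add: admissible_def pos_divide_le_eq mult.commute)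
    then show ?thesis
      unfolding \<epsilon>_def using C(2) g(2) by (intro admissible_norm_det_ge) (auto simp: admissible_def)
  qed
  then have "\<epsilon> \<le> critical_covolume \<nu>"
    unfolding critical_covolume_eq_Inf_admissible[OF \<nu>] using exists_admissible[OF \<nu>]
    by (intro cInf_greatest) auto
  moreover have "\<epsilon> > 0"
    using C(2) by (simp add: \<epsilon>_def)
  ultimately show ?thesis by linarith
qed

lemma critical_covolume_lessD:
  fixes \<nu> :: "real^'k \<Rightarrow> real"
  assumes "is_norm \<nu>" "critical_covolume \<nu> < v"
  shows "\<exists>g \<in> admissible \<nu> 1. det g \<noteq> 0 \<and> \<bar>det g\<bar> < v"
  using assms exists_admissible[OF assms(1)]
  by (force simp: critical_covolume_eq_Inf_admissible dest!: cInf_lessD[rotated])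

definition critical_radius :: "(real^'k \<Rightarrow> real) \<Rightarrow> real" where
  "critical_radius \<nu> = critical_covolume \<nu> powr (- 1 / real CARD('k))"

lemma critical_radius_pos: "is_norm \<nu> \<Longrightarrow> critical_radius \<nu> > 0"
  using critical_covolume_pos[of \<nu>] by (simp add: critical_radius_def)

lemma critical_covolume_mult_radius_power:
  fixes \<nu> :: "real^'k \<Rightarrow> real"
  assumes "is_norm \<nu>"
  shows "critical_covolume \<nu> * critical_radius \<nu> ^ CARD('k) = 1"
proof -
  have "critical_radius \<nu> ^ CARD('k) = critical_radius \<nu> powr real CARD('k)"
    using critical_radius_pos[OF assms] by (rule powr_realpow[symmetric])
  also have "\<dots> = critical_covolume \<nu> powr - 1"
    by (simp add: critical_radius_def powr_powr)
  also have "\<dots> = 1 / critical_covolume \<nu>"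
    using critical_covolume_pos[OF assms] by (simp add: powr_minus_divide)
  finally show ?thesis
    using critical_covolume_pos[OF assms] by simp
qed

section \<open>Improvability of Dirichlet's theorem\<close>

lemma exists_larger_root:
  fixes r x :: real
  assumes "d > 0" "r \<ge> 0" "r ^ d < x"
  obtains \<rho> where "r < \<rho>" "\<rho> ^ d = x"
proof -
  have "0 \<le> x"
    using assms(2,3) by (meson less_imp_le order_trans zero_le_power)
  then have "root d x \<ge> 0" "root d x ^ d = x"
    using assms(1) by (simp_all add: real_root_ge_zero)
  moreover have "r < root d x"
    using assms calculation by (metis power_less_imp_less_base)
  ultimately show thesis
    using that by blast
qed

lemma exists_contracted_admissible:
  fixes \<nu> :: "real^('m::finite + 'n::finite) \<Rightarrow> real"
  assumes \<nu>: "is_norm \<nu>" and c: "0 < c" "c < 1"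
  obtains M \<rho> where "\<bar>det M\<bar> = 1" "critical_radius \<nu> < \<rho>"
    "block_diag (1 / c) 1 ** M \<in> admissible \<nu> \<rho>"
proof -
  define d where "d = CARD('m + 'n)"
  define r where "r = critical_radius \<nu>"
  have r: "r > 0" "critical_covolume \<nu> * r ^ d = 1"
    using critical_radius_pos[OF \<nu>] critical_covolume_mult_radius_power[OF \<nu>]
    by (simp_all add: r_def d_def)
  have c_power: "0 < c ^ CARD('m)" "c ^ CARD('m) < 1"
    using power_strict_decreasing[of 0 "CARD('m)" c] c by simp_all
  have "critical_covolume \<nu> = 1 / r ^ d"
    using r by (simp add: field_simps)
  also have "\<dots> < 1 / (c ^ CARD('m) * r ^ d)"
    using c_power r(1) by (simp add: field_simps)
  finally obtain g where g: "g \<in> admissible \<nu> 1" "det g \<noteq> 0" "\<bar>det g\<bar> < 1 / (c ^ CARD('m) * r ^ d)"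
    using critical_covolume_lessD[OF \<nu>] by blast
  have "r ^ d < 1 / (c ^ CARD('m) * \<bar>det g\<bar>)"
    using g c_power r(1) by (simp add: field_simps)
  then obtain \<rho> where \<rho>: "r < \<rho>" "\<rho> ^ d = 1 / (c ^ CARD('m) * \<bar>det g\<bar>)"
    using r(1) exists_larger_root[of d r] by (auto simp: d_def zero_less_card_finite)
  define M where "M = block_diag (c * \<rho>) \<rho> ** g"
  have "\<bar>det M\<bar> = c ^ CARD('m) * \<rho> ^ d * \<bar>det g\<bar>"
    using c \<rho>(1) r(1)
    by (simp add: M_def det_mul det_block_diag abs_mult power_mult_distrib power_add d_def)
  then have "\<bar>det M\<bar> = 1"
    using c c_power g(2) by (simp add: \<rho>(2))
  moreover have "block_diag (1 / c) 1 ** M = block_diag \<rho> \<rho> ** g"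
    using c by (simp add: M_def matrix_mul_assoc block_diag_mult)
  moreover have "block_diag \<rho> \<rho> *v x = \<rho> *\<^sub>R x" for x :: "real^('m + 'n)"
    by (intro vec_sum_eqI) (simp_all add: block_diag_vec)
  ultimately have "block_diag (1 / c) 1 ** M \<in> admissible \<nu> \<rho>"
    using g(1) \<rho>(1) r(1)
    by (auto simp: admissible_def is_norm_scaleR[OF \<nu>] simp flip: matrix_vector_mul_assoc)
  with \<open>\<bar>det M\<bar> = 1\<close> \<rho>(1) show thesis
    using that by (simp add: r_def)
qed

lemma join_vec_eq_uni:
  fixes A :: "real^'n^'m"
  shows "join_vec (A *v q - p) q = uni A *v join_vec (- p) q"
  by (intro vec_sum_eqI) (simp_all add: uni_vec join_vec_def matrix_vector_mult_def[of A])

lemma join_vec_in_int_vecs: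
  assumes "p \<in> int_vecs" "q \<in> int_vecs - {0}"
  shows "join_vec (- p) q \<in> int_vecs - {0}"
proof -
  have "join_vec (- p) q $ i \<in> \<int>" for i
    using assms by (cases i) (auto simp: join_vec_def int_vecs_def)
  moreover obtain j where "q $ j \<noteq> 0"
    using assms(2) by (auto simp: vec_eq_iff)
  then have "join_vec (- p) q $ Inr j \<noteq> 0"
    by (simp add: join_vec_def)
  ultimately show ?thesis
    by (auto simp: int_vecs_def)
qed

lemma D_set_eventually_inadmissible:
  fixes \<nu> :: "real^('m::finite + 'n::finite) \<Rightarrow> real" and A :: "real^'n^'m"
  assumes c: "c > 0" and A: "A \<in> D_set \<nu> (\<lambda>t. c * psi_exp (real CARD('n) / real CARD('m)) t)"
  shows "\<forall>\<^sub>F t in at_top.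
    block_diag (1 / c) 1 ** (flow t ** uni A) \<notin> admissible \<nu> (critical_radius \<nu>)"
proof -
  have "\<forall>\<^sub>F t in at_top. \<exists>q \<in> int_vecs - {0}. \<exists>p \<in> int_vecs.
     join_vec (A *v q - p) q \<in>
       (\<lambda>x. block_diag (c * psi_exp (real CARD('n) / real CARD('m)) t) t *v x) `
       nu_ball \<nu> (critical_radius \<nu>)"
    using A by (simp add: D_set_def critical_radius_def)
  then show ?thesis
    using eventually_gt_at_top[of 0]
  proof eventually_elim
    case (elim t)
    define \<alpha> where "\<alpha> = real CARD('n) / real CARD('m)"
    obtain q p x where q: "q \<in> int_vecs - {0}" and p: "p \<in> int_vecs"
        and x: "\<nu> x < critical_radius \<nu>"
      and eq: "join_vec (A *v q - p) q = block_diag (c * t powr - \<alpha>) t *v x"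
      using elim(1) by (auto simp: nu_ball_def psi_exp_def \<alpha>_def)
    have "block_diag (1 / c) 1 ** (flow t ** uni A) *v join_vec (- p) q =
        (block_diag (1 / c) 1 ** (flow t ** block_diag (c * t powr - \<alpha>) t)) *v x"
      using eq by (simp add: join_vec_eq_uni flip: matrix_vector_mul_assoc)
    also have "block_diag (1 / c) 1 ** (flow t ** block_diag (c * t powr - \<alpha>) t) =
        (mat 1 :: real^('m + 'n)^('m + 'n))"
      using c elim(2) by (simp add: flow_def block_diag_mult powr_minus \<alpha>_def block_diag_1)
    finally show ?case
      using x join_vec_in_int_vecs[OF p q] by (force simp: admissible_def)
  qed
qed

lemma D_set_not_dense_orbit:
  fixes \<nu> :: "real^('m::finite + 'n::finite) \<Rightarrow> real" and A :: "real^'n^'m"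
  assumes \<nu>: "is_norm \<nu>" and c: "0 < c" "c < 1"
    and A: "A \<in> D_set \<nu> (\<lambda>t. c * psi_exp (real CARD('n) / real CARD('m)) t)"
  shows "\<not> dense_orbit A"
proof
  assume dense: "dense_orbit A"
  define D where "D = (block_diag (1 / c) 1 :: real^('m + 'n)^('m + 'n))"
  obtain M \<rho> where M: "\<bar>det M\<bar> = 1" "critical_radius \<nu> < \<rho>" "D ** M \<in> admissible \<nu> \<rho>"
    unfolding D_def using exists_contracted_admissible[OF \<nu> c] by blast
  have "det (D ** M) \<noteq> 0"
    using M(1) c(1) by (auto simp: D_def det_mul det_block_diag)
  then obtain U where U: "open U" "D ** M \<in> U" "U \<subseteq> admissible \<nu> (critical_radius \<nu>)"
    using admissible_open_neighbourhood[OF \<nu> M(3) _ critical_radius_pos[OF \<nu>] M(2)] by blast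
  have "open ((\<lambda>X. D ** X) -` U)"
    using U(1) by (intro open_vimage continuous_intros)
  then have "\<exists>\<^sub>F t in at_top. flow t ** uni A \<in> GLZ_saturation ((\<lambda>X. D ** X) -` U)"
    using dense M(1) U(2) unfolding dense_orbit_def by blast
  then have "\<exists>\<^sub>F t in at_top. D ** (flow t ** uni A) \<in> admissible \<nu> (critical_radius \<nu>)"
  proof (rule frequently_elim1)
    fix t assume "flow t ** uni A \<in> GLZ_saturation ((\<lambda>X. D ** X) -` U)"
    then obtain \<gamma> where "\<gamma> \<in> GLZ" "D ** (flow t ** uni A) ** \<gamma> \<in> admissible \<nu> (critical_radius \<nu>)"
      using U(3) by (auto simp: GLZ_saturation_def matrix_mul_assoc)
    then show "D ** (flow t ** uni A) \<in> admissible \<nu> (critical_radius \<nu>)"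
      by (simp add: admissible_mult_GLZ_iff)
  qed
  then show False
    using D_set_eventually_inadmissible[OF c(1) A] by (simp add: frequently_def D_def)
qed

theorem theorem3p1:
  fixes \<nu> :: "real^('m::finite + 'n::finite) \<Rightarrow> real"
  assumes "is_norm \<nu>"
  shows "(D_hat \<nu> :: (real^'n^'m) set) \<in> null_sets lebesgue"
proof -
  have "D_hat \<nu> \<subseteq> {A :: real^'n^'m. \<not> dense_orbit A}"
    using D_set_not_dense_orbit[OF assms] by (auto simp: D_hat_def)
  then have "negligible (D_hat \<nu> :: (real^'n^'m) set)"
    by (rule negligible_subset[OF negligible_not_dense_orbit])
  then show ?thesis
    by (simp add: negligible_iff_null_sets)
qed

end
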